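(* Let $G$ be a Carnot group with polyhedral norm, with Lie algebra $\mathfrak g$, and let $\pi:G\to G/[G,G]$ be the projection to the abelianization. (i) Normal curves in $G$ are locally length-minimizing. (ii) More quantitatively, fixing a norm $N^*$ on the dual $\mathfrak g^*$, there exists $\alpha>0$ such that for every normal curve $\gamma:[0,1]\to G$ of length $1$ and with associated covector $\lambda\in\mathfrak g^*$, the curve $\pi\circ\gamma|_J$ is length-minimizing in $G/[G,G]$ for each interval $J\subseteq[0,1]$ satisfying $|J|\le\frac{\alpha}{N^*(\lambda)}$.
   Context: A (sub-Finsler) Carnot group is a simply connected Lie group $G$ whose Lie algebra has a stratification $\mathfrak g=V_1\oplus\dots\oplus V_s$ with $[V_1,V_j]=V_{j+1}$ ($V_{s+1}=0$), polarized by $V:=V_1$ and equipped with a norm $\|\cdot\|$ on $V$. The norm is polyhedral if its closed unit ball is the convex hull of finitely many points. The abelianization $G/[G,G]$ is a vector space identified with $V$ through $\mathrm d\pi$, carrying the norm that makes $\pi$ a submetry (i.e. $\pi$ maps closed balls onto closed balls of the same radius), namely $\|\cdot\|$. An absolutely continuous curve $\gamma:I\to G$ is horizontal if $\dot\gamma(t)\in \mathrm dL_{\gamma(t)}V$ for a.e. $t$ ($L$ = left translation); its control is $u(t)=\mathrm dL_{\gamma(t)}^{-1}\dot\gamma(t)\in V$ and its length is $\int_I\|u(t)\|\,\mathrm dt$. The distance $d(g,h)$ is the infimum of lengths of horizontal curves from $g$ to $h$. A curve is length-minimizing if its length equals the distance between its endpoints, and locally length-minimizing if every time has a neighborhood in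 the domain on which the restriction is length-minimizing. The energy is $\mathrm E:V\to\mathbb R$, $\mathrm E(v)=\frac12\|v\|^2$. The subdifferential of $\mathrm E$ at $w\in V$ is $\partial_w\mathrm E=\{\eta\in V^*:\eta(v-w)\le \mathrm E(v)-\mathrm E(w)\ \forall v\in V\}$. A horizontal curve $\gamma:I\to G$ with control $u\in L^2(I,V)$ is a normal curve if there exists $\lambda\in\mathfrak g^*$ with $\lambda\circ\mathrm{Ad}_{\gamma(t)}|_V\in\partial_{u(t)}\mathrm E$ for a.e. $t\in I$; each such $\lambda$ is called a covector associated to $\gamma$. (Normal curves have constant speed.) The size $|J|$ of an interval is the distance between its endpoints.
   Formalization: In (ii) the bound uses N*(λ∘Ad_{γ(0)}) in place of N*(λ): the same when γ starts at the identity. For arbitrary starting points the bound with N*(λ) fails, e.g. in the free nilpotent group of rank 3 and step 3 with the ℓ¹ norm. *)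

theory Defs
  imports "HOL-Analysis.Analysis" "HOL-Algebra.Generated_Groups"
begin

section \<open>Smooth maps and smooth manifolds\<close>

text \<open>\<open>C\<^sup>k\<close> and \<open>C\<^sup>\<infinity>\<close> maps on open subsets of Euclidean spaces.\<close>

primrec Ck_on :: "nat \<Rightarrow> 'a::euclidean_space set \<Rightarrow> ('a \<Rightarrow> 'b::real_normed_vector) \<Rightarrow> bool" where
  "Ck_on 0 S f \<longleftrightarrow> continuous_on S f"
| "Ck_on (Suc k) S f \<longleftrightarrow>
     (\<forall>x\<in>S. f differentiable (at x)) \<and> (\<forall>v. Ck_on k S (\<lambda>x. frechet_derivative f (at x) v))"

definition smooth_on :: "'a::euclidean_space set \<Rightarrow> ('a \<Rightarrow> 'b::real_normed_vector) \<Rightarrow> bool" where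
  "smooth_on S f \<longleftrightarrow> (\<forall>k. Ck_on k S f)"

text \<open>A chart is a pair of an open domain and a map that is only relevant on that domain.\<close>

type_synonym ('m, 'a) chart = "'m set \<times> ('m \<Rightarrow> 'a)"

definition chart_inv :: "('m, 'a) chart \<Rightarrow> 'a \<Rightarrow> 'm" where
  "chart_inv c = inv_into (fst c) (snd c)"

definition is_chart :: "('m::topological_space, 'a::euclidean_space) chart \<Rightarrow> bool" where
  "is_chart c \<longleftrightarrow> open (fst c) \<and> open (snd c ` fst c) \<and>
     homeomorphism (fst c) (snd c ` fst c) (snd c) (chart_inv c)"

definition smooth_atlas :: "('m::topological_space, 'a::euclidean_space) chart set \<Rightarrow> bool" where
  "smooth_atlas A \<longleftrightarrow> (\<forall>c\<in>A. is_chart c) \<and> (\<Union>c\<in>A. fst c) = UNIV \<and>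
     (\<forall>c\<in>A. \<forall>c'\<in>A. smooth_on (snd c ` (fst c \<inter> fst c')) (snd c' \<circ> chart_inv c))"

definition prod_atlas ::
  "('m, 'a) chart set \<Rightarrow> ('n, 'b) chart set \<Rightarrow> ('m \<times> 'n, 'a \<times> 'b) chart set" where
  "prod_atlas A B = (\<lambda>(c, d). (fst c \<times> fst d, map_prod (snd c) (snd d))) ` (A \<times> B)"

definition smooth_map ::
  "('m::topological_space, 'a::euclidean_space) chart set \<Rightarrow>
   ('n::topological_space, 'b::euclidean_space) chart set \<Rightarrow> ('m \<Rightarrow> 'n) \<Rightarrow> bool" where
  "smooth_map A B f \<longleftrightarrow> continuous_on UNIV f \<and>
     (\<forall>c\<in>A. \<forall>d\<in>B. smooth_on (snd c ` (fst c \<inter> f -` fst d)) (snd d \<circ> f \<circ> chart_inv c))"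


section \<open>Lie groups\<close>

text \<open>
  The underlying manifold is the whole type \<open>'g\<close> with its type-class topology. The chart
  \<open>echart\<close> around the identity is used to identify the tangent space at the identity, i.e. the
  Lie algebra, with the model space \<open>'a\<close>.
\<close>

record ('g, 'a) lie_group_data = "'g monoid" +
  atlas :: "('g, 'a) chart set"
  echart :: "('g, 'a) chart"

locale lie_group = group G
  for G :: "('g::{t2_space, second_countable_topology}, 'a::euclidean_space, 'm)
              lie_group_data_scheme" (structure) +
  assumes carrier_UNIV: "carrier G = UNIV"
    and smooth_atlas: "smooth_atlas (atlas G)"
    and echart_in_atlas: "echart G \<in> atlas G"
    and one_in_echart: "\<one> \<in> fst (echart G)"
    and smooth_mult: "smooth_map (prod_atlas (atlas G) (atlas G)) (atlas G) (\<lambda>(x, y). x \<otimes> y)"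
    and smooth_inv: "smooth_map (atlas G) (atlas G) (\<lambda>x. inv x)"

abbreviation ecoord :: "('g, 'a, 'm) lie_group_data_scheme \<Rightarrow> 'g \<Rightarrow> 'a" where
  "ecoord G \<equiv> snd (echart G)"

abbreviation ecoord_inv :: "('g, 'a, 'm) lie_group_data_scheme \<Rightarrow> 'a \<Rightarrow> 'g" where
  "ecoord_inv G \<equiv> chart_inv (echart G)"

text \<open>\<open>Ad\<^sub>g\<close> is the differential at the identity of the conjugation by \<open>g\<close>.\<close>

definition Ad :: "('g, 'a::euclidean_space, 'm) lie_group_data_scheme \<Rightarrow> 'g \<Rightarrow> 'a \<Rightarrow> 'a" where
  "Ad G g = frechet_derivative
     (\<lambda>x. ecoord G (g \<otimes>\<^bsub>G\<^esub> ecoord_inv G x \<otimes>\<^bsub>G\<^esub> inv\<^bsub>G\<^esub> g)) (at (ecoord G \<one>\<^bsub>G\<^esub>))"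

text \<open>The Lie bracket is \<open>[X, Y] = ad X Y\<close>, where \<open>ad\<close> is the differential of \<open>Ad\<close> at the identity.\<close>

definition lie_bracket ::
  "('g, 'a::euclidean_space, 'm) lie_group_data_scheme \<Rightarrow> 'a \<Rightarrow> 'a \<Rightarrow> 'a" where
  "lie_bracket G X Y =
     frechet_derivative (\<lambda>x. Ad G (ecoord_inv G x) Y) (at (ecoord G \<one>\<^bsub>G\<^esub>)) X"


section \<open>Carnot groups and norms\<close>

text \<open>
  \<open>L j\<close> is the layer \<open>V\<^sub>j\<close>; only the indices \<open>1, \<dots>, s + 1\<close> are used.
\<close>

definition stratification ::
  "('g, 'a::euclidean_space, 'm) lie_group_data_scheme \<Rightarrow> nat \<Rightarrow> (nat \<Rightarrow> 'a set) \<Rightarrow> bool" where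
  "stratification G s L \<longleftrightarrow> s \<ge> 1 \<and> (\<forall>j\<in>{1..s}. subspace (L j)) \<and> L (Suc s) = {0} \<and>
     (\<forall>x. \<exists>!f. f \<in> (\<Pi>\<^sub>E j\<in>{1..s}. L j) \<and> x = (\<Sum>j=1..s. f j)) \<and>
     (\<forall>j\<in>{1..s}. span {lie_bracket G X Y | X Y. X \<in> L 1 \<and> Y \<in> L j} = L (Suc j))"

definition carnot_group ::
  "('g::{t2_space, second_countable_topology}, 'a::euclidean_space, 'm) lie_group_data_scheme \<Rightarrow>
   nat \<Rightarrow> (nat \<Rightarrow> 'a set) \<Rightarrow> bool" where
  "carnot_group G s L \<longleftrightarrow>
     lie_group G \<and> simply_connected (UNIV :: 'g set) \<and> stratification G s L"

definition norm_on :: "'v::real_vector set \<Rightarrow> ('v \<Rightarrow> real) \<Rightarrow> bool" where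
  "norm_on V N \<longleftrightarrow> subspace V \<and> (\<forall>x\<in>V. N x \<ge> 0 \<and> (N x = 0 \<longleftrightarrow> x = 0)) \<and>
     (\<forall>c. \<forall>x\<in>V. N (c *\<^sub>R x) = \<bar>c\<bar> * N x) \<and> (\<forall>x\<in>V. \<forall>y\<in>V. N (x + y) \<le> N x + N y)"

definition polyhedral :: "'v::real_vector set \<Rightarrow> ('v \<Rightarrow> real) \<Rightarrow> bool" where
  "polyhedral V N \<longleftrightarrow> (\<exists>F. finite F \<and> {x\<in>V. N x \<le> 1} = convex hull F)"


section \<open>Horizontal curves and length\<close>

definition abs_continuous_on :: "real set \<Rightarrow> (real \<Rightarrow> 'b::real_normed_vector) \<Rightarrow> bool" where
  "abs_continuous_on J f \<longleftrightarrow> (\<forall>\<epsilon>>0. \<exists>\<delta>>0. \<forall>D. finite D \<and>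
     (\<forall>(x, y)\<in>D. x \<le> y \<and> {x..y} \<subseteq> J) \<and>
     pairwise (\<lambda>p q. disjnt {fst p<..<snd p} {fst q<..<snd q}) D \<and>
     (\<Sum>(x, y)\<in>D. y - x) < \<delta> \<longrightarrow> (\<Sum>(x, y)\<in>D. norm (f y - f x)) < \<epsilon>)"

text \<open>
  On a non-compact interval, absolute continuity is understood locally, i.e. on compact
  subintervals.
\<close>

definition ac_curve ::
  "('g::topological_space, 'a::euclidean_space, 'm) lie_group_data_scheme \<Rightarrow>
   real set \<Rightarrow> (real \<Rightarrow> 'g) \<Rightarrow> bool" where
  "ac_curve G I \<gamma> \<longleftrightarrow> is_interval I \<and> continuous_on I \<gamma> \<and>
     (\<forall>c\<in>atlas G. \<forall>a b. {a..b} \<subseteq> I \<and> \<gamma> ` {a..b} \<subseteq> fst c \<longrightarrow>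
        abs_continuous_on {a..b} (snd c \<circ> \<gamma>))"

text \<open>
  \<open>left_shift G \<gamma> t\<close> is the curve \<open>L\<^bsub>\<gamma>(t)\<^esub>\<^sup>-\<^sup>1 \<circ> \<gamma>\<close>, which passes through the identity at time
  \<open>t\<close>, read in the chart around the identity; its velocity at time \<open>t\<close> is
  \<open>dL\<^bsub>\<gamma>(t)\<^esub>\<^sup>-\<^sup>1 \<gamma>'(t)\<close>.
\<close>

definition left_shift ::
  "('g, 'a, 'm) lie_group_data_scheme \<Rightarrow> (real \<Rightarrow> 'g) \<Rightarrow> real \<Rightarrow> real \<Rightarrow> 'a" where
  "left_shift G \<gamma> t = (\<lambda>r. ecoord G (inv\<^bsub>G\<^esub> (\<gamma> t) \<otimes>\<^bsub>G\<^esub> \<gamma> r))"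

definition control ::
  "('g, 'a::euclidean_space, 'm) lie_group_data_scheme \<Rightarrow> real set \<Rightarrow> (real \<Rightarrow> 'g) \<Rightarrow> real \<Rightarrow> 'a"
  where
  "control G I \<gamma> t = vector_derivative (left_shift G \<gamma> t) (at t within I)"

definition horizontal ::
  "('g::topological_space, 'a::euclidean_space, 'm) lie_group_data_scheme \<Rightarrow> 'a set \<Rightarrow>
   real set \<Rightarrow> (real \<Rightarrow> 'g) \<Rightarrow> bool" where
  "horizontal G V I \<gamma> \<longleftrightarrow> ac_curve G I \<gamma> \<and>
     (AE t in lebesgue_on I. left_shift G \<gamma> t differentiable (at t within I) \<and> control G I \<gamma> t \<in> V)"

definition curve_length ::
  "('g, 'a::euclidean_space, 'm) lie_group_data_scheme \<Rightarrow> ('a \<Rightarrow> real) \<Rightarrow>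
   real set \<Rightarrow> (real \<Rightarrow> 'g) \<Rightarrow> ennreal" where
  "curve_length G N I \<gamma> = (\<integral>\<^sup>+t. ennreal (N (control G I \<gamma> t)) \<partial>lebesgue_on I)"

definition cc_dist ::
  "('g::topological_space, 'a::euclidean_space, 'm) lie_group_data_scheme \<Rightarrow> 'a set \<Rightarrow>
   ('a \<Rightarrow> real) \<Rightarrow> 'g \<Rightarrow> 'g \<Rightarrow> ennreal" where
  "cc_dist G V N g h = Inf {curve_length G N {a..b} \<gamma> | a b \<gamma>.
     a \<le> b \<and> horizontal G V {a..b} \<gamma> \<and> \<gamma> a = g \<and> \<gamma> b = h}"

definition length_minimizing ::
  "('g::topological_space, 'a::euclidean_space, 'm) lie_group_data_scheme \<Rightarrow> 'a set \<Rightarrow>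
   ('a \<Rightarrow> real) \<Rightarrow> real \<Rightarrow> real \<Rightarrow> (real \<Rightarrow> 'g) \<Rightarrow> bool" where
  "length_minimizing G V N a b \<gamma> \<longleftrightarrow> a \<le> b \<and> horizontal G V {a..b} \<gamma> \<and>
     curve_length G N {a..b} \<gamma> = cc_dist G V N (\<gamma> a) (\<gamma> b)"

definition locally_length_minimizing ::
  "('g::topological_space, 'a::euclidean_space, 'm) lie_group_data_scheme \<Rightarrow> 'a set \<Rightarrow>
   ('a \<Rightarrow> real) \<Rightarrow> real set \<Rightarrow> (real \<Rightarrow> 'g) \<Rightarrow> bool" where
  "locally_length_minimizing G V N I \<gamma> \<longleftrightarrow> (\<forall>t\<in>I. \<exists>a b. t \<in> {a..b} \<and> {a..b} \<subseteq> I \<and>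
     (\<exists>\<epsilon>>0. ball t \<epsilon> \<inter> I \<subseteq> {a..b}) \<and> length_minimizing G V N a b \<gamma>)"


section \<open>Normal curves\<close>

definition energy :: "('v \<Rightarrow> real) \<Rightarrow> 'v \<Rightarrow> real" where
  "energy N v = (N v)\<^sup>2 / 2"

text \<open>
  An element of \<open>V\<^sup>*\<close> is represented by its linear extensions to the ambient space: only the values
  on \<open>V\<close> matter.
\<close>

definition subdifferential ::
  "'v::real_vector set \<Rightarrow> ('v \<Rightarrow> real) \<Rightarrow> 'v \<Rightarrow> ('v \<Rightarrow> real) set" where
  "subdifferential V f w = {\<eta>. linear \<eta> \<and> (\<forall>v\<in>V. \<eta> (v - w) \<le> f v - f w)}"

definition L2_on :: "real set \<Rightarrow> (real \<Rightarrow> 'b::euclidean_space) \<Rightarrow> bool" where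
  "L2_on I u \<longleftrightarrow> u \<in> borel_measurable (lebesgue_on I) \<and>
     integrable (lebesgue_on I) (\<lambda>t. (norm (u t))\<^sup>2)"

definition associated_covector ::
  "('g::topological_space, 'a::euclidean_space, 'm) lie_group_data_scheme \<Rightarrow> 'a set \<Rightarrow>
   ('a \<Rightarrow> real) \<Rightarrow> real set \<Rightarrow> (real \<Rightarrow> 'g) \<Rightarrow> ('a \<Rightarrow>\<^sub>L real) \<Rightarrow> bool" where
  "associated_covector G V N I \<gamma> \<xi> \<longleftrightarrow>
     (AE t in lebesgue_on I.
        blinfun_apply \<xi> \<circ> Ad G (\<gamma> t) \<in> subdifferential V (energy N) (control G I \<gamma> t))"

definition normal_curve ::
  "('g::topological_space, 'a::euclidean_space, 'm) lie_group_data_scheme \<Rightarrow> 'a set \<Rightarrow>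
   ('a \<Rightarrow> real) \<Rightarrow> real set \<Rightarrow> (real \<Rightarrow> 'g) \<Rightarrow> bool" where
  "normal_curve G V N I \<gamma> \<longleftrightarrow> horizontal G V I \<gamma> \<and> L2_on I (control G I \<gamma>) \<and>
     (\<exists>\<xi>. associated_covector G V N I \<gamma> \<xi>)"

text \<open>
  \<open>coAd G g \<xi> = \<xi> \<circ> Ad\<^sub>g\<close>. If \<open>\<xi>\<close> is a covector associated to \<open>\<gamma>\<close>, then \<open>coAd G (\<gamma> 0) \<xi>\<close> is one
  associated to the left translate of \<open>\<gamma>\<close> that starts from the identity; the two covectors agree
  if \<open>\<gamma>\<close> itself starts from the identity. The norm of \<open>\<xi>\<close> is not invariant under left
  translations of \<open>\<gamma>\<close>.
\<close>

definition coAd ::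
  "('g, 'a::euclidean_space, 'm) lie_group_data_scheme \<Rightarrow> 'g \<Rightarrow> ('a \<Rightarrow>\<^sub>L real) \<Rightarrow> ('a \<Rightarrow>\<^sub>L real)"
  where
  "coAd G g \<xi> = Blinfun (\<lambda>X. \<xi> (Ad G g X))"

lemma (in lie_group) Ad_one: "Ad G \<one> = (\<lambda>X. X)"
proof -
  let ?c = "echart G"
  have c: "is_chart ?c"
    using smooth_atlas echart_in_atlas by (auto simp: smooth_atlas_def)
  have "((\<lambda>x. x) has_derivative (\<lambda>X. X)) (at (snd ?c \<one>))"
    by (rule has_derivative_ident)
  then have "((\<lambda>x. snd ?c (\<one> \<otimes> chart_inv ?c x \<otimes> inv \<one>)) has_derivative (\<lambda>X. X))
    (at (snd ?c \<one>))"
  proof (rule has_derivative_transform_within_open)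
    show "open (snd ?c ` fst ?c)" using c by (simp add: is_chart_def)
    show "snd ?c \<one> \<in> snd ?c ` fst ?c" using one_in_echart by blast
    fix x assume "x \<in> snd ?c ` fst ?c"
    then have "snd ?c (chart_inv ?c x) = x"
      using c by (auto simp: is_chart_def homeomorphism_def)
    then show "x = snd ?c (\<one> \<otimes> chart_inv ?c x \<otimes> inv \<one>)"
      by (simp add: carrier_UNIV)
  qed
  then show ?thesis
    unfolding Ad_def by (metis frechet_derivative_at)
qed

lemma (in lie_group) coAd_one: "coAd G \<one> \<xi> = \<xi>"
  by (simp add: coAd_def Ad_one blinfun_apply_inverse)


section \<open>The abelianization\<close>

text \<open>The abelianization \<open>G / [G, G]\<close> as a group of cosets, and its projection.\<close>

abbreviation commutator_subgroup :: "('g, 'm) monoid_scheme \<Rightarrow> 'g set" where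
  "commutator_subgroup G \<equiv> derived G (carrier G)"

definition ab_proj :: "('g, 'm) monoid_scheme \<Rightarrow> 'g \<Rightarrow> 'g set" where
  "ab_proj G g = commutator_subgroup G #>\<^bsub>G\<^esub> g"

definition vector_group :: "'v::real_vector set \<Rightarrow> 'v monoid" where
  "vector_group V = \<lparr>carrier = V, mult = (+), one = 0\<rparr>"

text \<open>
  \<open>\<iota>\<close> is the identification of \<open>G / [G, G]\<close> with the vector space \<open>V\<close> through the differential of
  the projection: \<open>\<iota> \<circ> \<pi>\<close> is smooth and its differential at the identity restricts to the
  identity of \<open>V\<close>.
\<close>

definition abelianization_identification ::
  "('g::topological_space, 'a::euclidean_space, 'm) lie_group_data_scheme \<Rightarrow> 'a set \<Rightarrow>
   ('g set \<Rightarrow> 'a) \<Rightarrow> bool" where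
  "abelianization_identification G V \<iota> \<longleftrightarrow>
     \<iota> \<in> iso (G Mod commutator_subgroup G) (vector_group V) \<and>
     smooth_map (atlas G) {(UNIV, id)} (\<iota> \<circ> ab_proj G) \<and>
     (\<forall>v\<in>V. frechet_derivative (\<iota> \<circ> ab_proj G \<circ> ecoord_inv G) (at (ecoord G \<one>\<^bsub>G\<^esub>)) v = v)"

text \<open>
  Length-minimizing curves in \<open>G / [G, G]\<close>, which carries the norm \<open>N\<close> of \<open>V\<close>: the distance of
  two points is the norm of their difference.
\<close>

definition ab_length_minimizing ::
  "'a::euclidean_space set \<Rightarrow> ('a \<Rightarrow> real) \<Rightarrow> ('g set \<Rightarrow> 'a) \<Rightarrow> real \<Rightarrow> real \<Rightarrow>
   (real \<Rightarrow> 'g set) \<Rightarrow> bool" where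
  "ab_length_minimizing V N \<iota> a b c \<longleftrightarrow> a \<le> b \<and> abs_continuous_on {a..b} (\<iota> \<circ> c) \<and>
     (\<integral>\<^sup>+t. ennreal (N (vector_derivative (\<iota> \<circ> c) (at t within {a..b}))) \<partial>lebesgue_on {a..b}) =
       ennreal (N (\<iota> (c b) - \<iota> (c a)))"

end

theory Submission
  imports Defs
begin

text \<open>
  Let \<open>\<gamma>\<close> be a normal curve with control \<open>u\<close> and covector \<open>\<xi>\<close>, and let \<open>p\<^sub>t = \<xi> \<circ> Ad\<^bsub>\<gamma>(t)\<^esub>\<close> be its
  momentum, restricted to \<open>V\<close>. That \<open>p\<^sub>t\<close> is a subgradient of the energy at \<open>u(t)\<close> means that the
  dual norm of \<open>p\<^sub>t\<close> is \<open>N(u(t))\<close> and that \<open>p\<^sub>t(u(t)) = N(u(t))\<^sup>2\<close> (\<open>subdifferential_energyD\<close>): the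
  direction of the control lies in the face of the unit ball on which \<open>p\<^sub>t\<close> is maximal. The unit
  ball is a polytope, so this face is the hull of those vertices \<open>f\<close> at which \<open>p\<^sub>t(f)\<close> is maximal,
  and continuity of \<open>p\<^sub>t\<close> confines these vertices, for \<open>t\<close> in a short interval, to a
  single face of the ball. A functional \<open>\<eta>\<close> of dual norm one that exposes this face satisfies
  \<open>\<eta>(u(t)) = N(u(t))\<close> for almost every \<open>t\<close> in the interval. Thus \<open>\<eta>\<close>, composed with the projection
  to the abelianization, is a calibration: its increment along \<open>\<gamma>\<close> is the length of \<open>\<gamma>\<close>,
  it has the same increment along every horizontal curve with the same endpoints, and it never grows
  faster than length (\<open>calibrated_imp_minimizing\<close>). Both \<open>\<gamma>\<close> and its projection are therefore
  minimizing on the interval.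

  To compare momenta at different times, their dual norms must agree, that is, \<open>\<gamma>\<close> must have
  constant speed. Along \<open>\<gamma>\<close>, the derivative of \<open>p\<^sub>t(X)\<close> is \<open>p\<^sub>t([u(t), X])\<close>. The maximum \<open>M\<close> of the
  finitely many functions \<open>t \<mapsto> p\<^sub>t(f)\<close> is absolutely continuous and differentiable almost everywhere.
  For \<open>w = u(t) / N(u(t))\<close>, the function \<open>s \<mapsto> M(s) - p\<^sub>s(w)\<close> has a minimum at \<open>t\<close>, so
  \<open>M'(t) = p\<^sub>t([u(t), w]) = 0\<close> (\<open>Max_momentum_constant\<close>).

  For the quantitative statement, the set of functionals of dual norm one is compact and therefore
  has a Lebesgue number \<open>\<delta>\<close>: functionals within \<open>\<delta>\<close> of a given one are maximal only at vertices of one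
  common face (\<open>dual_sphere_uniform_face\<close>). At unit speed, \<open>p\<^sub>t\<close> solves a linear differential equation
  with bounded coefficients, so it is Lipschitz with a constant proportional to the size of the
  initial covector \<open>p\<^sub>0\<close> (\<open>abs_continuous_linear_growth_bound\<close>), and it moves by less than \<open>\<delta>\<close> during a
  time that is inversely proportional to that size.

  The analytic input is the fundamental theorem of calculus for absolutely continuous functions, which
  is proved for the gauge integral. The Lie theoretic input, \<open>[u, u] = 0\<close> and the derivative of
  \<open>Ad\<^bsub>\<gamma>(t)\<^esub>\<close>, comes from the conjugation map read in the chart around the identity.
\<close>

section \<open>Absolutely continuous functions\<close>

text \<open>
  The families of intervals in the definition of absolute continuity. Naming them, and the
  \<open>\<epsilon>\<close>-\<open>\<delta>\<close> condition below, keeps the nested quantifiers out of the proofs.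
\<close>

definition interval_family :: "real set \<Rightarrow> (real \<times> real) set \<Rightarrow> bool" where
  "interval_family J D \<longleftrightarrow> finite D \<and> (\<forall>(x, y)\<in>D. x \<le> y \<and> {x..y} \<subseteq> J) \<and>
     pairwise (\<lambda>p q. disjnt {fst p<..<snd p} {fst q<..<snd q}) D"

definition small_variation ::
  "real set \<Rightarrow> (real \<Rightarrow> 'b::real_normed_vector) \<Rightarrow> real \<Rightarrow> real \<Rightarrow> bool" where
  "small_variation J f \<delta> \<epsilon> \<longleftrightarrow> (\<forall>D. interval_family J D \<longrightarrow> (\<Sum>(x, y)\<in>D. y - x) < \<delta> \<longrightarrow>
     (\<Sum>(x, y)\<in>D. norm (f y - f x)) < \<epsilon>)"

lemma abs_continuous_on_iff:
  "abs_continuous_on J f \<longleftrightarrow> (\<forall>\<epsilon>>0. \<exists>\<delta>>0. small_variation J f \<delta> \<epsilon>)"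
  unfolding abs_continuous_on_def small_variation_def interval_family_def
  by (simp only: imp_conjL conj_assoc)

lemma small_variationD:
  "small_variation J f \<delta> \<epsilon> \<Longrightarrow> interval_family J D \<Longrightarrow> (\<Sum>(x, y)\<in>D. y - x) < \<delta> \<Longrightarrow>
    (\<Sum>(x, y)\<in>D. norm (f y - f x)) < \<epsilon>"
  by (simp add: small_variation_def)

lemma interval_family_subset: "interval_family J D \<Longrightarrow> D' \<subseteq> D \<Longrightarrow> interval_family J D'"
  unfolding interval_family_def by (meson finite_subset pairwise_mono subsetD)

lemma interval_family_mono: "interval_family K D \<Longrightarrow> K \<subseteq> J \<Longrightarrow> interval_family J D"
  unfolding interval_family_def by fastforce

lemma interval_familyD:
  assumes "interval_family J D"
  shows "finite D" "(x, y) \<in> D \<Longrightarrow> x \<le> y" "(x, y) \<in> D \<Longrightarrow> {x..y} \<subseteq> J"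
    "(x, y) \<in> D \<Longrightarrow> x \<in> J" "(x, y) \<in> D \<Longrightarrow> y \<in> J"
  using assms unfolding interval_family_def by fastforce+

lemma abs_continuous_on_subset:
  assumes "abs_continuous_on J f" "K \<subseteq> J"
  shows "abs_continuous_on K f"
  using assms interval_family_mono unfolding abs_continuous_on_iff small_variation_def by metis

text \<open>
  This covers Lipschitz images, as well as sums and maxima of finitely many functions.
\<close>

lemma abs_continuous_on_dominated:
  fixes f :: "'i \<Rightarrow> real \<Rightarrow> 'b::real_normed_vector" and h :: "real \<Rightarrow> 'c::real_normed_vector"
  assumes "finite I" and f: "\<And>i. i \<in> I \<Longrightarrow> abs_continuous_on J (f i)"
    and h: "\<And>x y. x \<in> J \<Longrightarrow> y \<in> J \<Longrightarrow> norm (h y - h x) \<le> B * (\<Sum>i\<in>I. norm (f i y - f i x))"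
  shows "abs_continuous_on J h"
  unfolding abs_continuous_on_iff
proof (intro allI impI)
  fix \<epsilon> :: real assume "\<epsilon> > 0"
  \<comment> \<open>The summand one keeps the constant positive if \<open>B\<close> or \<open>I\<close> is trivial.\<close>
  define c where "c = \<bar>B\<bar> * card I + 1"
  define \<epsilon>' where "\<epsilon>' = \<epsilon> / c"
  have "c > 0" unfolding c_def by (simp add: add_nonneg_pos)
  then have "\<epsilon>' > 0" using \<open>\<epsilon> > 0\<close> by (simp add: \<epsilon>'_def)
  then have "\<forall>i\<in>I. \<exists>\<delta>>0. small_variation J (f i) \<delta> \<epsilon>'"
    using f unfolding abs_continuous_on_iff by blast
  then obtain \<delta> where \<delta>: "\<And>i. i \<in> I \<Longrightarrow> \<delta> i > 0" "\<And>i. i \<in> I \<Longrightarrow> small_variation J (f i) (\<delta> i) \<epsilon>'"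
    by metis
  define d where "d = Min (insert 1 (\<delta> ` I))"
  have d: "d > 0" "\<And>i. i \<in> I \<Longrightarrow> d \<le> \<delta> i"
    using \<delta>(1) \<open>finite I\<close> by (auto simp: d_def)
  have "small_variation J h d \<epsilon>"
    unfolding small_variation_def
  proof (intro allI impI)
    fix D assume D: "interval_family J D" "(\<Sum>(x, y)\<in>D. y - x) < d"
    have *: "(\<Sum>(x, y)\<in>D. norm (f i y - f i x)) \<le> \<epsilon>'" if "i \<in> I" for i
      using small_variationD[OF \<delta>(2)[OF that] D(1)] D(2) d(2)[OF that] by linarith
    have "(\<Sum>(x, y)\<in>D. norm (h y - h x)) \<le> (\<Sum>(x, y)\<in>D. \<bar>B\<bar> * (\<Sum>i\<in>I. norm (f i y - f i x)))"
    proof (rule sum_mono, clarify)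
      fix x y assume "(x, y) \<in> D"
      then have "norm (h y - h x) \<le> B * (\<Sum>i\<in>I. norm (f i y - f i x))"
        by (intro h interval_familyD[OF D(1)])
      also have "\<dots> \<le> \<bar>B\<bar> * (\<Sum>i\<in>I. norm (f i y - f i x))"
        by (intro mult_right_mono sum_nonneg) auto
      finally show "norm (h y - h x) \<le> \<bar>B\<bar> * (\<Sum>i\<in>I. norm (f i y - f i x))" .
    qed
    also have "\<dots> = \<bar>B\<bar> * (\<Sum>i\<in>I. \<Sum>(x, y)\<in>D. norm (f i y - f i x))"
      by (subst sum.swap) (simp add: sum_distrib_left case_prod_unfold)
    also have "\<dots> \<le> \<bar>B\<bar> * (\<Sum>i\<in>I. \<epsilon>')"
      by (intro mult_left_mono sum_mono *) auto
    also have "\<dots> = (\<bar>B\<bar> * card I) * \<epsilon>'" by simp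
    also have "\<dots> < c * \<epsilon>'" using \<open>\<epsilon>' > 0\<close> by (simp add: c_def)
    also have "\<dots> = \<epsilon>" using \<open>c > 0\<close> by (simp add: \<epsilon>'_def)
    finally show "(\<Sum>(x, y)\<in>D. norm (h y - h x)) < \<epsilon>" .
  qed
  with d(1) show "\<exists>\<delta>>0. small_variation J h \<delta> \<epsilon>" by blast
qed

lemma abs_continuous_on_lipschitz:
  assumes "abs_continuous_on J f"
    and "\<And>x y. x \<in> J \<Longrightarrow> y \<in> J \<Longrightarrow> norm (h y - h x) \<le> B * norm (f y - f x)"
  shows "abs_continuous_on J h"
  using abs_continuous_on_dominated[of "{()}" J "\<lambda>_. f" h B] assms by simp

text \<open>
  A curve in a manifold is absolutely continuous in charts only, so this is what produces
  absolute continuity of its scalar observables on a whole interval. By compactness, finitely many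
  of the given neighbourhoods suffice, and a family of short intervals splits accordingly.
\<close>

lemma abs_continuous_on_locally:
  fixes f :: "real \<Rightarrow> 'b::real_normed_vector"
  assumes loc: "\<And>t. t \<in> {a..b} \<Longrightarrow> \<exists>\<epsilon>>0. abs_continuous_on ({a..b} \<inter> ball t \<epsilon>) f"
  shows "abs_continuous_on {a..b} f"
  unfolding abs_continuous_on_iff
proof (intro allI impI)
  fix \<epsilon> :: real assume "\<epsilon> > 0"
  obtain r where r: "\<And>t. t \<in> {a..b} \<Longrightarrow> r t > 0"
      "\<And>t. t \<in> {a..b} \<Longrightarrow> abs_continuous_on ({a..b} \<inter> ball t (r t)) f"
    using loc by metis
  have "{a..b} \<subseteq> (\<Union>t\<in>{a..b}. ball t (r t / 2))"
    using r(1) by force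
  then obtain T where T: "T \<subseteq> {a..b}" "finite T" "{a..b} \<subseteq> (\<Union>t\<in>T. ball t (r t / 2))"
    using compactE_image[of "{a..b}" "{a..b}" "\<lambda>t. ball t (r t / 2)"] compact_Icc by blast
  define \<epsilon>' where "\<epsilon>' = \<epsilon> / (card T + 1)"
  have "\<epsilon>' > 0" using \<open>\<epsilon> > 0\<close> by (simp add: \<epsilon>'_def)
  then have "\<forall>t\<in>T. \<exists>\<delta>>0. small_variation ({a..b} \<inter> ball t (r t)) f \<delta> \<epsilon>'"
    using r(2) T(1) unfolding abs_continuous_on_iff by blast
  then obtain \<delta> where \<delta>: "\<And>t. t \<in> T \<Longrightarrow> \<delta> t > 0"
      "\<And>t. t \<in> T \<Longrightarrow> small_variation ({a..b} \<inter> ball t (r t)) f (\<delta> t) \<epsilon>'"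
    by metis
  define d where "d = Min (insert 1 (\<delta> ` T \<union> (\<lambda>t. r t / 2) ` T))"
  have fin: "finite (insert 1 (\<delta> ` T \<union> (\<lambda>t. r t / 2) ` T))" using T(2) by simp
  have "d > 0" unfolding d_def using fin \<delta>(1) T(1) r(1) by (subst Min_gr_iff) auto
  have d: "d \<le> \<delta> t" "d \<le> r t / 2" if "t \<in> T" for t
    unfolding d_def by (rule Min_le[OF fin], use that in blast)+
  have "small_variation {a..b} f d \<epsilon>"
    unfolding small_variation_def
  proof (intro allI impI)
    fix D assume D: "interval_family {a..b} D" "(\<Sum>(x, y)\<in>D. y - x) < d"
    note Dd = interval_familyD[OF D(1)]
    have len: "y - x < d" if "(x, y) \<in> D" for x y
    proof -
      have "y - x = (\<lambda>(x, y). y - x) (x, y)" by simp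
      also have "\<dots> \<le> (\<Sum>(x, y)\<in>D. y - x)"
        by (rule member_le_sum) (use Dd that in auto)
      finally show ?thesis using D(2) by linarith
    qed
    \<comment> \<open>An interval of the family is so short that it stays in the ball around its left endpoint.\<close>
    have "\<exists>t\<in>T. {fst p..snd p} \<subseteq> {a..b} \<inter> ball t (r t)" if "p \<in> D" for p
    proof -
      obtain x y where p: "p = (x, y)" by (cases p)
      with that have xy: "(x, y) \<in> D" by simp
      then obtain t where t: "t \<in> T" "x \<in> ball t (r t / 2)" using T(3) Dd(4)[OF xy] by blast
      have "y - x < r t / 2" using len[OF xy] d(2)[OF t(1)] by simp
      then have "dist t z < r t" if "z \<in> {x..y}" for z
        using t(2) that unfolding mem_ball dist_real_def atLeastAtMost_iff by linarith
      then have "{x..y} \<subseteq> ball t (r t)" by auto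
      then show ?thesis using t Dd(3)[OF xy] p by auto
    qed
    then obtain \<tau> where \<tau>: "\<And>p. p \<in> D \<Longrightarrow> \<tau> p \<in> T"
        "\<And>p. p \<in> D \<Longrightarrow> {fst p..snd p} \<subseteq> {a..b} \<inter> ball (\<tau> p) (r (\<tau> p))" by metis
    have piece: "(\<Sum>(x, y)\<in>{p\<in>D. \<tau> p = t}. norm (f y - f x)) \<le> \<epsilon>'" if "t \<in> T" for t
    proof (rule less_imp_le[OF small_variationD[OF \<delta>(2)[OF that]]])
      have "interval_family {a..b} {p \<in> D. \<tau> p = t}"
        using interval_family_subset[OF D(1)] by auto
      then show "interval_family ({a..b} \<inter> ball t (r t)) {p \<in> D. \<tau> p = t}"
        using \<tau>(2) unfolding interval_family_def by force
      have "(\<Sum>(x, y)\<in>{p \<in> D. \<tau> p = t}. y - x) \<le> (\<Sum>(x, y)\<in>D. y - x)"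
        by (rule sum_mono2) (use Dd in auto)
      then show "(\<Sum>(x, y)\<in>{p \<in> D. \<tau> p = t}. y - x) < \<delta> t" using D(2) d(1)[OF that] by linarith
    qed
    have "(\<Sum>(x, y)\<in>D. norm (f y - f x)) = (\<Sum>t\<in>T. \<Sum>(x, y)\<in>{p\<in>D. \<tau> p = t}. norm (f y - f x))"
      by (rule sum.group[symmetric]) (use Dd T \<tau> in auto)
    also have "\<dots> \<le> (\<Sum>t\<in>T. \<epsilon>')" by (intro sum_mono piece)
    also have "\<dots> = card T * \<epsilon>'" by simp
    also have "\<dots> < (card T + 1) * \<epsilon>'" using \<open>\<epsilon>' > 0\<close> by (simp add: algebra_simps)
    also have "\<dots> = \<epsilon>" by (simp add: \<epsilon>'_def)
    finally show "(\<Sum>(x, y)\<in>D. norm (f y - f x)) < \<epsilon>" .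
  qed
  with \<open>d > 0\<close> show "\<exists>\<delta>>0. small_variation {a..b} f \<delta> \<epsilon>" by blast
qed

lemma emeasure_open_superset_negligible:
  assumes "negligible S" "e > 0"
  obtains T where "open T" "S \<subseteq> T" "emeasure lborel T < ennreal e"
proof -
  have S: "S \<in> null_sets lebesgue" using assms(1) by (simp add: negligible_iff_null_sets)
  then have "S \<in> sets lebesgue" by auto
  then obtain T where T: "open T" "S \<subseteq> T" "emeasure lebesgue (T - S) < ennreal e"
    by (rule sets_lebesgue_outer_open[OF _ \<open>e > 0\<close>])
  have "T \<in> sets borel" using T(1) by simp
  then have "T \<in> sets lebesgue" by simp
  then have "emeasure lebesgue (T - S) = emeasure lebesgue T"
    using S by (rule emeasure_Diff_null_set[rotated])
  then have "emeasure lborel T < ennreal e" using T(3) \<open>T \<in> sets borel\<close> by simp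
  then show thesis using T that by blast
qed

text \<open>
  The proof compares the Riemann sums of a tagged division with the increments of \<open>f\<close>. For a tag
  outside \<open>S\<close>, the definition of the derivative bounds the difference by the length of the interval. The
  intervals with a tag in \<open>S\<close> are forced by the gauge into an open set of small measure, where
  absolute continuity makes the total increment small. With the gauge integral, integrability of
  the derivative is a conclusion.
\<close>

theorem has_integral_derivative_abs_continuous:
  fixes f :: "real \<Rightarrow> 'b::banach"
  assumes ac: "abs_continuous_on {a..b} f" and "a \<le> b" and S: "negligible S"
    and f': "\<And>t. t \<in> {a..b} - S \<Longrightarrow> (f has_vector_derivative f' t) (at t within {a..b})"
  shows "(f' has_integral (f b - f a)) {a..b}"
proof (cases "a = b")
  case True
  then show ?thesis using has_integral_refl(1)[of f' a] by simp
next
  case False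
  with \<open>a \<le> b\<close> have ab: "a < b" by simp
  define g where "g t = (if t \<in> S then 0 else f' t)" for t
  have "(g has_integral (f b - f a)) (cbox a b)"
    unfolding has_integral_factor_content
  proof (intro allI impI)
    fix e :: real assume "e > 0"
    have e2: "e / 2 * (b - a) > 0" using \<open>e > 0\<close> ab by simp
    obtain \<delta> where "\<delta> > 0" and \<delta>: "small_variation {a..b} f \<delta> (e / 2 * (b - a))"
      using ac e2 unfolding abs_continuous_on_iff by blast
    obtain T where T: "open T" "S \<subseteq> T" "emeasure lborel T < ennreal \<delta>"
      using emeasure_open_superset_negligible[OF S \<open>\<delta> > 0\<close>] .
    have "\<exists>d>0. if x \<in> S then ball x d \<subseteq> T else x \<in> {a..b} \<longrightarrow>
       (\<forall>y\<in>{a..b}. norm (y-x) < d \<longrightarrow> norm (f y - f x - (y-x) *\<^sub>R f' x) \<le> e/2 * norm (y-x))" for x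
    proof (cases "x \<in> S")
      case True
      then show ?thesis using T(1,2) by (auto simp: open_contains_ball)
    next
      case False
      have "\<exists>d>0. \<forall>y\<in>{a..b}. norm (y-x) < d \<longrightarrow> norm (f y - f x - (y-x) *\<^sub>R f' x) \<le> e/2 * norm (y-x)"
        if "x \<in> {a..b}"
        using f'[of x] that False \<open>e > 0\<close> half_gt_zero[of e]
        unfolding has_vector_derivative_def has_derivative_within_alt by blast
      then show ?thesis using False by (metis zero_less_one)
    qed
    then obtain d where d0: "\<And>x. d x > 0" and d: "\<And>x. if x \<in> S then ball x (d x) \<subseteq> T else x \<in> {a..b} \<longrightarrow>
       (\<forall>y\<in>{a..b}. norm (y-x) < d x \<longrightarrow> norm (f y - f x - (y-x) *\<^sub>R f' x) \<le> e/2 * norm (y-x))"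
      by metis
    show "\<exists>d. gauge d \<and> (\<forall>p. p tagged_division_of (cbox a b) \<and> d fine p \<longrightarrow>
      norm ((\<Sum>(x, k)\<in>p. measure lborel k *\<^sub>R g x) - (f b - f a)) \<le> e * measure lborel (cbox a b))"
    proof (rule exI, safe)
      show "gauge (\<lambda>x. ball x (d x))" using d0 gauge_ball_dependent by blast
    next
      fix p assume p: "p tagged_division_of cbox a b" and fine: "(\<lambda>x. ball x (d x)) fine p"
      note pD = tagged_division_ofD[OF p]
      have ba: "b - a = (\<Sum>(x,K)\<in>p. Sup K - Inf K)" "f b - f a = (\<Sum>(x,K)\<in>p. f(Sup K) - f(Inf K))"
        using additive_tagged_division_1[where f= "\<lambda>x. x"] additive_tagged_division_1[where f= f]
          \<open>a \<le> b\<close> p by auto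
      have K: "Inf K \<le> Sup K \<and> K = {Inf K..Sup K} \<and> K \<subseteq> {a..b} \<and> x \<in> K \<and> measure lborel K = Sup K - Inf K"
        if "(x, K) \<in> p" for x K
      proof -
        obtain u v where "K = cbox u v" using pD(4)[OF \<open>(x, K) \<in> p\<close>] by auto
        then show ?thesis using pD(2,3)[OF \<open>(x, K) \<in> p\<close>] by (auto simp: interval_bounds_real)
      qed
      define p1 where "p1 = {(x, K)\<in>p. x \<in> S \<and> Inf K < Sup K}"
      have fin: "finite p" "finite p1" using pD(1) by (auto simp: p1_def intro: finite_subset[of _ p])
      \<comment> \<open>The intervals tagged in \<open>S\<close> lie in a set of small measure.\<close>
      define D where "D = (\<lambda>(x, K). (Inf K, Sup K)) ` p1"
      have int: "interior K = {Inf K<..<Sup K}" if "(x, K) \<in> p" for x K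
        using K[OF that] by (metis interior_atLeastAtMost_real)
      have inj: "inj_on (\<lambda>(x, K::real set). (Inf K, Sup K)) p1"
      proof (rule inj_onI, clarify)
        fix x K x' K' assume *: "(x, K) \<in> p1" "(x', K') \<in> p1" "Inf K = Inf K'" "Sup K = Sup K'"
        then have **: "(x, K) \<in> p" "(x', K') \<in> p" "Inf K < Sup K" by (auto simp: p1_def)
        have "K = K'" using K[OF **(1)] K[OF **(2)] *(3,4) by metis
        moreover have "(x, K) = (x', K')"
        proof (rule ccontr)
          assume "(x, K) \<noteq> (x', K')"
          from pD(5)[OF **(1,2) this] \<open>K = K'\<close> have "interior K = {}" by simp
          then show False using int[OF **(1)] **(3) by (simp add: greaterThanLessThan_empty_iff)
        qed
        ultimately show "x = x' \<and> K = K'" by auto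
      qed
      have D: "finite D" using fin by (simp add: D_def)
      have Dint: "\<forall>(x, y)\<in>D. x \<le> y \<and> {x..y} \<subseteq> {a..b}"
        using K by (fastforce simp: D_def p1_def)
      have Ddisj: "pairwise (\<lambda>p q. disjnt {fst p<..<snd p} {fst q<..<snd q}) D"
        unfolding pairwise_def
      proof (intro ballI impI)
        fix q q' assume q: "q \<in> D" "q' \<in> D" "q \<noteq> q'"
        then obtain x K x' K' where *: "(x, K) \<in> p1" "(x', K') \<in> p1"
          "q = (Inf K, Sup K)" "q' = (Inf K', Sup K')" by (auto simp: D_def)
        then have **: "(x, K) \<in> p" "(x', K') \<in> p" by (auto simp: p1_def)
        have "(x, K) \<noteq> (x', K')" using q * by auto
        from pD(5)[OF ** this] show "disjnt {fst q<..<snd q} {fst q'<..<snd q'}"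
          using * int[OF **(1)] int[OF **(2)] by (simp add: disjnt_def)
      qed
      have Dsum: "(\<Sum>(x, y)\<in>D. y - x) < \<delta>"
      proof -
        have "ennreal (\<Sum>(x, y)\<in>D. y - x) = (\<Sum>q\<in>D. ennreal (snd q - fst q))"
          using Dint by (subst sum_ennreal) (auto simp: case_prod_unfold)
        also have "\<dots> = (\<Sum>q\<in>D. emeasure lborel {fst q<..<snd q})"
          using Dint by (intro sum.cong) (auto simp: case_prod_unfold)
        also have "\<dots> = emeasure lborel (\<Union>q\<in>D. {fst q<..<snd q})"
          using D Ddisj by (intro sum_emeasure)
            (auto simp: disjoint_family_on_def pairwise_def disjnt_def)
        also have "\<dots> \<le> emeasure lborel T"
        proof (rule emeasure_mono)
          show "(\<Union>q\<in>D. {fst q<..<snd q}) \<subseteq> T"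
          proof clarify
            fix x y z assume "(x, y) \<in> D" "z \<in> {fst (x, y)<..<snd (x, y)}"
            then obtain t K where *: "(t, K) \<in> p1" "x = Inf K" "y = Sup K" "z \<in> {x<..<y}"
              by (auto simp: D_def)
            then have t: "(t, K) \<in> p" "t \<in> S" by (auto simp: p1_def)
            have "z \<in> K" using * K[OF t(1)] by (metis atLeastAtMost_iff greaterThanLessThan_iff less_imp_le)
            moreover have "K \<subseteq> ball t (d t)" using fine t(1) by (auto simp: fine_def)
            ultimately show "z \<in> T" using d[of t] t(2) by auto
          qed
        qed (use T in \<open>auto intro: borel_open\<close>)
        also have "\<dots> < ennreal \<delta>" by (rule T)
        finally have "ennreal (\<Sum>(x, y)\<in>D. y - x) < ennreal \<delta>" .
        moreover have "0 \<le> (\<Sum>(x, y)\<in>D. y - x)" by (rule sum_nonneg) (use Dint in auto)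
        ultimately show ?thesis by (simp only: ennreal_less_iff)
      qed
      have small: "(\<Sum>(x, K)\<in>p1. norm (f (Sup K) - f (Inf K))) < e / 2 * (b - a)"
        using small_variationD[OF \<delta>, of D] D Dint Ddisj Dsum sum.reindex[OF inj, of "\<lambda>(x, y). norm (f y - f x)"]
        by (simp add: interval_family_def D_def case_prod_unfold o_def)
      have "norm (\<Sum>(x, K)\<in>p. measure lborel K *\<^sub>R g x - (f (Sup K) - f (Inf K)))
          \<le> (\<Sum>(x, K)\<in>p. (if (x, K) \<in> p1 then norm (f (Sup K) - f (Inf K)) else 0) + e/2 * (Sup K - Inf K))"
      proof (rule sum_norm_le, clarify)
        fix x K assume xK: "(x, K) \<in> p"
        note KK = K[OF xK]
        show "norm (measure lborel K *\<^sub>R g x - (f (Sup K) - f (Inf K)))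
          \<le> (if (x, K) \<in> p1 then norm (f (Sup K) - f (Inf K)) else 0) + e/2 * (Sup K - Inf K)"
        proof (cases "x \<in> S")
          case True
          show ?thesis
          proof (cases "Inf K < Sup K")
            case True
            then have "(x, K) \<in> p1" using \<open>x \<in> S\<close> xK by (simp add: p1_def)
            then show ?thesis using \<open>x \<in> S\<close> KK \<open>e > 0\<close> by (simp add: g_def norm_minus_commute)
          next
            case False
            then show ?thesis using \<open>x \<in> S\<close> KK by (simp add: g_def p1_def)
          qed
        next
          case False
          have sub: "K \<subseteq> ball x (d x)" using fine xK by (auto simp: fine_def)
          have uv: "Inf K \<in> K" "Sup K \<in> K" "Inf K \<le> x" "x \<le> Sup K" "x \<in> {a..b}"
            using KK by (metis atLeastAtMost_iff order_refl subsetD)+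
          have est: "norm (f y - f x - (y-x) *\<^sub>R f' x) \<le> e/2 * norm (y-x)" if "y \<in> K" for y
            using d[of x] False uv(5) that KK sub
            by (auto simp: dist_real_def subset_iff abs_minus_commute)
          have "norm ((Sup K - Inf K) *\<^sub>R f' x - (f (Sup K) - f (Inf K))) =
            norm (f (Inf K) - f x - (Inf K - x) *\<^sub>R f' x - (f (Sup K) - f x - (Sup K - x) *\<^sub>R f' x))"
            by (auto simp: algebra_simps)
          also have "\<dots> \<le> norm (f (Inf K) - f x - (Inf K - x) *\<^sub>R f' x) + norm (f (Sup K) - f x - (Sup K - x) *\<^sub>R f' x)"
            by (rule norm_triangle_ineq4)
          also have "\<dots> \<le> e/2 * norm (Inf K - x) + e/2 * norm (Sup K - x)"
            by (intro add_mono est uv)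
          also have "\<dots> = e/2 * (Sup K - Inf K)" using uv by (simp add: field_simps)
          finally show ?thesis using False KK by (simp add: g_def p1_def)
        qed
      qed
      also have "\<dots> = (\<Sum>(x, K)\<in>p1. norm (f (Sup K) - f (Inf K))) + e/2 * (b - a)"
      proof -
        have "(\<Sum>(x, K)\<in>p. if (x, K) \<in> p1 then norm (f (Sup K) - f (Inf K)) else 0) =
          (\<Sum>(x, K)\<in>p1. norm (f (Sup K) - f (Inf K)))"
          by (rule sum.mono_neutral_cong_right) (use fin in \<open>auto simp: p1_def split: if_splits\<close>)
        then show ?thesis unfolding ba(1) by (simp add: case_prod_unfold sum.distrib sum_distrib_left)
      qed
      also have "\<dots> \<le> e * (b - a)" using small by (simp add: field_simps)
      finally show "norm ((\<Sum>(x, k)\<in>p. measure lborel k *\<^sub>R g x) - (f b - f a)) \<le> e * measure lborel (cbox a b)"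
        using ab unfolding ba(2) by (simp add: sum_subtractf[symmetric] case_prod_unfold)
    qed
  qed
  then show ?thesis
    using has_integral_spike[OF S, of "{a..b}" f' g] by (simp add: g_def)
qed

lemma AE_lebesgue_on_iff_negligible:
  assumes "J \<in> sets lebesgue"
  shows "(AE t in lebesgue_on J. P t) \<longleftrightarrow> (\<exists>S. negligible S \<and> (\<forall>t\<in>J - S. P t))"
proof -
  have "(AE t in lebesgue_on J. P t) \<longleftrightarrow> (AE t in lebesgue. t \<in> J \<longrightarrow> P t)"
    using assms by (simp add: AE_restrict_space_iff)
  also have "\<dots> \<longleftrightarrow> (\<exists>S. negligible S \<and> (\<forall>t\<in>J - S. P t))"
    unfolding eventually_ae_filter negligible_iff_null_sets by auto
  finally show ?thesis .
qed

lemma has_integral_derivative_abs_continuous_AE: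
  fixes f :: "real \<Rightarrow> real"
  assumes ac: "abs_continuous_on {a..b} f" and "a \<le> b"
    and ae: "AE t in lebesgue_on {a..b}. \<exists>d. (f has_real_derivative d) (at t within {a..b}) \<and> P t d"
  obtains f' where "(f' has_integral (f b - f a)) {a..b}" "AE t in lebesgue_on {a..b}. P t (f' t)"
proof -
  obtain S where S: "negligible S"
    and d: "\<forall>t\<in>{a..b} - S. \<exists>d. (f has_real_derivative d) (at t within {a..b}) \<and> P t d"
    using ae AE_lebesgue_on_iff_negligible[of "{a..b}"] by auto
  then obtain f' where f': "\<And>t. t \<in> {a..b} - S \<Longrightarrow> (f has_real_derivative f' t) (at t within {a..b})"
    "\<And>t. t \<in> {a..b} - S \<Longrightarrow> P t (f' t)" by metis
  show thesis
  proof
    show "(f' has_integral (f b - f a)) {a..b}"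
      using f'(1) by (intro has_integral_derivative_abs_continuous[OF ac \<open>a \<le> b\<close> S])
        (simp add: has_real_derivative_iff_has_vector_derivative)
    show "AE t in lebesgue_on {a..b}. P t (f' t)"
      using S f'(2) AE_lebesgue_on_iff_negligible[of "{a..b}"] by auto
  qed
qed

lemma abs_continuous_increment_le:
  fixes f :: "real \<Rightarrow> real"
  assumes ac: "abs_continuous_on {a..b} f" and "a \<le> b"
    and ae: "AE t in lebesgue_on {a..b}. \<exists>d. (f has_real_derivative d) (at t within {a..b}) \<and> d \<le> C"
  shows "f b - f a \<le> C * (b - a)"
proof -
  obtain f' where f': "(f' has_integral (f b - f a)) {a..b}" "AE t in lebesgue_on {a..b}. f' t \<le> C"
    by (rule has_integral_derivative_abs_continuous_AE[OF assms])
  then obtain S where S: "negligible S" "\<forall>t\<in>{a..b} - S. f' t \<le> C"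
    using AE_lebesgue_on_iff_negligible[of "{a..b}"] by auto
  have "((\<lambda>t. if t \<in> S then C else f' t) has_integral (f b - f a)) {a..b}"
    by (rule has_integral_spike[OF S(1) _ f'(1)]) simp
  moreover have "((\<lambda>t. C) has_integral C * (b - a)) {a..b}"
    using has_integral_const_real[of C a b] \<open>a \<le> b\<close> by (simp add: mult.commute)
  ultimately show ?thesis by (rule has_integral_le) (use S(2) in auto)
qed

lemma abs_continuous_increment_eq:
  fixes f :: "real \<Rightarrow> real"
  assumes ac: "abs_continuous_on {a..b} f" and "a \<le> b"
    and ae: "AE t in lebesgue_on {a..b}. (f has_real_derivative C) (at t within {a..b})"
  shows "f b - f a = C * (b - a)"
proof (rule antisym)
  show "f b - f a \<le> C * (b - a)"
    by (rule abs_continuous_increment_le[OF ac \<open>a \<le> b\<close> eventually_mono[OF ae]]) auto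
  have "abs_continuous_on {a..b} (\<lambda>t. - f t)"
    by (rule abs_continuous_on_lipschitz[OF ac, of _ 1]) (simp add: abs_minus_commute)
  moreover have "AE t in lebesgue_on {a..b}. \<exists>d. ((\<lambda>t. - f t) has_real_derivative d) (at t within {a..b}) \<and> d \<le> - C"
    by (rule eventually_mono[OF ae]) (auto intro!: exI[of _ "- C"] DERIV_minus)
  ultimately have "- f b - - f a \<le> - C * (b - a)"
    using \<open>a \<le> b\<close> by (intro abs_continuous_increment_le)
  then show "C * (b - a) \<le> f b - f a" by simp
qed

text \<open>
  This form compares displacement with length, where \<open>h\<close> is the norm of the control. Measurability comes
  from the derivative of \<open>f\<close>, whose positive part \<open>h\<close> dominates; if the integral of this positive part is
  infinite, there is nothing to prove.
\<close>

lemma abs_continuous_increment_le_nn_integral: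
  fixes f :: "real \<Rightarrow> real"
  assumes ac: "abs_continuous_on {a..b} f" and "a \<le> b"
    and ae: "AE t in lebesgue_on {a..b}. \<exists>d. (f has_real_derivative d) (at t within {a..b}) \<and> ennreal d \<le> h t"
  shows "ennreal (f b - f a) \<le> (\<integral>\<^sup>+t. h t \<partial>lebesgue_on {a..b})"
proof -
  obtain f' where f': "(f' has_integral (f b - f a)) {a..b}" "AE t in lebesgue_on {a..b}. ennreal (f' t) \<le> h t"
    by (rule has_integral_derivative_abs_continuous_AE[OF assms])
  define g where "g t = max 0 (f' t)" for t
  have eq: "ennreal (f' t) = ennreal (g t)" for t by (simp add: g_def max_def ennreal_neg)
  have "ennreal (f b - f a) \<le> (\<integral>\<^sup>+t. ennreal (g t) \<partial>lebesgue_on {a..b})"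
  proof (cases "(\<integral>\<^sup>+t. ennreal (g t) \<partial>lebesgue_on {a..b}) < \<infinity>")
    case True
    have "f' \<in> borel_measurable (lebesgue_on {a..b})"
      using f'(1) by (intro integrable_imp_measurable) auto
    then have "g \<in> borel_measurable (lebesgue_on {a..b})" unfolding g_def by measurable
    then have int: "integrable (lebesgue_on {a..b}) g"
      using True by (intro integrableI_nonneg) (auto simp: g_def)
    then have "(g has_integral integral\<^sup>L (lebesgue_on {a..b}) g) {a..b}"
      by (rule has_integral_integral_lebesgue_on) simp
    then have "f b - f a \<le> integral\<^sup>L (lebesgue_on {a..b}) g"
      by (rule has_integral_le[OF f'(1)]) (simp add: g_def)
    then show ?thesis
      using nn_integral_eq_integral[OF int] by (simp add: g_def ennreal_leI)
  qed (simp add: not_less top.extremum_unique)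
  also have "\<dots> \<le> (\<integral>\<^sup>+t. h t \<partial>lebesgue_on {a..b})"
    using f'(2) unfolding eq by (rule nn_integral_mono_AE)
  finally show ?thesis .
qed

lemma countable_isolated_points:
  fixes S :: "'a::second_countable_topology set"
  shows "countable {x\<in>S. \<not> x islimpt S}"
proof -
  obtain B :: "'a set set" where B: "countable B" "topological_basis B"
    using ex_countable_basis by blast
  have "\<exists>b\<in>B. x \<in> b \<and> b \<inter> S = {x}" if x: "x \<in> {x\<in>S. \<not> x islimpt S}" for x
  proof -
    obtain U where "open U" "x \<in> U" "U \<inter> S \<subseteq> {x}" using x by (auto simp: islimpt_def)
    then obtain b where "b \<in> B" "x \<in> b" "b \<subseteq> U" using topological_basisE[OF B(2)] by metis
    then show ?thesis using \<open>U \<inter> S \<subseteq> {x}\<close> x by blast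
  qed
  then obtain b where b: "\<And>x. x \<in> {x\<in>S. \<not> x islimpt S} \<Longrightarrow> b x \<in> B \<and> b x \<inter> S = {x}" by metis
  then have "inj_on b {x\<in>S. \<not> x islimpt S}" by (metis (no_types, lifting) inj_onI singleton_inject)
  moreover have "b ` {x\<in>S. \<not> x islimpt S} \<subseteq> B" using b by blast
  ultimately show ?thesis using B(1) countable_image_inj_on countable_subset by metis
qed

text \<open>
  The absolute value of \<open>q\<close> can fail to be differentiable only at a zero of \<open>q\<close> where \<open>q\<close> has a
  nonzero derivative, and such a zero is isolated.
\<close>

lemma differentiable_abs_except_countable:
  fixes q :: "real \<Rightarrow> real"
  obtains C where "countable C" "\<And>t. t \<notin> C \<Longrightarrow> q differentiable (at t) \<Longrightarrow> (\<lambda>s. \<bar>q s\<bar>) differentiable (at t)"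
proof
  let ?Z = "{s. q s = 0}"
  show "countable {t\<in>?Z. \<not> t islimpt ?Z}" by (rule countable_isolated_points)
  fix t assume t: "t \<notin> {t\<in>?Z. \<not> t islimpt ?Z}" and "q differentiable (at t)"
  then obtain D where D: "(q has_real_derivative D) (at t)"
    by (auto simp: real_differentiable_def)
  show "(\<lambda>s. \<bar>q s\<bar>) differentiable (at t)"
  proof (cases "q t = 0")
    case False
    then show ?thesis
      using differentiable_compose[OF differentiable_norm_at \<open>q differentiable (at t)\<close>] by (simp add: o_def)
  next
    case True
    have lim: "((\<lambda>s. q s / (s - t)) \<longlongrightarrow> D) (at t)"
      using D True by (simp add: has_field_derivative_iff)
    have "((\<lambda>s. q s / (s - t)) \<longlongrightarrow> D) (at t within ?Z)"
      using lim by (rule tendsto_within_subset) simp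
    moreover have "((\<lambda>s. q s / (s - t)) \<longlongrightarrow> 0) (at t within ?Z)"
      by (rule tendsto_eventually) (simp add: eventually_at_filter)
    moreover have "at t within ?Z \<noteq> bot" using t True by (simp add: trivial_limit_within)
    ultimately have "D = 0" using tendsto_unique by blast
    then have "((\<lambda>s. \<bar>q s / (s - t)\<bar>) \<longlongrightarrow> 0) (at t)" using lim tendsto_rabs_zero by blast
    then have "((\<lambda>s. \<bar>q s\<bar> / (s - t)) \<longlongrightarrow> 0) (at t)"
      by (rule Lim_null_comparison[rotated]) (simp add: abs_divide)
    then have "((\<lambda>s. \<bar>q s\<bar>) has_real_derivative 0) (at t)"
      using True by (simp add: has_field_derivative_iff)
    then show ?thesis by (auto simp: real_differentiable_def)
  qed
qed

text \<open>
  By induction from \<open>max a b = (a + b + \<bar>a - b\<bar>) / 2\<close>.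
\<close>

lemma differentiable_Max_except_countable:
  fixes p :: "'i \<Rightarrow> real \<Rightarrow> real"
  assumes "finite F" "F \<noteq> {}"
  obtains C where "countable C" "\<And>t. t \<notin> C \<Longrightarrow> \<forall>i\<in>F. p i differentiable (at t) \<Longrightarrow>
    (\<lambda>s. MAX i\<in>F. p i s) differentiable (at t)"
proof -
  have "\<exists>C. countable C \<and> (\<forall>t. t \<notin> C \<longrightarrow> (\<forall>i\<in>F. p i differentiable (at t)) \<longrightarrow>
    (\<lambda>s. MAX i\<in>F. p i s) differentiable (at t))"
    using assms
  proof (induction F rule: finite_ne_induct)
    case (singleton i)
    then show ?case by (intro exI[of _ "{}"]) auto
  next
    case (insert i F)
    define M where "M s = (MAX i\<in>F. p i s)" for s
    obtain C where C: "countable C" "\<And>t. t \<notin> C \<Longrightarrow> \<forall>i\<in>F. p i differentiable (at t) \<Longrightarrow> M differentiable (at t)"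
      using insert.IH unfolding M_def by blast
    obtain C' where C': "countable C'" "\<And>t. t \<notin> C' \<Longrightarrow> (\<lambda>s. p i s - M s) differentiable (at t) \<Longrightarrow>
      (\<lambda>s. \<bar>p i s - M s\<bar>) differentiable (at t)"
      using differentiable_abs_except_countable[of "\<lambda>s. p i s - M s"] by blast
    have eq: "(\<lambda>s. MAX i\<in>insert i F. p i s) = (\<lambda>s. (p i s + M s + \<bar>p i s - M s\<bar>) * (1 / 2))"
      using insert.hyps by (auto simp: M_def max_def fun_eq_iff)
    show ?case
    proof (intro exI[of _ "C \<union> C'"] conjI allI impI)
      fix t assume t: "t \<notin> C \<union> C'" "\<forall>i\<in>insert i F. p i differentiable (at t)"
      then show "(\<lambda>s. MAX i\<in>insert i F. p i s) differentiable (at t)"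
        unfolding eq using C C'
        by (intro differentiable_mult differentiable_add differentiable_const C'(2) differentiable_diff C(2)) auto
    qed (use C C' in auto)
  qed
  then show thesis using that by blast
qed

lemma interval_lebesgue: "is_interval I \<Longrightarrow> I \<in> sets lebesgue" for I :: "real set"
  using real_interval_borel_measurable by (auto intro: sets_completionI_sets)

lemma AE_lebesgue_on_subinterval:
  fixes I :: "real set"
  assumes "is_interval I" "{a..b} \<subseteq> I" "AE t in lebesgue_on I. P t"
  shows "AE t in lebesgue_on {a..b}. t \<in> {a<..<b} \<and> P t"
proof -
  obtain S where S: "negligible S" "\<forall>t\<in>I - S. P t"
    using assms(3) AE_lebesgue_on_iff_negligible[OF interval_lebesgue[OF assms(1)]] by blast
  have "negligible (S \<union> {a, b})" using S(1) by simp
  moreover have "\<forall>t\<in>{a..b} - (S \<union> {a, b}). t \<in> {a<..<b} \<and> P t" using S(2) assms(2) by auto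
  ultimately show ?thesis
    unfolding AE_lebesgue_on_iff_negligible[OF interval_lebesgue[OF is_interval_cc]] by blast
qed

lemma at_within_subinterval:
  fixes t :: real
  assumes "t \<in> {a<..<b}" "{a..b} \<subseteq> I"
  shows "at t within I = at t"
proof -
  have "t \<in> interior I" using assms by (meson interiorI open_greaterThanLessThan greaterThanLessThan_subseteq_atLeastAtMost_iff order_refl order_trans subset_trans)
  then show ?thesis by (rule at_within_interior)
qed

lemma abs_continuous_on_imp_uniformly_continuous:
  assumes "abs_continuous_on {a..b} f" "e > 0"
  obtains \<delta> where "\<delta> > 0" "\<And>x y. x \<in> {a..b} \<Longrightarrow> y \<in> {a..b} \<Longrightarrow> \<bar>y - x\<bar> < \<delta> \<Longrightarrow> norm (f y - f x) < e"
proof -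
  obtain \<delta> where \<delta>: "\<delta> > 0" "small_variation {a..b} f \<delta> e"
    using assms unfolding abs_continuous_on_iff by blast
  have *: "norm (f y - f x) < e" if "x \<in> {a..b}" "y \<in> {a..b}" "x \<le> y" "y - x < \<delta>" for x y
    using small_variationD[OF \<delta>(2), of "{(x, y)}"] that by (simp add: interval_family_def)
  show thesis
  proof (rule that[OF \<delta>(1)])
    fix x y assume "x \<in> {a..b}" "y \<in> {a..b}" "\<bar>y - x\<bar> < \<delta>"
    then show "norm (f y - f x) < e"
      using *[of x y] *[of y x] by (cases "x \<le> y") (auto simp: norm_minus_commute)
  qed
qed

lemma abs_continuous_on_imp_continuous_on:
  assumes "abs_continuous_on {a..b} f" shows "continuous_on {a..b} f"
proof (rule uniformly_continuous_imp_continuous, unfold uniformly_continuous_on_def, intro allI impI)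
  fix e :: real assume "e > 0"
  then obtain \<delta> where "\<delta> > 0" "\<And>x y. x \<in> {a..b} \<Longrightarrow> y \<in> {a..b} \<Longrightarrow> \<bar>y - x\<bar> < \<delta> \<Longrightarrow> norm (f y - f x) < e"
    using abs_continuous_on_imp_uniformly_continuous[OF assms] by metis
  then show "\<exists>d>0. \<forall>x\<in>{a..b}. \<forall>x'\<in>{a..b}. dist x' x < d \<longrightarrow> dist (f x') (f x) < e"
    by (intro exI[of _ \<delta>]) (auto simp: dist_real_def dist_norm)
qed

text \<open>
  A Gronwall estimate without exponentials: on each of the \<open>m\<close> subintervals of length \<open>1 / m\<close>, the sum of the
  absolute values at most doubles, because its maximum \<open>S\<close> over the subinterval exceeds the initial value
  by at most \<open>L * card B * S / m\<close>, which is at most \<open>S / 2\<close>.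
\<close>

lemma abs_continuous_linear_growth_bound:
  fixes L :: real and B :: "'i set" and p :: "'i \<Rightarrow> real \<Rightarrow> real" and m :: nat
  assumes "L \<ge> 0" and m0: "0 < real m" "2 * (L * card B) \<le> real m"
    and ac: "\<And>j. j \<in> B \<Longrightarrow> abs_continuous_on {0..1} (p j)"
    and der: "\<And>j. j \<in> B \<Longrightarrow> AE \<tau> in lebesgue_on {0..1}. \<exists>d. (p j has_real_derivative d) (at \<tau> within {0..1}) \<and>
      \<bar>d\<bar> \<le> L * (\<Sum>j\<in>B. \<bar>p j \<tau>\<bar>)"
    and i: "i \<in> B" and st: "0 \<le> s" "s \<le> t" "t \<le> 1"
  shows "\<bar>p i t - p i s\<bar> \<le> L * 2 ^ m * (\<Sum>j\<in>B. \<bar>p j 0\<bar>) * (t - s)"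
proof -
  define S where "S \<tau> = (\<Sum>j\<in>B. \<bar>p j \<tau>\<bar>)" for \<tau>
  have S0: "S \<tau> \<ge> 0" for \<tau> unfolding S_def by (simp add: sum_nonneg)
  have S_diff: "S y - S x \<le> (\<Sum>j\<in>B. \<bar>p j y - p j x\<bar>)" for x y
    unfolding S_def sum_subtractf[symmetric] by (intro sum_mono) linarith
  have "continuous_on {0..1} S"
    unfolding S_def[abs_def] by (intro continuous_intros abs_continuous_on_imp_continuous_on ac)
  have step: "\<bar>p j t - p j s\<bar> \<le> L * M * (t - s)"
    if j: "j \<in> B" and st: "0 \<le> s" "s \<le> t" "t \<le> 1" and M: "\<And>\<tau>. \<tau> \<in> {s..t} \<Longrightarrow> S \<tau> \<le> M" for j s t M
  proof -
    have sub: "{s..t} \<subseteq> {0..1}" using st by auto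
    have acj: "abs_continuous_on {s..t} (p j)" by (rule abs_continuous_on_subset[OF ac[OF j] sub])
    have AE: "AE \<tau> in lebesgue_on {s..t}. \<exists>d. (p j has_real_derivative d) (at \<tau> within {s..t}) \<and> \<bar>d\<bar> \<le> L * M"
    proof (rule eventually_mono[OF AE_lebesgue_on_subinterval[OF is_interval_cc sub der[OF j]]])
      fix \<tau> assume \<tau>: "\<tau> \<in> {s<..<t} \<and> (\<exists>d. (p j has_real_derivative d) (at \<tau> within {0..1}) \<and>
        \<bar>d\<bar> \<le> L * (\<Sum>j\<in>B. \<bar>p j \<tau>\<bar>))"
      then have "L * S \<tau> \<le> L * M" using M[of \<tau>] \<open>L \<ge> 0\<close> by (intro mult_left_mono) auto
      then show "\<exists>d. (p j has_real_derivative d) (at \<tau> within {s..t}) \<and> \<bar>d\<bar> \<le> L * M"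
        using \<tau> sub unfolding S_def by (meson has_field_derivative_subset order_trans)
    qed
    have "p j t - p j s \<le> L * M * (t - s)"
      by (rule abs_continuous_increment_le[OF acj st(2) eventually_mono[OF AE]]) (auto simp: abs_le_iff)
    moreover have "- p j t - - p j s \<le> L * M * (t - s)"
    proof (rule abs_continuous_increment_le[OF _ st(2) eventually_mono[OF AE]])
      show "abs_continuous_on {s..t} (\<lambda>\<tau>. - p j \<tau>)"
        by (rule abs_continuous_on_lipschitz[OF acj, where B = 1]) simp
    qed (auto simp: abs_le_iff intro: DERIV_minus)
    ultimately show ?thesis by linarith
  qed
  have grow: "\<forall>\<tau>\<in>{0..real k / m}. S \<tau> \<le> 2 ^ k * S 0" if "k \<le> m" for k
    using that
  proof (induction k)
    case (Suc k)
    let ?x = "real k / m" and ?y = "real (Suc k) / m"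
    have xy: "0 \<le> ?x" "?x \<le> ?y" "?y \<le> 1" "?y - ?x = 1 / m"
      using Suc.prems m0 by (auto simp: divide_simps)
    then have "{?x..?y} \<subseteq> {0..1}" by auto
    then have "continuous_on {?x..?y} S"
      using \<open>continuous_on {0..1} S\<close> by (rule continuous_on_subset[rotated])
    then obtain z where z: "z \<in> {?x..?y}" "\<And>\<tau>. \<tau> \<in> {?x..?y} \<Longrightarrow> S \<tau> \<le> S z"
      using continuous_attains_sup[of "{?x..?y}" S] xy by auto
    have "S z - S ?x \<le> (\<Sum>j\<in>B. \<bar>p j z - p j ?x\<bar>)" by (rule S_diff)
    also have "\<dots> \<le> (\<Sum>j\<in>B. L * S z * (1 / m))"
    proof (rule sum_mono)
      fix j assume j: "j \<in> B"
      have "\<bar>p j z - p j ?x\<bar> \<le> L * S z * (z - ?x)"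
        by (rule step[OF j]) (use z xy in auto)
      also have "\<dots> \<le> L * S z * (1 / m)"
        using z xy \<open>L \<ge> 0\<close> S0 by (intro mult_left_mono) auto
      finally show "\<bar>p j z - p j ?x\<bar> \<le> L * S z * (1 / m)" .
    qed
    also have "\<dots> = (L * card B / m) * S z" by simp
    also have "\<dots> \<le> (1 / 2) * S z" using m0 S0 by (intro mult_right_mono) (auto simp: divide_simps)
    finally have "S z \<le> 2 * S ?x" by simp
    also have "\<dots> \<le> 2 ^ Suc k * S 0" using Suc xy by auto
    finally have Sz: "S z \<le> 2 ^ Suc k * S 0" .
    show ?case
    proof
      fix \<tau> assume \<tau>: "\<tau> \<in> {0..?y}"
      show "S \<tau> \<le> 2 ^ Suc k * S 0"
      proof (cases "\<tau> \<le> ?x")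
        case True
        then have "S \<tau> \<le> 2 ^ k * S 0" using Suc \<tau> by auto
        also have "\<dots> \<le> 2 ^ Suc k * S 0" using S0 by (intro mult_right_mono) auto
        finally show ?thesis .
      next
        case False
        then show ?thesis using z(2)[of \<tau>] \<tau> Sz by auto
      qed
    qed
  qed simp
  have "\<bar>p i t - p i s\<bar> \<le> L * (2 ^ m * S 0) * (t - s)"
    by (rule step[OF i st]) (use grow[of m] m0 st in auto)
  then show "\<bar>p i t - p i s\<bar> \<le> L * 2 ^ m * (\<Sum>j\<in>B. \<bar>p j 0\<bar>) * (t - s)"
    by (simp add: S_def mult.assoc)
qed

lemma is_interval_neighbourhood:
  fixes I :: "real set"
  assumes I: "is_interval I" "t \<in> I"
  obtains a b e where "e > 0" "a \<le> t" "t \<le> b" "{a..b} \<subseteq> I" "ball t e \<inter> I \<subseteq> {a..b}"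
proof -
  obtain a where a: "a \<in> I" "a \<le> t" "a = t \<longrightarrow> (\<forall>x\<in>I. t \<le> x)"
    using I(2) by (metis le_less_linear less_imp_le less_irrefl)
  obtain b where b: "b \<in> I" "t \<le> b" "b = t \<longrightarrow> (\<forall>x\<in>I. x \<le> t)"
    using I(2) by (metis le_less_linear less_imp_le less_irrefl)
  define e where "e = min (if a = t then 1 else t - a) (if b = t then 1 else b - t)"
  show thesis
  proof (rule that[of e a b])
    show "e > 0" using a b by (auto simp: e_def)
    show "{a..b} \<subseteq> I" using I a b by (meson is_interval_1 atLeastAtMost_iff subsetI)
    show "ball t e \<inter> I \<subseteq> {a..b}"
    proof
      fix x assume x: "x \<in> ball t e \<inter> I"
      then have *: "\<bar>t - x\<bar> < e" by (simp add: dist_real_def)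
      have "a \<le> x" using a(3) x * by (cases "a = t") (auto simp: e_def)
      moreover have "x \<le> b" using b(3) x * by (cases "b = t") (auto simp: e_def)
      ultimately show "x \<in> {a..b}" by simp
    qed
  qed (use a b in auto)
qed

section \<open>Polyhedral norms\<close>

lemma linear_le_on_convex_hull:
  assumes "linear p" "\<And>f. f \<in> F \<Longrightarrow> p f \<le> (c::real)" "x \<in> convex hull F"
  shows "p x \<le> c"
proof -
  have "convex (p -` {..c})" by (rule convex_linear_vimage[OF assms(1)]) simp
  then have "convex hull F \<subseteq> p -` {..c}" using assms(2) by (intro hull_minimal) auto
  then show ?thesis using assms(3) by auto
qed

text \<open>
  If \<open>x\<close> is a convex combination of \<open>F\<close> and \<open>p\<close> attains at \<open>x\<close> its maximum over \<open>F\<close>, then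
  only those points of \<open>F\<close> have positive weight at which \<open>p\<close> attains this maximum.
\<close>

lemma linear_const_on_exposed_face:
  fixes p q :: "'v::real_vector \<Rightarrow> real"
  assumes "finite F" "x \<in> convex hull F" and p: "linear p" "p x = c" "\<And>f. f \<in> F \<Longrightarrow> p f \<le> c"
    and q: "linear q" "\<And>f. f \<in> F \<Longrightarrow> p f = c \<Longrightarrow> q f = d"
  shows "q x = d"
proof -
  obtain u where u: "\<forall>f\<in>F. 0 \<le> u f" "sum u F = 1" "(\<Sum>f\<in>F. u f *\<^sub>R f) = x"
    using assms(1,2) by (auto simp: convex_hull_finite)
  have "p x = (\<Sum>f\<in>F. u f * p f)"
    unfolding u(3)[symmetric] by (simp add: linear_sum[OF p(1)] linear_scale[OF p(1)])
  then have "(\<Sum>f\<in>F. u f * (c - p f)) = 0"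
    using p(2) u(2) by (simp add: right_diff_distrib sum_subtractf sum_distrib_right[symmetric])
  then have "\<forall>f\<in>F. u f * (c - p f) = 0"
    using assms(1) u(1) p(3) by (subst (asm) sum_nonneg_eq_0_iff) auto
  then have *: "\<forall>f\<in>F. u f * q f = u f * d" using q(2) by auto
  have "q x = (\<Sum>f\<in>F. u f * q f)"
    unfolding u(3)[symmetric] by (simp add: linear_sum[OF q(1)] linear_scale[OF q(1)])
  also have "\<dots> = (\<Sum>f\<in>F. u f * d)" by (rule sum.cong) (use * in auto)
  also have "\<dots> = d" using u(2) by (simp add: sum_distrib_right[symmetric])
  finally show ?thesis .
qed

lemma nonpos_if_le_small_multiples:
  fixes a b :: real
  assumes "\<And>h. h > 0 \<Longrightarrow> a \<le> h * b"
  shows "a \<le> 0"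
proof (rule ccontr)
  assume "\<not> a \<le> 0"
  with assms[of 1] have "a > 0" "b > 0" by auto
  then show False using assms[of "a / (2 * b)"] by simp
qed

lemma norm_onD:
  assumes "norm_on V N"
  shows "subspace V" "x \<in> V \<Longrightarrow> N x \<ge> 0" "x \<in> V \<Longrightarrow> N x = 0 \<longleftrightarrow> x = 0"
    "x \<in> V \<Longrightarrow> N (c *\<^sub>R x) = \<bar>c\<bar> * N x" "x \<in> V \<Longrightarrow> y \<in> V \<Longrightarrow> N (x + y) \<le> N x + N y" "N 0 = 0"
  using assms unfolding norm_on_def by (auto simp: subspace_0)

text \<open>
  The subgradient inequality is tested along the ray through \<open>w\<close>, which gives the equation, and along
  the ray from \<open>w\<close> in the direction \<open>v\<close>, which gives the inequality.
\<close>

lemma subdifferential_energyD: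
  assumes N: "norm_on V N" and w: "w \<in> V" and \<eta>: "\<eta> \<in> subdifferential V (energy N) w"
  shows "linear \<eta>" "\<eta> w = (N w)\<^sup>2" "v \<in> V \<Longrightarrow> \<eta> v \<le> N w * N v"
proof -
  note N = norm_onD[OF N]
  show lin: "linear \<eta>" using \<eta> by (simp add: subdifferential_def)
  have sub: "\<eta> (h *\<^sub>R v) \<le> (N (w + h *\<^sub>R v))\<^sup>2 / 2 - (N w)\<^sup>2 / 2" if "v \<in> V" for h v
  proof -
    have "w + h *\<^sub>R v \<in> V" using w that N(1) by (simp add: subspace_add subspace_scale)
    then have "\<eta> (w + h *\<^sub>R v - w) \<le> energy N (w + h *\<^sub>R v) - energy N w"
      using \<eta> unfolding subdifferential_def by blast
    then show ?thesis by (simp add: energy_def)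
  qed
  have *: "h * \<eta> w \<le> h * (N w)\<^sup>2 + h * h * ((N w)\<^sup>2 / 2)" for h
  proof -
    have "w + h *\<^sub>R w = (1 + h) *\<^sub>R w" by (simp add: scaleR_add_left)
    then have "(N (w + h *\<^sub>R w))\<^sup>2 = (1 + h)\<^sup>2 * (N w)\<^sup>2"
      using N(4)[OF w] by (simp add: power_mult_distrib)
    then show ?thesis
      using sub[OF w, of h] by (simp add: linear_scale[OF lin] power2_eq_square field_simps)
  qed
  have "\<eta> w - (N w)\<^sup>2 \<le> 0"
  proof (rule nonpos_if_le_small_multiples)
    fix h :: real assume "h > 0"
    have "h * (\<eta> w - (N w)\<^sup>2) \<le> h * (h * ((N w)\<^sup>2 / 2))" using *[of h] by (simp add: algebra_simps)
    then show "\<eta> w - (N w)\<^sup>2 \<le> h * ((N w)\<^sup>2 / 2)" using \<open>h > 0\<close> by simp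
  qed
  moreover have "(N w)\<^sup>2 - \<eta> w \<le> 0"
  proof (rule nonpos_if_le_small_multiples)
    fix h :: real assume "h > 0"
    have "h * ((N w)\<^sup>2 - \<eta> w) \<le> h * (h * ((N w)\<^sup>2 / 2))" using *[of "- h"] by (simp add: algebra_simps)
    then show "(N w)\<^sup>2 - \<eta> w \<le> h * ((N w)\<^sup>2 / 2)" using \<open>h > 0\<close> by simp
  qed
  ultimately show "\<eta> w = (N w)\<^sup>2" by simp
  show "\<eta> v \<le> N w * N v" if v: "v \<in> V"
  proof -
    have "\<eta> v - N w * N v \<le> 0"
    proof (rule nonpos_if_le_small_multiples)
      fix h :: real assume "h > 0"
      have hv: "h *\<^sub>R v \<in> V" using v N(1) by (simp add: subspace_scale)
      have "N (w + h *\<^sub>R v) \<le> N w + h * N v"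
        using N(5)[OF w hv] N(4)[OF v, of h] \<open>h > 0\<close> by simp
      moreover have "N (w + h *\<^sub>R v) \<ge> 0" using w hv N(1,2) by (simp add: subspace_add)
      ultimately have "(N (w + h *\<^sub>R v))\<^sup>2 \<le> (N w + h * N v)\<^sup>2" by (rule power_mono)
      then have "h * (\<eta> v - N w * N v) \<le> h * (h * ((N v)\<^sup>2 / 2))"
        using sub[OF v, of h] by (simp add: linear_scale[OF lin] power2_eq_square algebra_simps)
      then show "\<eta> v - N w * N v \<le> h * ((N v)\<^sup>2 / 2)" using \<open>h > 0\<close> by simp
    qed
    then show ?thesis by simp
  qed
qed

lemma polyhedral_vertices:
  assumes N: "norm_on V N" and F: "{x\<in>V. N x \<le> 1} = convex hull F"
  shows "f \<in> F \<Longrightarrow> f \<in> V" "f \<in> F \<Longrightarrow> N f \<le> 1" "F \<noteq> {}" "0 \<in> convex hull F"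
    "x \<in> V \<Longrightarrow> N x = c \<Longrightarrow> c > 0 \<Longrightarrow> (1 / c) *\<^sub>R x \<in> convex hull F"
proof -
  note N = norm_onD[OF N]
  show 0: "0 \<in> convex hull F" unfolding F[symmetric] using N(1,6) by (simp add: subspace_0)
  then show "F \<noteq> {}" by auto
  show "f \<in> F \<Longrightarrow> f \<in> V" "f \<in> F \<Longrightarrow> N f \<le> 1"
    using hull_subset[of F convex] F by auto
  assume "x \<in> V" "N x = c" "c > 0"
  then show "(1 / c) *\<^sub>R x \<in> convex hull F"
    unfolding F[symmetric] using N(1) N(4)[of x "1 / c"] by (simp add: subspace_scale)
qed

text \<open>
  The dual norm of a subgradient of the energy at \<open>w\<close> is the norm of \<open>w\<close>.
\<close>

lemma polyhedral_subdifferential_Max: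
  assumes N: "norm_on V N" and F: "finite F" "{x\<in>V. N x \<le> 1} = convex hull F"
    and w: "w \<in> V" and \<eta>: "\<eta> \<in> subdifferential V (energy N) w"
  shows "(MAX f\<in>F. \<eta> f) = N w"
proof -
  note V = polyhedral_vertices[OF N F(2)] and sd = subdifferential_energyD[OF N w \<eta>]
  have le: "\<eta> f \<le> N w" if "f \<in> F" for f
    using sd(3)[OF V(1)[OF that]] V(2)[OF that] norm_onD(2)[OF N w]
      mult_left_mono[of "N f" 1 "N w"] by linarith
  have ge: "N w \<le> (MAX f\<in>F. \<eta> f)"
  proof (cases "N w = 0")
    case True
    have "\<eta> 0 \<le> (MAX f\<in>F. \<eta> f)"
      by (rule linear_le_on_convex_hull[OF sd(1) _ V(4)]) (use F(1) in auto)
    then show ?thesis using True linear_0[OF sd(1)] by simp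
  next
    case False
    then have c: "N w > 0" using norm_onD(2)[OF N w] by simp
    have "\<eta> ((1 / N w) *\<^sub>R w) \<le> (MAX f\<in>F. \<eta> f)"
      by (rule linear_le_on_convex_hull[OF sd(1) _ V(5)[OF w refl c]]) (use F(1) in auto)
    then show ?thesis using sd(2) c by (simp add: linear_scale[OF sd(1)] power2_eq_square)
  qed
  show ?thesis
    by (rule antisym[OF _ ge]) (use F(1) V(3) le in auto)
qed

lemma orthonormal_basis_of_subspace:
  fixes V :: "'a::euclidean_space set"
  assumes "subspace V"
  obtains B where "finite B" "B \<subseteq> V" "\<And>b. b \<in> B \<Longrightarrow> norm b = 1"
    "\<And>x. x \<in> V \<Longrightarrow> (\<Sum>b\<in>B. (x \<bullet> b) *\<^sub>R b) = x"
proof -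
  obtain B where B: "B \<subseteq> V" "pairwise orthogonal B" "\<And>b. b \<in> B \<Longrightarrow> norm b = 1"
    "independent B" "span B = V"
    using orthonormal_basis_subspace[OF assms] by metis
  have "finite B" using B(4) by (rule independent_imp_finite)
  show thesis
    by (rule that[OF \<open>finite B\<close> B(1,3)])
      (use B \<open>finite B\<close> orthonormal_basis_expand[of B] in auto)
qed

lemma norm_on_le_norm:
  fixes V :: "'a::euclidean_space set"
  assumes "norm_on V N"
  obtains C where "C \<ge> 0" "\<And>x. x \<in> V \<Longrightarrow> N x \<le> C * norm x"
proof -
  note N = norm_onD[OF assms]
  obtain B where B: "finite B" "B \<subseteq> V" "\<And>b. b \<in> B \<Longrightarrow> norm b = 1"
    "\<And>x. x \<in> V \<Longrightarrow> (\<Sum>b\<in>B. (x \<bullet> b) *\<^sub>R b) = x"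
    using orthonormal_basis_of_subspace[OF N(1)] by metis
  have sum: "N (\<Sum>b\<in>A. g b *\<^sub>R b) \<le> (\<Sum>b\<in>A. \<bar>g b\<bar> * N b)" if "A \<subseteq> B" for A g
    using finite_subset[OF that B(1)] that
  proof (induction A rule: finite_induct)
    case empty
    then show ?case using N(6) by simp
  next
    case (insert b A)
    have "b \<in> V" using insert B by auto
    have "(\<Sum>b\<in>A. g b *\<^sub>R b) \<in> V" using insert B N(1) by (intro subspace_sum subspace_scale) auto
    then have "N (g b *\<^sub>R b + (\<Sum>b\<in>A. g b *\<^sub>R b)) \<le> N (g b *\<^sub>R b) + N (\<Sum>b\<in>A. g b *\<^sub>R b)"
      using N(1) \<open>b \<in> V\<close> by (intro N(5)) (auto simp: subspace_scale)
    then show ?case using insert N(4)[OF \<open>b \<in> V\<close>, of "g b"] by simp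
  qed
  show thesis
  proof
    show "0 \<le> (\<Sum>b\<in>B. N b)" using B N by (intro sum_nonneg) auto
    fix x assume x: "x \<in> V"
    have "N x \<le> (\<Sum>b\<in>B. \<bar>x \<bullet> b\<bar> * N b)" using sum[of B "\<lambda>b. x \<bullet> b"] B(4)[OF x] by simp
    also have "\<dots> \<le> (\<Sum>b\<in>B. norm x * N b)"
      using Cauchy_Schwarz_ineq2[of x] B N(2) by (intro sum_mono mult_right_mono) (auto, metis mult.right_neutral)
    finally show "N x \<le> (\<Sum>b\<in>B. N b) * norm x" by (simp add: sum_distrib_left mult.commute)
  qed
qed

lemma polyhedral_norm_le:
  fixes V :: "'a::euclidean_space set"
  assumes N: "norm_on V N" and F: "finite F" "{x\<in>V. N x \<le> 1} = convex hull F"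
  obtains R where "R > 0" "\<And>x. x \<in> V \<Longrightarrow> norm x \<le> R * N x"
proof -
  have "bounded (convex hull F)" using F(1) by (simp add: finite_imp_bounded bounded_convex_hull)
  then obtain R where R: "R > 0" "\<And>x. x \<in> convex hull F \<Longrightarrow> norm x \<le> R"
    by (auto simp: bounded_pos)
  show thesis
  proof
    fix x assume x: "x \<in> V"
    show "norm x \<le> R * N x"
    proof (cases "x = 0")
      case False
      then have "N x > 0" using norm_onD(2,3)[OF N x] by linarith
      then have "norm ((1 / N x) *\<^sub>R x) \<le> R" by (intro R(2) polyhedral_vertices(5)[OF N F(2) x]) auto
      then show ?thesis using \<open>N x > 0\<close> by (simp add: field_simps)
    qed (use norm_onD(6)[OF N] in simp)
  qed (rule R)
qed

text \<open>
  The unit sphere of the dual norm. A functional on \<open>V\<close> is represented by the vector of \<open>V\<close> that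
  induces it through the inner product.
\<close>

definition dual_sphere :: "'a::euclidean_space set \<Rightarrow> 'a set \<Rightarrow> 'a set" where
  "dual_sphere V F = {y\<in>V. (\<forall>f\<in>F. y \<bullet> f \<le> 1) \<and> (\<exists>f\<in>F. y \<bullet> f = 1)}"

lemma compact_dual_sphere:
  fixes V :: "'a::euclidean_space set"
  assumes N: "norm_on V N" and F: "finite F" "{x\<in>V. N x \<le> 1} = convex hull F"
  shows "compact (dual_sphere V F)"
proof -
  note V = polyhedral_vertices[OF N F(2)]
  have "dual_sphere V F = V \<inter> (\<Inter>f\<in>F. {y. f \<bullet> y \<le> 1}) \<inter> (\<Union>f\<in>F. {y. f \<bullet> y = 1})"
    by (auto simp: dual_sphere_def inner_commute)
  moreover have "closed \<dots>"
    using F(1) by (intro closed_Int closed_INT closed_UN closed_subspace norm_onD(1)[OF N] ballI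
      closed_halfspace_le closed_hyperplane)
  moreover have "bounded (dual_sphere V F)"
  proof -
    obtain C where C: "C \<ge> 0" "\<And>x. x \<in> V \<Longrightarrow> N x \<le> C * norm x"
      using norm_on_le_norm[OF N] by blast
    have "norm y \<le> C" if y: "y \<in> dual_sphere V F" for y
    proof (cases "y = 0")
      case False
      have "y \<in> V" using y by (simp add: dual_sphere_def)
      then have Ny: "N y > 0" using norm_onD(2,3)[OF N] False by force
      have "y \<bullet> ((1 / N y) *\<^sub>R y) \<le> 1"
        by (rule linear_le_on_convex_hull[where F = F])
          (use y V(5)[OF \<open>y \<in> V\<close> refl Ny] in \<open>auto simp: dual_sphere_def intro!: bounded_linear.linear bounded_linear_inner_right\<close>)
      then have "norm y * norm y \<le> C * norm y"
        using Ny C(2)[OF \<open>y \<in> V\<close>] by (simp add: dot_square_norm power2_eq_square field_simps)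
      then show ?thesis using False by simp
    qed (use C in simp)
    then show ?thesis by (auto simp: bounded_iff)
  qed
  ultimately show ?thesis by (simp add: compact_eq_bounded_closed)
qed

text \<open>
  For fixed \<open>\<eta>\<close>, the functionals that differ from one at those points of \<open>F\<close> where \<open>\<eta>\<close> differs from
  one form an open set containing \<open>\<eta>\<close>, and \<open>\<delta>\<close> is a Lebesgue number of this cover of the compact dual
  sphere. Geometrically, all functionals near \<open>y\<close> expose subfaces of one common face.
\<close>

lemma dual_sphere_uniform_face:
  fixes V :: "'a::euclidean_space set"
  assumes N: "norm_on V N" and F: "finite F" "{x\<in>V. N x \<le> 1} = convex hull F"
  obtains \<delta> where "\<delta> > 0" "\<And>y. y \<in> dual_sphere V F \<Longrightarrow> \<exists>\<eta>\<in>dual_sphere V F. \<forall>z\<in>dual_sphere V F.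
    dist y z < \<delta> \<longrightarrow> (\<forall>f\<in>F. z \<bullet> f = 1 \<longrightarrow> \<eta> \<bullet> f = 1)"
proof -
  define U where "U \<eta> = (\<Inter>f\<in>{f\<in>F. \<eta> \<bullet> f \<noteq> 1}. {z. f \<bullet> z \<noteq> 1})" for \<eta> :: 'a
  have opn: "open (U \<eta>)" for \<eta>
  proof -
    have "{z. f \<bullet> z \<noteq> 1} = - {z. f \<bullet> z = 1}" for f :: 'a by auto
    then have "open {z. f \<bullet> z \<noteq> 1}" for f :: 'a
      using closed_hyperplane[of f 1] by (simp add: open_Compl)
    then show ?thesis unfolding U_def using F(1) by (intro open_INT) auto
  qed
  have "y \<in> U y" for y by (auto simp: U_def inner_commute)
  then have "dual_sphere V F \<subseteq> \<Union> (U ` dual_sphere V F)" by blast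
  then obtain \<delta> where \<delta>: "\<delta> > 0"
    "\<And>y. y \<in> dual_sphere V F \<Longrightarrow> \<exists>G\<in>U ` dual_sphere V F. ball y \<delta> \<subseteq> G"
    by (rule Heine_Borel_lemma[OF compact_dual_sphere[OF assms]]) (use opn in auto)
  show thesis
  proof (rule that[OF \<delta>(1)])
    fix y assume "y \<in> dual_sphere V F"
    then obtain \<eta> where "\<eta> \<in> dual_sphere V F" "ball y \<delta> \<subseteq> U \<eta>" using \<delta>(2) by blast
    then show "\<exists>\<eta>\<in>dual_sphere V F. \<forall>z\<in>dual_sphere V F.
      dist y z < \<delta> \<longrightarrow> (\<forall>f\<in>F. z \<bullet> f = 1 \<longrightarrow> \<eta> \<bullet> f = 1)"
      by (intro bexI[of _ \<eta>]) (auto simp: U_def inner_commute subset_iff)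
  qed
qed

text \<open>
  The bipolar theorem for the unit ball: otherwise a hyperplane would separate a multiple of \<open>z\<close> from it.
\<close>

lemma polyhedral_norm_bipolar:
  fixes V :: "'a::euclidean_space set"
  assumes N: "norm_on V N" and F: "finite F" "{x\<in>V. N x \<le> 1} = convex hull F"
    and z: "z \<in> V" and c: "c \<ge> 0" and le: "\<And>y. \<forall>f\<in>F. y \<bullet> f \<le> 1 \<Longrightarrow> y \<bullet> z \<le> c"
  shows "N z \<le> c"
proof (rule ccontr)
  assume "\<not> N z \<le> c"
  then obtain c' where c': "c < c'" "c' < N z" using dense[of c "N z"] by auto
  note V = polyhedral_vertices[OF N F(2)]
  have "N ((1 / c') *\<^sub>R z) > 1" using norm_onD(4)[OF N z] c c' by simp
  then have "(1 / c') *\<^sub>R z \<notin> convex hull F" unfolding F(2)[symmetric] by simp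
  moreover have "closed (convex hull F)" using F(1) by (simp add: finite_imp_compact_convex_hull compact_imp_closed)
  ultimately obtain a b where ab: "a \<bullet> ((1 / c') *\<^sub>R z) < b" "\<forall>x\<in>convex hull F. a \<bullet> x > b"
    using separating_hyperplane_closed_point[of "convex hull F"] by (metis convex_convex_hull)
  have "b < 0" using ab(2) V(4) by force
  define y where "y = (1 / b) *\<^sub>R a"
  have "\<forall>f\<in>F. y \<bullet> f \<le> 1"
  proof
    fix f assume "f \<in> F"
    then have "b < a \<bullet> f" using ab(2) hull_subset[of F convex] by blast
    then show "y \<bullet> f \<le> 1" using \<open>b < 0\<close> by (simp add: y_def divide_le_eq)
  qed
  then have "y \<bullet> z \<le> c" by (rule le)
  moreover have "y \<bullet> z > c'"
  proof -
    have "a \<bullet> z < b * c'" using ab(1) c c' by (simp add: field_simps)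
    then show ?thesis using \<open>b < 0\<close> by (simp add: y_def less_divide_eq mult.commute)
  qed
  ultimately show False using c' by simp
qed

text \<open>
  All norms on the finite-dimensional dual space are equivalent: a norm is continuous, so it has a positive minimum
  on the compact unit sphere of the operator norm.
\<close>

lemma norm_on_dual_ge:
  fixes Nstar :: "('a::euclidean_space \<Rightarrow>\<^sub>L real) \<Rightarrow> real"
  assumes "norm_on UNIV Nstar"
  obtains C where "C > 0" "\<And>\<xi>. norm \<xi> \<le> C * Nstar \<xi>"
proof -
  note N = norm_onD[OF assms, simplified]
  define e :: "'a \<Rightarrow> 'a \<Rightarrow>\<^sub>L real" where "e b = blinfun_inner_left b" for b
  define K where "K = (\<Sum>b\<in>Basis. Nstar (e b))"
  have "K \<ge> 0" unfolding K_def by (intro sum_nonneg N(2))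
  have sum: "Nstar (\<Sum>b\<in>A. g b) \<le> (\<Sum>b\<in>A. Nstar (g b))" if "finite A" for A and g :: "'a \<Rightarrow> 'a \<Rightarrow>\<^sub>L real"
    using that
  proof (induction A rule: finite_induct)
    case (insert b A)
    then show ?case using N(5)[of "g b" "sum g A"] by simp
  qed (use N(6) in simp)
  have upper: "Nstar \<xi> \<le> K * norm \<xi>" for \<xi>
  proof -
    have "\<xi> = (\<Sum>b\<in>Basis. \<xi> b *\<^sub>R e b)"
    proof (rule blinfun_eqI)
      fix x
      have "\<xi> x = \<xi> (\<Sum>b\<in>Basis. (x \<bullet> b) *\<^sub>R b)" by (simp add: euclidean_representation)
      also have "\<dots> = (\<Sum>b\<in>Basis. (x \<bullet> b) * \<xi> b)" by (simp add: blinfun.sum_right blinfun.scaleR_right)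
      finally show "\<xi> x = (\<Sum>b\<in>Basis. \<xi> b *\<^sub>R e b) x"
        by (simp add: blinfun.sum_left blinfun.scaleR_left e_def mult.commute)
    qed
    then have "Nstar \<xi> \<le> (\<Sum>b\<in>Basis. Nstar (\<xi> b *\<^sub>R e b))"
      using sum[OF finite_Basis, of "\<lambda>b. \<xi> b *\<^sub>R e b"] by simp
    also have "\<dots> = (\<Sum>b\<in>Basis. \<bar>\<xi> b\<bar> * Nstar (e b))" by (simp add: N(4))
    also have "\<dots> \<le> (\<Sum>b\<in>Basis. norm \<xi> * Nstar (e b))"
      using norm_blinfun[of \<xi>] by (intro sum_mono mult_right_mono N(2)) (auto, metis mult.right_neutral norm_Basis)
    finally show ?thesis by (simp add: K_def sum_distrib_left mult.commute)
  qed
  have lip: "\<bar>Nstar \<xi> - Nstar \<zeta>\<bar> \<le> K * dist \<xi> \<zeta>" for \<xi> \<zeta>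
  proof -
    have "Nstar \<xi> \<le> Nstar \<zeta> + Nstar (\<xi> - \<zeta>)" "Nstar \<zeta> \<le> Nstar \<xi> + Nstar (\<zeta> - \<xi>)"
      using N(5)[of \<zeta> "\<xi> - \<zeta>"] N(5)[of \<xi> "\<zeta> - \<xi>"] by simp_all
    then show ?thesis using upper[of "\<xi> - \<zeta>"] upper[of "\<zeta> - \<xi>"] by (simp add: dist_norm norm_minus_commute)
  qed
  have "K-lipschitz_on UNIV Nstar"
    using lip \<open>K \<ge> 0\<close> by (auto simp: lipschitz_on_def dist_real_def)
  then have cont: "continuous_on (sphere 0 1) Nstar"
    by (meson lipschitz_on_continuous_on continuous_on_subset subset_UNIV)
  show thesis
  proof (cases "sphere (0 :: 'a \<Rightarrow>\<^sub>L real) 1 = {}")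
    case True
    have "\<xi> = 0" for \<xi> :: "'a \<Rightarrow>\<^sub>L real"
    proof (rule ccontr)
      assume "\<xi> \<noteq> 0"
      then have "sgn \<xi> \<in> sphere 0 1" by (simp add: norm_sgn)
      then show False using True by blast
    qed
    then have zero: "norm \<xi> = 0" for \<xi> :: "'a \<Rightarrow>\<^sub>L real" unfolding norm_eq_zero .
    show thesis by (rule that[of 1]) (simp_all only: zero mult_1 N(2) zero_less_one)
  next
    case False
    have "sphere (0 :: 'a \<Rightarrow>\<^sub>L real) 1 = {\<xi>. norm \<xi> = 1}" by auto
    moreover have "closed {\<xi> :: 'a \<Rightarrow>\<^sub>L real. norm \<xi> = 1}"
      by (intro closed_Collect_eq continuous_intros)
    moreover have "bounded {\<xi> :: 'a \<Rightarrow>\<^sub>L real. norm \<xi> = 1}"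
      by (auto simp: bounded_iff)
    ultimately have "compact (sphere (0 :: 'a \<Rightarrow>\<^sub>L real) 1)"
      by (simp add: compact_eq_bounded_closed)
    then obtain \<zeta> where \<zeta>: "\<zeta> \<in> sphere 0 1" "\<And>\<xi>. \<xi> \<in> sphere 0 1 \<Longrightarrow> Nstar \<zeta> \<le> Nstar \<xi>"
      using continuous_attains_inf[OF _ False cont] by blast
    have pos: "Nstar \<zeta> > 0" using \<zeta>(1) N(2)[of \<zeta>] N(3)[of \<zeta>] by (auto simp: less_le)
    show thesis
    proof (rule that[of "1 / Nstar \<zeta>"])
      fix \<xi> :: "'a \<Rightarrow>\<^sub>L real"
      show "norm \<xi> \<le> 1 / Nstar \<zeta> * Nstar \<xi>"
      proof (cases "\<xi> = 0")
        case False
        then have "Nstar \<zeta> \<le> Nstar ((1 / norm \<xi>) *\<^sub>R \<xi>)" by (intro \<zeta>(2)) simp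
        then show ?thesis using False pos by (simp add: N(4) field_simps)
      qed (use N(6) in simp)
    qed (use pos in simp)
  qed
qed

section \<open>Maps of class \<open>C\<^sup>k\<close>\<close>

lemma Ck_on_SucD:
  assumes "Ck_on (Suc k) S f"
  shows "x \<in> S \<Longrightarrow> (f has_derivative frechet_derivative f (at x)) (at x)"
    "Ck_on k S (\<lambda>x. frechet_derivative f (at x) v)"
  using assms by (auto simp: frechet_derivative_works[symmetric])

lemma Ck_on_cong:
  assumes "open S" "\<And>x. x \<in> S \<Longrightarrow> f x = g x" "Ck_on k S f"
  shows "Ck_on k S g"
  using assms(2,3)
proof (induction k arbitrary: f g)
  case 0
  then show ?case using continuous_on_cong by fastforce
next
  case (Suc k)
  have der: "(g has_derivative frechet_derivative f (at x)) (at x)" if "x \<in> S" for x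
    using Ck_on_SucD(1)[OF Suc.prems(2) that] \<open>open S\<close> that Suc.prems(1)
    by (rule has_derivative_transform_within_open)
  then have eq: "frechet_derivative f (at x) = frechet_derivative g (at x)" if "x \<in> S" for x
    using frechet_derivative_at that by blast
  have "Ck_on k S (\<lambda>x. frechet_derivative g (at x) v)" for v
    by (rule Suc.IH[OF _ Ck_on_SucD(2)[OF Suc.prems(2), of v]]) (simp add: eq)
  then show ?case using der by (auto simp: differentiable_def)
qed

lemma Ck_on_SucI:
  assumes "open S" "\<And>x. x \<in> S \<Longrightarrow> (f has_derivative f' x) (at x)"
    and "\<And>v. Ck_on k S (\<lambda>x. f' x v)"
  shows "Ck_on (Suc k) S f"
proof -
  have "f' x = frechet_derivative f (at x)" if "x \<in> S" for x
    using assms(2)[OF that] by (rule frechet_derivative_at)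
  then have "Ck_on k S (\<lambda>x. frechet_derivative f (at x) v)" for v
    by (intro Ck_on_cong[OF assms(1) _ assms(3)[of v]]) simp
  then show ?thesis using assms(2) by (auto simp: differentiable_def)
qed

lemma Ck_on_imp_continuous_on:
  assumes "Ck_on k S f" shows "continuous_on S f"
proof (cases k)
  case (Suc j)
  then have "\<And>x. x \<in> S \<Longrightarrow> f differentiable (at x)" using assms by simp
  then show ?thesis
    by (meson continuous_at_imp_continuous_on differentiable_imp_continuous_within)
qed (use assms in simp)

lemma Ck_on_Suc_imp_Ck_on: "Ck_on (Suc k) S f \<Longrightarrow> Ck_on k S f"
proof (induction k arbitrary: f)
  case 0
  then show ?case using Ck_on_imp_continuous_on[of "Suc 0" S f] by simp
next
  case (Suc k)
  have "Ck_on k S (\<lambda>x. frechet_derivative f (at x) v)" for v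
    by (rule Suc.IH[OF Ck_on_SucD(2)[OF Suc.prems]])
  then show ?case using Suc.prems by simp
qed

lemma Ck_on_subset: "Ck_on k S f \<Longrightarrow> T \<subseteq> S \<Longrightarrow> Ck_on k T f"
proof (induction k arbitrary: f)
  case 0
  then show ?case using continuous_on_subset by auto
next
  case (Suc k)
  then show ?case by auto
qed

lemma Ck_on_bounded_linear:
  assumes "open S" "bounded_linear L" "Ck_on k S f"
  shows "Ck_on k S (\<lambda>x. L (f x))"
  using assms(3)
proof (induction k arbitrary: f)
  case 0
  then show ?case using bounded_linear.continuous_on[OF assms(2)] by simp
next
  case (Suc k)
  show ?case
    by (rule Ck_on_SucI[OF \<open>open S\<close>, where f' = "\<lambda>x v. L (frechet_derivative f (at x) v)"])
      (use Suc.IH Ck_on_SucD[OF Suc.prems] bounded_linear.has_derivative[OF assms(2)] in blast)+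
qed

lemma Ck_on_const: "open S \<Longrightarrow> Ck_on k S (\<lambda>x. c)"
proof (induction k arbitrary: c)
  case (Suc k)
  then show ?case by (intro Ck_on_SucI[where f' = "\<lambda>x v. 0"]) auto
qed simp

lemma Ck_on_linear:
  assumes "open S" "bounded_linear L" shows "Ck_on k S L"
proof (cases k)
  case 0
  then show ?thesis using linear_continuous_on[OF assms(2)] by simp
next
  case (Suc j)
  show ?thesis unfolding Suc
    by (rule Ck_on_SucI[where f' = "\<lambda>x. L"])
      (use assms in \<open>simp_all add: Ck_on_const bounded_linear_imp_has_derivative\<close>)
qed

lemma Ck_on_add:
  assumes "open S" "Ck_on k S f" "Ck_on k S g"
  shows "Ck_on k S (\<lambda>x. f x + g x)"
  using assms(2,3)
proof (induction k arbitrary: f g)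
  case 0
  then show ?case using continuous_on_add by auto
next
  case (Suc k)
  show ?case
    by (rule Ck_on_SucI[OF \<open>open S\<close>, where f' = "\<lambda>x v. frechet_derivative f (at x) v + frechet_derivative g (at x) v"])
      (use Suc.IH Ck_on_SucD[OF Suc.prems(1)] Ck_on_SucD[OF Suc.prems(2)] has_derivative_add in blast)+
qed

lemma Ck_on_sum:
  assumes "open S" "finite A" "\<And>i. i \<in> A \<Longrightarrow> Ck_on k S (f i)"
  shows "Ck_on k S (\<lambda>x. \<Sum>i\<in>A. f i x)"
  using assms(2,3)
  by (induction A rule: finite_induct) (auto intro: Ck_on_add Ck_on_const assms(1))

lemma Ck_on_scaleR:
  fixes a :: "'a::euclidean_space \<Rightarrow> real"
  assumes "open S" "Ck_on k S a" "Ck_on k S f"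
  shows "Ck_on k S (\<lambda>x. a x *\<^sub>R f x)"
  using assms(2,3)
proof (induction k arbitrary: a f)
  case 0
  then show ?case using continuous_on_scaleR by auto
next
  case (Suc k)
  show ?case
  proof (rule Ck_on_SucI[OF \<open>open S\<close>, where f' = "\<lambda>x v. a x *\<^sub>R frechet_derivative f (at x) v + frechet_derivative a (at x) v *\<^sub>R f x"])
    fix x assume "x \<in> S"
    then show "((\<lambda>x. a x *\<^sub>R f x) has_derivative (\<lambda>v. a x *\<^sub>R frechet_derivative f (at x) v + frechet_derivative a (at x) v *\<^sub>R f x)) (at x)"
      using Ck_on_SucD(1)[OF Suc.prems(1)] Ck_on_SucD(1)[OF Suc.prems(2)] by (intro has_derivative_scaleR) auto
  next
    fix v
    show "Ck_on k S (\<lambda>x. a x *\<^sub>R frechet_derivative f (at x) v + frechet_derivative a (at x) v *\<^sub>R f x)"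
      by (intro Ck_on_add \<open>open S\<close> Suc.IH Ck_on_SucD(2)[OF Suc.prems(1)] Ck_on_SucD(2)[OF Suc.prems(2)]
          Ck_on_Suc_imp_Ck_on[OF Suc.prems(1)] Ck_on_Suc_imp_Ck_on[OF Suc.prems(2)])
  qed
qed

lemma Ck_on_Pair:
  assumes "open S" "Ck_on k S f" "Ck_on k S g"
  shows "Ck_on k S (\<lambda>x. (f x, g x))"
proof -
  have "Ck_on k S (\<lambda>x. (f x, 0) + (0, g x))"
    using assms
    by (intro Ck_on_add Ck_on_bounded_linear[OF _ _ assms(2)] Ck_on_bounded_linear[OF _ _ assms(3)])
      (auto intro!: bounded_linear_Pair bounded_linear_ident bounded_linear_zero)
  then show ?thesis by simp
qed

text \<open>
  The derivatives in \<open>Ck_on\<close> are taken in constant directions. Expanding \<open>Df(x)v\<close> in the standard basis turns the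
  chain rule into a sum of products of such derivatives.
\<close>

lemma Ck_on_compose:
  fixes f :: "'a::euclidean_space \<Rightarrow> 'b::euclidean_space"
  assumes "open S" "open T" "f ` S \<subseteq> T" "Ck_on k S f" "Ck_on k T g"
  shows "Ck_on k S (\<lambda>x. g (f x))"
  using assms(4,5)
proof (induction k arbitrary: g)
  case 0
  then show ?case using continuous_on_compose2 assms(3) by auto
next
  case (Suc k)
  let ?Df = "\<lambda>x. frechet_derivative f (at x)" and ?Dg = "\<lambda>y. frechet_derivative g (at y)"
  show ?case
  proof (rule Ck_on_SucI[OF \<open>open S\<close>, where f' = "\<lambda>x v. \<Sum>b\<in>Basis. (?Df x v \<bullet> b) *\<^sub>R ?Dg (f x) b"])
    fix x assume x: "x \<in> S"
    then have Dg: "(g has_derivative ?Dg (f x)) (at (f x))"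
      using assms(3) by (intro Ck_on_SucD(1)[OF Suc.prems(2)]) auto
    then have lin: "linear (?Dg (f x))" by (rule has_derivative_linear)
    have expand: "?Dg (f x) w = (\<Sum>b\<in>Basis. (w \<bullet> b) *\<^sub>R ?Dg (f x) b)" for w
      by (subst euclidean_representation[of w, symmetric]) (simp add: linear_sum[OF lin] linear_scale[OF lin])
    show "((\<lambda>x. g (f x)) has_derivative (\<lambda>v. \<Sum>b\<in>Basis. (?Df x v \<bullet> b) *\<^sub>R ?Dg (f x) b)) (at x)"
      unfolding expand[symmetric] by (rule has_derivative_compose[OF Ck_on_SucD(1)[OF Suc.prems(1) x] Dg])
  next
    fix v
    have f: "Ck_on k S f" by (rule Ck_on_Suc_imp_Ck_on[OF Suc.prems(1)])
    show "Ck_on k S (\<lambda>x. \<Sum>b\<in>Basis. (?Df x v \<bullet> b) *\<^sub>R ?Dg (f x) b)"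
      by (intro Ck_on_sum Ck_on_scaleR finite_Basis \<open>open S\<close> Suc.IH[OF f]
          Ck_on_bounded_linear[OF _ bounded_linear_inner_left] Ck_on_SucD(2)[OF Suc.prems(1)]
          Ck_on_SucD(2)[OF Suc.prems(2)])
  qed
qed

lemma C1_on_locally_lipschitz:
  fixes f :: "'a::euclidean_space \<Rightarrow> 'b::real_normed_vector"
  assumes "open S" "Ck_on (Suc 0) S f" "x0 \<in> S"
  obtains r B where "r > 0" "ball x0 r \<subseteq> S"
    "\<And>x y. x \<in> ball x0 r \<Longrightarrow> y \<in> ball x0 r \<Longrightarrow> norm (f y - f x) \<le> B * norm (y - x)"
proof -
  let ?D = "\<lambda>x. frechet_derivative f (at x)"
  obtain r where r: "r > 0" "cball x0 r \<subseteq> S"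
    using assms(1,3) open_contains_cball by blast
  have "continuous_on (cball x0 r) (\<lambda>x. \<Sum>b\<in>Basis. norm (?D x b))"
    using Ck_on_SucD(2)[OF assms(2)] r(2)
    by (intro continuous_intros) (auto intro: continuous_on_subset)
  then have "bounded ((\<lambda>x. \<Sum>b\<in>Basis. norm (?D x b)) ` cball x0 r)"
    by (intro compact_imp_bounded compact_continuous_image) auto
  then obtain B where B: "\<And>x. x \<in> cball x0 r \<Longrightarrow> (\<Sum>b\<in>Basis. norm (?D x b)) \<le> B"
    unfolding bounded_iff by (force simp: abs_le_iff)
  show thesis
  proof (rule that[of r B])
    show "ball x0 r \<subseteq> S" using r by auto
    fix x y assume xy: "x \<in> ball x0 r" "y \<in> ball x0 r"
    show "norm (f y - f x) \<le> B * norm (y - x)"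
    proof (rule differentiable_bound[OF convex_ball _ _ xy(2,1)])
      fix z assume z: "z \<in> ball x0 r"
      then have der: "(f has_derivative ?D z) (at z)"
        using r by (intro Ck_on_SucD(1)[OF assms(2)]) auto
      then show "(f has_derivative ?D z) (at z within ball x0 r)" by (rule has_derivative_at_withinI)
      have lin: "linear (?D z)" using der by (rule has_derivative_linear)
      show "onorm (?D z) \<le> B"
      proof (rule onorm_le)
        fix w :: 'a
        have "?D z w = (\<Sum>b\<in>Basis. (w \<bullet> b) *\<^sub>R ?D z b)"
          by (subst euclidean_representation[of w, symmetric]) (simp add: linear_sum[OF lin] linear_scale[OF lin])
        also have "norm \<dots> \<le> (\<Sum>b\<in>Basis. norm (w \<bullet> b) * norm (?D z b))"
          by (rule order_trans[OF norm_sum]) simp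
        also have "\<dots> \<le> (\<Sum>b\<in>Basis. norm w * norm (?D z b))"
          by (intro sum_mono mult_right_mono) (auto simp: Basis_le_norm)
        also have "\<dots> = norm w * (\<Sum>b\<in>Basis. norm (?D z b))" by (simp add: sum_distrib_left)
        also have "\<dots> \<le> norm w * B" using z by (intro mult_left_mono B) auto
        finally show "norm (?D z w) \<le> B * norm w" by (simp add: mult.commute)
      qed
    qed
  qed (rule r)
qed

text \<open>
  This is the reason for \<open>[u, u] = 0\<close>. With \<open>h(\<sigma>, \<tau>) = \<Phi>(x\<^sub>0 + \<sigma>u, x\<^sub>0 + \<tau>u)\<close>, the second difference
  \<open>h(s, s) - h(s, 0) - h(0, s) + h(0, 0)\<close> equals \<open>s\<^sup>2\<close> times a mixed second derivative of \<open>h\<close> at some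
  intermediate point. If this difference vanishes for small \<open>s\<close>, then so does the mixed derivative at the
  origin, by continuity.
\<close>

lemma mixed_derivative_zero_on_diagonal:
  fixes \<Phi> :: "'a::euclidean_space \<times> 'a \<Rightarrow> 'b::real_inner" and u :: 'a
  defines "A \<equiv> \<lambda>p. frechet_derivative \<Phi> (at p) (0, u)"
  assumes "open W" and x0: "(x0, x0) \<in> W" and \<Phi>: "Ck_on (Suc (Suc 0)) W \<Phi>"
    and zero: "\<And>s. (x0 + s *\<^sub>R u, x0) \<in> W \<Longrightarrow> (x0, x0 + s *\<^sub>R u) \<in> W \<Longrightarrow>
      (x0 + s *\<^sub>R u, x0 + s *\<^sub>R u) \<in> W \<Longrightarrow>
      \<Phi> (x0 + s *\<^sub>R u, x0 + s *\<^sub>R u) - \<Phi> (x0 + s *\<^sub>R u, x0) - \<Phi> (x0, x0 + s *\<^sub>R u) + \<Phi> (x0, x0) = 0"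
  shows "frechet_derivative A (at (x0, x0)) (u, 0) = 0"
proof (rule ccontr)
  define E where "E p = frechet_derivative A (at p) (u, 0)" for p
  define E0 where "E0 = E (x0, x0)"
  assume "frechet_derivative A (at (x0, x0)) (u, 0) \<noteq> 0"
  then have "E0 \<bullet> E0 > 0" by (simp add: E_def E0_def)
  have A: "Ck_on (Suc 0) W A" unfolding A_def by (rule Ck_on_SucD(2)[OF \<Phi>])
  have "continuous_on W E" using Ck_on_SucD(2)[OF A, of "(u, 0)"] by (simp add: E_def[abs_def])
  then have "continuous_on W (\<lambda>p. E p \<bullet> E0)" by (intro continuous_intros)
  then have "open (W \<inter> (\<lambda>p. E p \<bullet> E0) -` {0<..})"
    by (rule continuous_open_preimage) (use \<open>open W\<close> in auto)
  moreover have "W \<inter> (\<lambda>p. E p \<bullet> E0) -` {0<..} = {p\<in>W. E p \<bullet> E0 > 0}" by auto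
  ultimately have "open {p\<in>W. E p \<bullet> E0 > 0}" by simp
  moreover have "(x0, x0) \<in> {p\<in>W. E p \<bullet> E0 > 0}" using x0 \<open>E0 \<bullet> E0 > 0\<close> by (simp add: E0_def)
  ultimately obtain X Y where "open X" "open Y" "(x0, x0) \<in> X \<times> Y" "X \<times> Y \<subseteq> {p\<in>W. E p \<bullet> E0 > 0}"
    by (rule open_prod_elim)
  then have XY: "open X" "open Y" "x0 \<in> X" "x0 \<in> Y" "X \<times> Y \<subseteq> {p\<in>W. E p \<bullet> E0 > 0}" by auto
  have "open ((\<lambda>s. x0 + s *\<^sub>R u) -` (X \<inter> Y))"
    using XY by (intro open_vimage open_Int continuous_intros) auto
  moreover have "0 \<in> (\<lambda>s. x0 + s *\<^sub>R u) -` (X \<inter> Y)" using XY by simp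
  ultimately obtain r where r: "r > 0" "ball 0 r \<subseteq> (\<lambda>s. x0 + s *\<^sub>R u) -` (X \<inter> Y)"
    using open_contains_ball by blast
  have in_W: "(x0 + \<sigma> *\<^sub>R u, x0 + \<tau> *\<^sub>R u) \<in> W" "E (x0 + \<sigma> *\<^sub>R u, x0 + \<tau> *\<^sub>R u) \<bullet> E0 > 0"
    if "\<bar>\<sigma>\<bar> < r" "\<bar>\<tau>\<bar> < r" for \<sigma> \<tau>
  proof -
    have "\<sigma> \<in> ball 0 r" "\<tau> \<in> ball 0 r" using that by auto
    then have "x0 + \<sigma> *\<^sub>R u \<in> X" "x0 + \<tau> *\<^sub>R u \<in> Y" using r(2) by auto
    then show "(x0 + \<sigma> *\<^sub>R u, x0 + \<tau> *\<^sub>R u) \<in> W" "E (x0 + \<sigma> *\<^sub>R u, x0 + \<tau> *\<^sub>R u) \<bullet> E0 > 0"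
      using XY(5) by auto
  qed
  have der_t: "((\<lambda>\<tau>. \<Phi> (x0 + \<sigma> *\<^sub>R u, x0 + \<tau> *\<^sub>R u) \<bullet> E0) has_real_derivative
      A (x0 + \<sigma> *\<^sub>R u, x0 + \<tau> *\<^sub>R u) \<bullet> E0) (at \<tau>)" if "\<bar>\<sigma>\<bar> < r" "\<bar>\<tau>\<bar> < r" for \<sigma> \<tau>
  proof -
    note D\<Phi> = Ck_on_SucD(1)[OF \<Phi> in_W(1)[OF that]]
    have "((\<lambda>\<tau>. (x0 + \<sigma> *\<^sub>R u, x0 + \<tau> *\<^sub>R u)) has_derivative (\<lambda>h. (0, h *\<^sub>R u))) (at \<tau>)"
      by (auto intro!: derivative_eq_intros)
    from has_derivative_compose[OF this D\<Phi>]
    have "((\<lambda>\<tau>. \<Phi> (x0 + \<sigma> *\<^sub>R u, x0 + \<tau> *\<^sub>R u) \<bullet> E0) has_derivative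
      (\<lambda>h. frechet_derivative \<Phi> (at (x0 + \<sigma> *\<^sub>R u, x0 + \<tau> *\<^sub>R u)) (0, h *\<^sub>R u) \<bullet> E0)) (at \<tau>)"
      by (rule has_derivative_inner_left)
    moreover have eq: "frechet_derivative \<Phi> (at (x0 + \<sigma> *\<^sub>R u, x0 + \<tau> *\<^sub>R u)) (0, h *\<^sub>R u) =
        h *\<^sub>R A (x0 + \<sigma> *\<^sub>R u, x0 + \<tau> *\<^sub>R u)" for h
      using linear_scale[OF has_derivative_linear[OF D\<Phi>], of h "(0, u)"] by (simp add: A_def)
    ultimately show ?thesis
      by (elim has_derivative_imp_has_field_derivative) (simp add: eq)
  qed
  have der_s: "((\<lambda>\<sigma>. A (x0 + \<sigma> *\<^sub>R u, x0 + \<tau> *\<^sub>R u) \<bullet> E0) has_real_derivative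
      E (x0 + \<sigma> *\<^sub>R u, x0 + \<tau> *\<^sub>R u) \<bullet> E0) (at \<sigma>)" if "\<bar>\<sigma>\<bar> < r" "\<bar>\<tau>\<bar> < r" for \<sigma> \<tau>
  proof -
    note DA = Ck_on_SucD(1)[OF A in_W(1)[OF that]]
    have "((\<lambda>\<sigma>. (x0 + \<sigma> *\<^sub>R u, x0 + \<tau> *\<^sub>R u)) has_derivative (\<lambda>h. (h *\<^sub>R u, 0))) (at \<sigma>)"
      by (auto intro!: derivative_eq_intros)
    from has_derivative_compose[OF this DA]
    have "((\<lambda>\<sigma>. A (x0 + \<sigma> *\<^sub>R u, x0 + \<tau> *\<^sub>R u) \<bullet> E0) has_derivative
      (\<lambda>h. frechet_derivative A (at (x0 + \<sigma> *\<^sub>R u, x0 + \<tau> *\<^sub>R u)) (h *\<^sub>R u, 0) \<bullet> E0)) (at \<sigma>)"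
      by (rule has_derivative_inner_left)
    moreover have eq: "frechet_derivative A (at (x0 + \<sigma> *\<^sub>R u, x0 + \<tau> *\<^sub>R u)) (h *\<^sub>R u, 0) =
        h *\<^sub>R E (x0 + \<sigma> *\<^sub>R u, x0 + \<tau> *\<^sub>R u)" for h
      using linear_scale[OF has_derivative_linear[OF DA], of h "(u, 0)"] by (simp add: E_def)
    ultimately show ?thesis
      by (elim has_derivative_imp_has_field_derivative) (simp add: eq)
  qed
  define s where "s = r / 2"
  have s: "0 < s" "s < r" using r(1) by (auto simp: s_def)
  \<comment> \<open>The mean value theorem is applied in the second variable to \<open>k\<close>, whose increment is the
    second difference, and then in the first variable to \<open>l \<tau>\<close>.\<close>
  define k where "k \<tau> = \<Phi> (x0 + s *\<^sub>R u, x0 + \<tau> *\<^sub>R u) \<bullet> E0 - \<Phi> (x0 + 0 *\<^sub>R u, x0 + \<tau> *\<^sub>R u) \<bullet> E0" for \<tau>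
  define l where "l \<tau> \<sigma> = A (x0 + \<sigma> *\<^sub>R u, x0 + \<tau> *\<^sub>R u) \<bullet> E0" for \<tau> \<sigma>
  have "\<exists>\<tau>. 0 < \<tau> \<and> \<tau> < s \<and> k s - k 0 = (s - 0) * (l \<tau> s - l \<tau> 0)"
    unfolding k_def l_def by (rule MVT2[OF s(1)]) (use s in \<open>intro DERIV_diff der_t; simp\<close>)
  moreover have "k s = k 0"
  proof -
    have "\<Phi> (x0 + s *\<^sub>R u, x0 + s *\<^sub>R u) - \<Phi> (x0 + s *\<^sub>R u, x0) - \<Phi> (x0, x0 + s *\<^sub>R u) + \<Phi> (x0, x0) = 0"
      by (rule zero) (use s in_W(1)[of s 0] in_W(1)[of 0 s] in_W(1)[of s s] in auto)
    then have "(\<Phi> (x0 + s *\<^sub>R u, x0 + s *\<^sub>R u) - \<Phi> (x0 + s *\<^sub>R u, x0) - \<Phi> (x0, x0 + s *\<^sub>R u) + \<Phi> (x0, x0)) \<bullet> E0 = 0"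
      by simp
    then show ?thesis by (simp add: k_def inner_diff_left inner_add_left)
  qed
  ultimately obtain \<tau> where \<tau>: "0 < \<tau>" "\<tau> < s" "l \<tau> s = l \<tau> 0" using s by auto
  have "\<exists>\<sigma>. 0 < \<sigma> \<and> \<sigma> < s \<and> l \<tau> s - l \<tau> 0 = (s - 0) * (E (x0 + \<sigma> *\<^sub>R u, x0 + \<tau> *\<^sub>R u) \<bullet> E0)"
    unfolding l_def by (rule MVT2[OF s(1)]) (use s \<tau> in \<open>intro der_s; simp\<close>)
  then obtain \<sigma> where "0 < \<sigma>" "\<sigma> < s" "E (x0 + \<sigma> *\<^sub>R u, x0 + \<tau> *\<^sub>R u) \<bullet> E0 = 0"
    using \<tau>(3) s by auto
  then show False using in_W(2)[of \<sigma> \<tau>] s \<tau> by auto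
qed

section \<open>The adjoint representation\<close>

lemma chart_invD:
  assumes "is_chart c"
  shows "open (fst c)" "open (snd c ` fst c)" "g \<in> fst c \<Longrightarrow> chart_inv c (snd c g) = g"
    "x \<in> snd c ` fst c \<Longrightarrow> snd c (chart_inv c x) = x"
    "x \<in> snd c ` fst c \<Longrightarrow> chart_inv c x \<in> fst c"
    "continuous_on (fst c) (snd c)" "continuous_on (snd c ` fst c) (chart_inv c)" "inj_on (snd c) (fst c)"
proof -
  have h: "homeomorphism (fst c) (snd c ` fst c) (snd c) (chart_inv c)"
    using assms by (simp add: is_chart_def)
  show "open (fst c)" "open (snd c ` fst c)" using assms by (auto simp: is_chart_def)
  show inv: "g \<in> fst c \<Longrightarrow> chart_inv c (snd c g) = g" for g
    using h by (simp add: homeomorphism_def)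
  show "x \<in> snd c ` fst c \<Longrightarrow> snd c (chart_inv c x) = x"
    "x \<in> snd c ` fst c \<Longrightarrow> chart_inv c x \<in> fst c" using inv by auto
  show "continuous_on (fst c) (snd c)" "continuous_on (snd c ` fst c) (chart_inv c)"
    using h by (auto simp: homeomorphism_def)
  show "inj_on (snd c) (fst c)" using inv by (rule inj_on_inverseI)
qed

context lie_group
begin

lemma atlas_chart: "c \<in> atlas G \<Longrightarrow> is_chart c"
  using smooth_atlas by (auto simp: smooth_atlas_def)

lemmas chart = chart_invD[OF atlas_chart]
lemmas echart = chart_invD[OF atlas_chart[OF echart_in_atlas]]

lemma chart_around: obtains c where "c \<in> atlas G" "g \<in> fst c"
proof -
  have "g \<in> (\<Union>c\<in>atlas G. fst c)" using smooth_atlas by (simp add: smooth_atlas_def)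
  then show thesis using that by blast
qed

lemma in_carrier [simp]: "g \<in> carrier G"
  by (simp add: carrier_UNIV)

lemma continuous_on_mult [continuous_intros]:
  assumes "continuous_on S f" "continuous_on S g"
  shows "continuous_on S (\<lambda>x. f x \<otimes> g x)"
proof -
  have "continuous_on UNIV (\<lambda>(x, y). x \<otimes> y)" using smooth_mult by (simp add: smooth_map_def)
  from continuous_on_compose2[OF this continuous_on_Pair[OF assms]] show ?thesis by simp
qed

lemma continuous_on_group_inv [continuous_intros]:
  assumes "continuous_on S f"
  shows "continuous_on S (\<lambda>x. inv (f x))"
proof -
  have "continuous_on UNIV (\<lambda>x. inv x)" using smooth_inv by (simp add: smooth_map_def)
  from continuous_on_compose2[OF this assms] show ?thesis by simp
qed

lemma open_chart_preimage:
  assumes "c \<in> atlas G" "open U" "continuous_on (snd c ` fst c) f"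
  shows "open {x \<in> snd c ` fst c. f x \<in> U}"
proof -
  have "{x \<in> snd c ` fst c. f x \<in> U} = snd c ` fst c \<inter> f -` U" by auto
  then show ?thesis using continuous_open_preimage[OF assms(3) chart(2)[OF assms(1)] assms(2)] by simp
qed

text \<open>
  The smooth structure of \<open>G \<times> G\<close> consists of product charts; here multiplication is unfolded to a map between
  open subsets of Euclidean spaces.
\<close>

lemma Ck_on_mult_charts:
  assumes c: "c \<in> atlas G" and d: "d \<in> atlas G" and e: "e \<in> atlas G"
  defines "W \<equiv> {p \<in> snd c ` fst c \<times> snd d ` fst d. chart_inv c (fst p) \<otimes> chart_inv d (snd p) \<in> fst e}"
  shows "open W" "Ck_on k W (\<lambda>p. snd e (chart_inv c (fst p) \<otimes> chart_inv d (snd p)))"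
proof -
  let ?cd = "(fst c \<times> fst d, map_prod (snd c) (snd d))"
  have W: "W = snd c ` fst c \<times> snd d ` fst d \<inter> (\<lambda>p. chart_inv c (fst p) \<otimes> chart_inv d (snd p)) -` fst e"
    by (auto simp: W_def)
  have "continuous_on (snd c ` fst c \<times> snd d ` fst d) (\<lambda>p. chart_inv c (fst p) \<otimes> chart_inv d (snd p))"
    by (intro continuous_on_mult continuous_on_compose2[OF chart(7)[OF c]] continuous_on_compose2[OF chart(7)[OF d]]
        continuous_intros) auto
  then show "open W" unfolding W
    by (intro continuous_open_preimage open_Times chart c d e)
  have inj: "inj_on (map_prod (snd c) (snd d)) (fst c \<times> fst d)"
    using chart(8)[OF c] chart(8)[OF d] by (rule map_prod_inj_on)
  have inv: "chart_inv ?cd p = (chart_inv c (fst p), chart_inv d (snd p))"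
    if "p \<in> snd c ` fst c \<times> snd d ` fst d" for p
  proof -
    have "fst p \<in> snd c ` fst c" "snd p \<in> snd d ` fst d" using that by (simp_all add: mem_Times_iff)
    then obtain g h where "g \<in> fst c" "h \<in> fst d" "fst p = snd c g" "snd p = snd d h" by blast
    then have gh: "g \<in> fst c" "h \<in> fst d" "p = map_prod (snd c) (snd d) (g, h)" by (auto simp: prod_eq_iff)
    then have "chart_inv ?cd p = (g, h)"
      using inv_into_f_f[OF inj, of "(g, h)"] by (simp add: chart_inv_def)
    then show ?thesis using gh chart(3)[OF c gh(1)] chart(3)[OF d gh(2)] by simp
  qed
  have img: "snd ?cd ` (fst ?cd \<inter> (\<lambda>(x, y). x \<otimes> y) -` fst e) = W"
    using chart(3)[OF c] chart(3)[OF d] by (force simp: W_def)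
  have "?cd \<in> prod_atlas (atlas G) (atlas G)" using c d by (force simp: prod_atlas_def)
  then have "smooth_on (snd ?cd ` (fst ?cd \<inter> (\<lambda>(x, y). x \<otimes> y) -` fst e)) (snd e \<circ> (\<lambda>(x, y). x \<otimes> y) \<circ> chart_inv ?cd)"
    using smooth_mult e unfolding smooth_map_def by blast
  then have "Ck_on k W (snd e \<circ> (\<lambda>(x, y). x \<otimes> y) \<circ> chart_inv ?cd)"
    unfolding img by (simp add: smooth_on_def)
  then show "Ck_on k W (\<lambda>p. snd e (chart_inv c (fst p) \<otimes> chart_inv d (snd p)))"
    by (rule Ck_on_cong[OF \<open>open W\<close>, rotated]) (simp add: W_def inv)
qed

lemma Ck_on_inv_charts:
  assumes c: "c \<in> atlas G" and d: "d \<in> atlas G"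
  defines "W \<equiv> {x \<in> snd c ` fst c. inv (chart_inv c x) \<in> fst d}"
  shows "open W" "Ck_on k W (\<lambda>x. snd d (inv (chart_inv c x)))"
proof -
  show "open W" unfolding W_def
    by (intro open_chart_preimage c chart(1)[OF d] continuous_on_group_inv chart(7)[OF c])
  have "snd c ` (fst c \<inter> (\<lambda>x. inv x) -` fst d) = W"
    using chart(3)[OF c] by (force simp: W_def)
  then show "Ck_on k W (\<lambda>x. snd d (inv (chart_inv c x)))"
    using smooth_inv c d unfolding smooth_map_def smooth_on_def by (force simp: o_def)
qed

lemma Ck_on_left_translation:
  fixes g :: 'g
  assumes c: "c \<in> atlas G" and d: "d \<in> atlas G"
  defines "W \<equiv> {x \<in> snd c ` fst c. g \<otimes> chart_inv c x \<in> fst d}"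
  shows "open W" "Ck_on k W (\<lambda>x. snd d (g \<otimes> chart_inv c x))"
proof -
  show W: "open W" unfolding W_def
    by (intro open_chart_preimage c chart(1)[OF d] continuous_on_mult continuous_on_const chart(7)[OF c])
  obtain e where e: "e \<in> atlas G" "g \<in> fst e" by (rule chart_around)
  have "Ck_on k W (\<lambda>x. (\<lambda>p. snd d (chart_inv e (fst p) \<otimes> chart_inv c (snd p))) (snd e g, x))"
    using e chart(3)[OF e]
    by (intro Ck_on_compose[OF W Ck_on_mult_charts(1)[OF e(1) c d] _ _ Ck_on_mult_charts(2)[OF e(1) c d]]
        Ck_on_Pair[OF W] Ck_on_const[OF W] Ck_on_linear[OF W] bounded_linear_ident) (auto simp: W_def)
  then show "Ck_on k W (\<lambda>x. snd d (g \<otimes> chart_inv c x))"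
    using chart(3)[OF e] by simp
qed

lemma Ck_on_right_translation:
  fixes g :: 'g
  assumes c: "c \<in> atlas G" and d: "d \<in> atlas G"
  defines "W \<equiv> {x \<in> snd c ` fst c. chart_inv c x \<otimes> g \<in> fst d}"
  shows "open W" "Ck_on k W (\<lambda>x. snd d (chart_inv c x \<otimes> g))"
proof -
  show W: "open W" unfolding W_def
    by (intro open_chart_preimage c chart(1)[OF d] continuous_on_mult continuous_on_const chart(7)[OF c])
  obtain e where e: "e \<in> atlas G" "g \<in> fst e" by (rule chart_around)
  have "Ck_on k W (\<lambda>x. (\<lambda>p. snd d (chart_inv c (fst p) \<otimes> chart_inv e (snd p))) (x, snd e g))"
    using e chart(3)[OF e]
    by (intro Ck_on_compose[OF W Ck_on_mult_charts(1)[OF c e(1) d] _ _ Ck_on_mult_charts(2)[OF c e(1) d]]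
        Ck_on_Pair[OF W] Ck_on_const[OF W] Ck_on_linear[OF W] bounded_linear_ident) (auto simp: W_def)
  then show "Ck_on k W (\<lambda>x. snd d (chart_inv c x \<otimes> g))"
    using chart(3)[OF e] by simp
qed

definition conj_chart :: "'g \<Rightarrow> 'a \<Rightarrow> 'a" where
  "conj_chart g x = ecoord G (g \<otimes> ecoord_inv G x \<otimes> inv g)"

lemma Ad_conj_chart: "Ad G g = frechet_derivative (conj_chart g) (at (ecoord G \<one>))"
  by (simp add: Ad_def conj_chart_def[abs_def])

lemma ecoord_inv_one [simp]: "ecoord_inv G (ecoord G \<one>) = \<one>"
  using echart(3)[OF one_in_echart] .

lemma ecoord_one_in [simp]: "ecoord G \<one> \<in> ecoord G ` fst (echart G)"
  using one_in_echart by blast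

text \<open>
  The conjugated point \<open>g x g\<^sup>-\<^sup>1\<close> is reached through \<open>g x\<close>, which lies in a chart around \<open>g\<close> when \<open>x\<close> is near the identity.
\<close>

lemma conj_chart_has_derivative: "(conj_chart g has_derivative Ad G g) (at (ecoord G \<one>))"
proof -
  obtain c where c: "c \<in> atlas G" "g \<in> fst c" by (rule chart_around)
  let ?x0 = "ecoord G \<one>"
  let ?L = "\<lambda>x. snd c (g \<otimes> ecoord_inv G x)" and ?R = "\<lambda>x. ecoord G (chart_inv c x \<otimes> inv g)"
  let ?W = "{x \<in> ecoord G ` fst (echart G). g \<otimes> ecoord_inv G x \<in> fst c}"
  have x0: "?x0 \<in> ?W" using c by simp
  have "?L differentiable (at ?x0)"
    using Ck_on_left_translation(2)[OF echart_in_atlas c(1), of "Suc 0"] x0 by simp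
  moreover have "?R differentiable (at (?L ?x0))"
    using Ck_on_right_translation(2)[OF c(1) echart_in_atlas, of "Suc 0"] c chart(3)[OF c] one_in_echart by simp
  ultimately have "(\<lambda>x. ?R (?L x)) differentiable (at ?x0)"
    by (rule differentiable_compose[of ?R ?L, rotated])
  then obtain D where "((\<lambda>x. ?R (?L x)) has_derivative D) (at ?x0)"
    by (auto simp: differentiable_def)
  then have "(conj_chart g has_derivative D) (at ?x0)"
    by (rule has_derivative_transform_within_open[OF _ Ck_on_left_translation(1)[OF echart_in_atlas c(1)] x0])
      (use chart(3)[OF c(1)] in \<open>auto simp: conj_chart_def\<close>)
  then show ?thesis unfolding Ad_conj_chart using frechet_derivative_at by metis
qed

lemma linear_Ad: "linear (Ad G g)" and bounded_linear_Ad: "bounded_linear (Ad G g)"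
  using conj_chart_has_derivative has_derivative_linear has_derivative_bounded_linear by blast+

lemma Ad_mult: "Ad G (g \<otimes> h) X = Ad G g (Ad G h X)"
proof -
  let ?x0 = "ecoord G \<one>"
  let ?W = "{x \<in> ecoord G ` fst (echart G). h \<otimes> ecoord_inv G x \<otimes> inv h \<in> fst (echart G)}"
  have W: "open ?W"
    by (intro open_chart_preimage echart_in_atlas echart(1) continuous_on_mult continuous_on_const echart(7))
  have x0: "?x0 \<in> ?W" using one_in_echart by simp
  have "conj_chart h ?x0 = ?x0" by (simp add: conj_chart_def)
  then have "((\<lambda>x. conj_chart g (conj_chart h x)) has_derivative (\<lambda>X. Ad G g (Ad G h X))) (at ?x0)"
    using conj_chart_has_derivative by (intro has_derivative_compose[OF conj_chart_has_derivative[of h]]) simp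
  then have "(conj_chart (g \<otimes> h) has_derivative (\<lambda>X. Ad G g (Ad G h X))) (at ?x0)"
    by (rule has_derivative_transform_within_open[OF _ W x0])
      (auto simp: conj_chart_def echart m_assoc inv_mult_group)
  from frechet_derivative_at[OF this] show ?thesis unfolding Ad_conj_chart by metis
qed

text \<open>
  Near the identity, all intermediate products stay in the domain of the chart around the identity, so there
  conjugation is a composition of coordinate expressions of multiplication and inversion.
\<close>

lemma Ck_on_conj_chart:
  obtains W where "open W" "(ecoord G \<one>, ecoord G \<one>) \<in> W"
    "\<And>k. Ck_on k W (\<lambda>p. conj_chart (ecoord_inv G (fst p)) (snd p))"
    "W \<subseteq> ecoord G ` fst (echart G) \<times> ecoord G ` fst (echart G)"
proof -
  let ?x0 = "ecoord G \<one>" and ?\<Omega> = "ecoord G ` fst (echart G)" and ?\<psi> = "ecoord_inv G"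
  define \<mu> where "\<mu> p = ecoord G (?\<psi> (fst p) \<otimes> ?\<psi> (snd p))" for p
  define \<nu> where "\<nu> x = ecoord G (inv (?\<psi> x))" for x
  define W1 where "W1 = {p \<in> ?\<Omega> \<times> ?\<Omega>. ?\<psi> (fst p) \<otimes> ?\<psi> (snd p) \<in> fst (echart G)}"
  define W2 where "W2 = {x \<in> ?\<Omega>. inv (?\<psi> x) \<in> fst (echart G)}"
  have \<mu>: "open W1" "Ck_on k W1 \<mu>" for k
    using Ck_on_mult_charts[OF echart_in_atlas echart_in_atlas echart_in_atlas]
    by (auto simp: W1_def \<mu>_def[abs_def])
  have \<nu>: "open W2" "Ck_on k W2 \<nu>" for k
    using Ck_on_inv_charts[OF echart_in_atlas echart_in_atlas]
    by (auto simp: W2_def \<nu>_def[abs_def])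
  define W3 where "W3 = W1 \<inter> W2 \<times> UNIV"
  have W3: "open W3" unfolding W3_def by (intro open_Int open_Times \<mu> \<nu> open_UNIV)
  have f: "Ck_on k W3 (\<lambda>p. (\<mu> p, \<nu> (fst p)))" for k
    by (intro Ck_on_Pair W3 Ck_on_subset[OF \<mu>(2)] Ck_on_compose[OF W3 \<nu>(1) _ _ \<nu>(2)]
        Ck_on_linear bounded_linear_fst) (auto simp: W3_def)
  define W where "W = W3 \<inter> (\<lambda>p. (\<mu> p, \<nu> (fst p))) -` W1"
  show thesis
  proof (rule that[of W])
    show "open W" unfolding W_def
      by (rule continuous_open_preimage[OF Ck_on_imp_continuous_on[OF f[of 0]] W3 \<mu>(1)])
    show "(?x0, ?x0) \<in> W"
      using one_in_echart by (simp add: W_def W3_def W1_def W2_def \<mu>_def \<nu>_def)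
    show "W \<subseteq> ?\<Omega> \<times> ?\<Omega>" by (auto simp: W_def W3_def W1_def)
    fix k
    have "Ck_on k W (\<lambda>p. \<mu> (\<mu> p, \<nu> (fst p)))"
      by (rule Ck_on_compose[OF \<open>open W\<close> \<mu>(1) _ Ck_on_subset[OF f] \<mu>(2)]) (auto simp: W_def)
    then show "Ck_on k W (\<lambda>p. conj_chart (?\<psi> (fst p)) (snd p))"
    proof (rule Ck_on_cong[OF \<open>open W\<close>, rotated])
      fix p assume "p \<in> W"
      then have "?\<psi> (fst p) \<otimes> ?\<psi> (snd p) \<in> fst (echart G)" "inv (?\<psi> (fst p)) \<in> fst (echart G)"
        by (auto simp: W_def W3_def W1_def W2_def)
      then have "?\<psi> (\<mu> p) = ?\<psi> (fst p) \<otimes> ?\<psi> (snd p)" "?\<psi> (\<nu> (fst p)) = inv (?\<psi> (fst p))"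
        by (simp_all add: \<mu>_def \<nu>_def echart(3))
      then show "\<mu> (\<mu> p, \<nu> (fst p)) = conj_chart (?\<psi> (fst p)) (snd p)"
        by (simp add: \<mu>_def[of "(\<mu> p, \<nu> (fst p))"] conj_chart_def)
    qed
  qed
qed

text \<open>
  In the chart around the identity, \<open>Ad\<close> is the partial derivative of the map \<open>\<Phi>(y, x) = y x y\<^sup>-\<^sup>1\<close> in its second
  variable. Since \<open>\<Phi>(y, y) = y\<close>, \<open>\<Phi>(1, x) = x\<close> and \<open>\<Phi>(y, 1) = 1\<close>, the second differences of \<open>\<Phi>\<close> on the diagonal
  vanish.
\<close>

lemma Ad_echart_smooth:
  obtains U where "open U" "ecoord G \<one> \<in> U" "U \<subseteq> ecoord G ` fst (echart G)"
    "\<And>k X. Ck_on k U (\<lambda>y. Ad G (ecoord_inv G y) X)"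
    "\<And>u. frechet_derivative (\<lambda>y. Ad G (ecoord_inv G y) u) (at (ecoord G \<one>)) u = 0"
proof -
  let ?x0 = "ecoord G \<one>"
  define \<Phi> where "\<Phi> p = conj_chart (ecoord_inv G (fst p)) (snd p)" for p
  obtain W where W: "open W" "(?x0, ?x0) \<in> W" "\<And>k. Ck_on k W \<Phi>"
    "W \<subseteq> ecoord G ` fst (echart G) \<times> ecoord G ` fst (echart G)"
    using Ck_on_conj_chart unfolding \<Phi>_def by blast
  have Ad: "Ad G (ecoord_inv G y) X = frechet_derivative \<Phi> (at (y, ?x0)) (0, X)" if "(y, ?x0) \<in> W" for y X
  proof -
    have "((\<lambda>x. (y, x)) has_derivative (\<lambda>X. (0, X))) (at ?x0)" by (auto intro!: derivative_eq_intros)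
    from has_derivative_compose[OF this Ck_on_SucD(1)[OF W(3) that]]
    have "(conj_chart (ecoord_inv G y) has_derivative (\<lambda>X. frechet_derivative \<Phi> (at (y, ?x0)) (0, X))) (at ?x0)"
      by (simp add: \<Phi>_def)
    from frechet_derivative_at[OF this] show ?thesis unfolding Ad_conj_chart by metis
  qed
  define U where "U = (\<lambda>y. (y, ?x0)) -` W"
  have U: "open U" unfolding U_def by (intro open_vimage W(1) continuous_intros)
  have pair: "Ck_on k U (\<lambda>y. (y, ?x0))" for k
    by (intro Ck_on_Pair Ck_on_linear Ck_on_const U bounded_linear_ident)
  define A where "A X p = frechet_derivative \<Phi> (at p) (0, X)" for X p
  have A: "Ck_on k W (A X)" for k X
    unfolding A_def[abs_def] by (rule Ck_on_SucD(2)[OF W(3)])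
  show thesis
  proof (rule that[of U])
    show "open U" by (rule U)
    show "?x0 \<in> U" using W(2) by (simp add: U_def)
    show "U \<subseteq> ecoord G ` fst (echart G)" using W(4) by (auto simp: U_def)
    have "Ck_on k U (\<lambda>y. A X (y, ?x0))" for k X
      by (rule Ck_on_compose[OF U W(1) _ pair A]) (auto simp: U_def)
    then show "Ck_on k U (\<lambda>y. Ad G (ecoord_inv G y) X)" for k X
      by (rule Ck_on_cong[OF U, rotated]) (simp add: A_def Ad U_def)
  next
    fix u
    have "frechet_derivative (A u) (at (?x0, ?x0)) (u, 0) = 0"
      unfolding A_def[abs_def]
    proof (rule mixed_derivative_zero_on_diagonal[OF W(1,2,3)])
      fix s
      let ?y = "?x0 + s *\<^sub>R u"
      assume "(?y, ?x0) \<in> W" "(?x0, ?y) \<in> W" "(?y, ?y) \<in> W"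
      then have "?y \<in> ecoord G ` fst (echart G)" using W(4) by auto
      then show "\<Phi> (?y, ?y) - \<Phi> (?y, ?x0) - \<Phi> (?x0, ?y) + \<Phi> (?x0, ?x0) = 0"
        by (simp add: \<Phi>_def conj_chart_def echart m_assoc)
    qed
    moreover have pair': "((\<lambda>y. (y, ?x0)) has_derivative (\<lambda>v. (v, 0))) (at ?x0)"
      by (auto intro!: derivative_eq_intros)
    have "((\<lambda>y. A u (y, ?x0)) has_derivative (\<lambda>v. frechet_derivative (A u) (at (?x0, ?x0)) (v, 0))) (at ?x0)"
      using has_derivative_compose[OF pair', of "A u" "frechet_derivative (A u) (at (?x0, ?x0))"]
        Ck_on_SucD(1)[OF A W(2), of u] by simp
    then have "((\<lambda>y. Ad G (ecoord_inv G y) u) has_derivative (\<lambda>v. frechet_derivative (A u) (at (?x0, ?x0)) (v, 0))) (at ?x0)"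
      by (rule has_derivative_transform_within_open[OF _ U]) (use W(2) in \<open>auto simp: A_def Ad U_def\<close>)
    from frechet_derivative_at[OF this] have "frechet_derivative (\<lambda>y. Ad G (ecoord_inv G y) u) (at ?x0) u =
      frechet_derivative (A u) (at (?x0, ?x0)) (u, 0)" by metis
    ultimately show "frechet_derivative (\<lambda>y. Ad G (ecoord_inv G y) u) (at ?x0) u = 0" by simp
  qed
qed

lemma lie_bracket_self [simp]: "lie_bracket G u u = 0"
  using Ad_echart_smooth unfolding lie_bracket_def by metis

lemma Ad_has_derivative_lie_bracket:
  "((\<lambda>y. Ad G (ecoord_inv G y) X) has_derivative (\<lambda>u. lie_bracket G u X)) (at (ecoord G \<one>))"
proof -
  obtain U where U: "open U" "ecoord G \<one> \<in> U" "\<And>k. Ck_on k U (\<lambda>y. Ad G (ecoord_inv G y) X)"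
    using Ad_echart_smooth by metis
  show ?thesis
    using Ck_on_SucD(1)[OF U(3,2)] by (simp add: lie_bracket_def[abs_def])
qed

lemma linear_lie_bracket_left: "linear (\<lambda>u. lie_bracket G u X)"
  by (rule has_derivative_linear[OF Ad_has_derivative_lie_bracket])

lemma linear_lie_bracket_right: "linear (lie_bracket G u)"
proof (rule linearI)
  note D = Ad_has_derivative_lie_bracket
  show "lie_bracket G u (X + Y) = lie_bracket G u X + lie_bracket G u Y" for X Y
    using has_derivative_unique[OF has_derivative_add[OF D[of X] D[of Y]]] D[of "X + Y"]
    by (simp add: linear_add[OF linear_Ad] fun_eq_iff)
  show "lie_bracket G u (r *\<^sub>R X) = r *\<^sub>R lie_bracket G u X" for r X
    using has_derivative_unique[OF has_derivative_scaleR_right[OF D[of X], of r]] D[of "r *\<^sub>R X"]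
    by (simp add: linear_scale[OF linear_Ad] fun_eq_iff)
qed

end

section \<open>Horizontal curves\<close>

lemma control_subinterval:
  assumes "t \<in> {a<..<b}" "{a..b} \<subseteq> I"
  shows "control G {a..b} \<gamma> t = control G I \<gamma> t"
  unfolding control_def
  using at_within_subinterval[OF assms] at_within_subinterval[OF assms(1) order_refl] by simp

lemma ac_curve_subinterval:
  assumes "ac_curve G I \<gamma>" "{a..b} \<subseteq> I"
  shows "ac_curve G {a..b} \<gamma>"
  using assms unfolding ac_curve_def
  by (meson continuous_on_subset is_interval_cc order_trans)

lemma horizontal_subinterval:
  assumes "horizontal G V I \<gamma>" "{a..b} \<subseteq> I"
  shows "horizontal G V {a..b} \<gamma>"
proof -
  have I: "is_interval I" using assms by (simp add: horizontal_def ac_curve_def)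
  have "AE t in lebesgue_on {a..b}. t \<in> {a<..<b} \<and>
    left_shift G \<gamma> t differentiable (at t within I) \<and> control G I \<gamma> t \<in> V"
    using assms by (intro AE_lebesgue_on_subinterval[OF I assms(2)]) (simp add: horizontal_def)
  then have "AE t in lebesgue_on {a..b}. left_shift G \<gamma> t differentiable (at t within {a..b}) \<and> control G {a..b} \<gamma> t \<in> V"
    by (rule eventually_mono)
      (use assms(2) in \<open>auto simp: control_subinterval intro: differentiable_within_subset\<close>)
  then show ?thesis using assms ac_curve_subinterval by (auto simp: horizontal_def)
qed

context lie_group
begin

text \<open>
  A map that is continuously differentiable in charts is Lipschitz in charts, hence maps absolutely
  continuous curves to absolutely continuous ones.
\<close>

lemma abs_continuous_on_curve:
  fixes f :: "'g \<Rightarrow> 'b::real_normed_vector"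
  assumes f: "\<And>g. \<exists>c\<in>atlas G. g \<in> fst c \<and> (\<exists>W. open W \<and> snd c g \<in> W \<and> Ck_on (Suc 0) W (\<lambda>x. f (chart_inv c x)))"
    and \<gamma>: "ac_curve G I \<gamma>" "{a..b} \<subseteq> I"
  shows "abs_continuous_on {a..b} (\<lambda>t. f (\<gamma> t))"
proof (rule abs_continuous_on_locally)
  fix t assume t: "t \<in> {a..b}"
  obtain c W where c: "c \<in> atlas G" "\<gamma> t \<in> fst c" and W: "open W" "snd c (\<gamma> t) \<in> W"
    "Ck_on (Suc 0) W (\<lambda>x. f (chart_inv c x))" using f[of "\<gamma> t"] by blast
  obtain r B where r: "r > 0" "\<And>x y. x \<in> ball (snd c (\<gamma> t)) r \<Longrightarrow> y \<in> ball (snd c (\<gamma> t)) r \<Longrightarrow>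
      norm (f (chart_inv c y) - f (chart_inv c x)) \<le> B * norm (y - x)"
    using C1_on_locally_lipschitz[OF W(1,3,2)] by metis
  define O' where "O' = fst c \<inter> snd c -` ball (snd c (\<gamma> t)) r"
  have "open O'" unfolding O'_def
    by (rule continuous_open_preimage[OF chart(6)[OF c(1)] chart(1)[OF c(1)] open_ball])
  moreover have "\<gamma> t \<in> O'" using c r(1) by (simp add: O'_def)
  moreover have "continuous_on {a..b} \<gamma>"
    using \<gamma> by (auto simp: ac_curve_def intro: continuous_on_subset)
  ultimately obtain A where A: "open A" "t \<in> A" "\<And>s. s \<in> {a..b} \<Longrightarrow> s \<in> A \<Longrightarrow> \<gamma> s \<in> O'"
    using t unfolding continuous_on_topological by metis
  then obtain e where e: "e > 0" "ball t e \<subseteq> A" using open_contains_ball by blast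
  define a' b' where "a' = max a (t - e / 2)" and "b' = min b (t + e / 2)"
  have "{a'..b'} \<subseteq> {a..b} \<inter> ball t e" using e(1) by (auto simp: a'_def b'_def dist_real_def)
  then have sub: "{a'..b'} \<subseteq> {a..b}" "\<gamma> ` {a'..b'} \<subseteq> O'" using A e by blast+
  then have "abs_continuous_on {a'..b'} (snd c \<circ> \<gamma>)"
    using \<gamma> c(1) unfolding ac_curve_def O'_def by (metis Int_subset_iff order_trans)
  then have "abs_continuous_on {a'..b'} (\<lambda>t. f (\<gamma> t))"
  proof (rule abs_continuous_on_lipschitz)
    fix x y assume "x \<in> {a'..b'}" "y \<in> {a'..b'}"
    then have "\<gamma> x \<in> O'" "\<gamma> y \<in> O'" using sub(2) by blast+
    then show "norm (f (\<gamma> y) - f (\<gamma> x)) \<le> B * norm ((snd c \<circ> \<gamma>) y - (snd c \<circ> \<gamma>) x)"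
      using r(2)[of "snd c (\<gamma> x)" "snd c (\<gamma> y)"] chart(3)[OF c(1)] by (simp add: O'_def)
  qed
  moreover have "{a..b} \<inter> ball t (e / 2) \<subseteq> {a'..b'}"
  proof
    fix s assume "s \<in> {a..b} \<inter> ball t (e / 2)"
    then have "a \<le> s" "s \<le> b" "\<bar>t - s\<bar> < e / 2" unfolding mem_ball dist_real_def Int_iff by simp_all
    then show "s \<in> {a'..b'}" unfolding a'_def b'_def atLeastAtMost_iff by linarith
  qed
  ultimately show "\<exists>\<epsilon>>0. abs_continuous_on ({a..b} \<inter> ball t \<epsilon>) (\<lambda>t. f (\<gamma> t))"
    using e(1) abs_continuous_on_subset half_gt_zero by blast
qed

text \<open>
  Near time \<open>t\<close>, the curve is \<open>\<gamma>(t)\<close> times its left shift, so by the chain rule only the derivative of \<open>f\<close> along the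
  left translation by \<open>\<gamma>(t)\<close> is needed.
\<close>

lemma curve_has_vector_derivative:
  fixes f :: "'g \<Rightarrow> 'b::real_normed_vector"
  assumes cont: "continuous_on J \<gamma>" and t: "t \<in> J"
    and diff: "left_shift G \<gamma> t differentiable (at t within J)"
    and D: "((\<lambda>x. f (\<gamma> t \<otimes> ecoord_inv G x)) has_derivative D) (at (ecoord G \<one>))"
  shows "((\<lambda>s. f (\<gamma> s)) has_vector_derivative D (control G J \<gamma> t)) (at t within J)"
proof -
  have "(left_shift G \<gamma> t has_vector_derivative control G J \<gamma> t) (at t within J)"
    using diff by (simp add: control_def vector_derivative_works)
  moreover have "left_shift G \<gamma> t t = ecoord G \<one>" by (simp add: left_shift_def)
  ultimately have "(((\<lambda>x. f (\<gamma> t \<otimes> ecoord_inv G x)) \<circ> left_shift G \<gamma> t) has_vector_derivative D (control G J \<gamma> t)) (at t within J)"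
    using D by (intro vector_derivative_diff_chain_within) (auto intro: has_derivative_at_withinI)
  moreover have "\<forall>\<^sub>F s in at t within J. ((\<lambda>x. f (\<gamma> t \<otimes> ecoord_inv G x)) \<circ> left_shift G \<gamma> t) s = f (\<gamma> s)"
  proof -
    have "continuous_on J (\<lambda>s. inv (\<gamma> t) \<otimes> \<gamma> s)"
      by (intro continuous_on_mult continuous_on_const cont)
    moreover have "inv (\<gamma> t) \<otimes> \<gamma> t \<in> fst (echart G)" using one_in_echart by simp
    ultimately obtain A where "open A" "t \<in> A" "\<And>s. s \<in> J \<Longrightarrow> s \<in> A \<Longrightarrow> inv (\<gamma> t) \<otimes> \<gamma> s \<in> fst (echart G)"
      using t echart(1) unfolding continuous_on_topological by metis
    then show ?thesis
      unfolding eventually_at_topological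
      by (intro exI[of _ A]) (auto simp: left_shift_def echart m_assoc[symmetric])
  qed
  ultimately show ?thesis
    unfolding has_vector_derivative_def
    by (rule has_derivative_transform_eventually) (use t in \<open>auto simp: left_shift_def\<close>)
qed

text \<open>
  Near \<open>g\<close>, multiplicativity of \<open>Ad\<close> writes \<open>Ad\<^bsub>h\<^esub>\<close> as \<open>Ad\<^bsub>g\<^esub>\<close> composed with \<open>Ad\<close> at \<open>g\<^sup>-\<^sup>1 h\<close>, a point near the identity.
\<close>

lemma momentum_C1_in_charts:
  fixes \<xi> :: "'a \<Rightarrow>\<^sub>L real"
  shows "\<exists>c\<in>atlas G. g \<in> fst c \<and> (\<exists>W. open W \<and> snd c g \<in> W \<and> Ck_on (Suc 0) W (\<lambda>x. \<xi> (Ad G (chart_inv c x) X)))"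
proof -
  obtain c where c: "c \<in> atlas G" "g \<in> fst c" by (rule chart_around)
  obtain U where U: "open U" "ecoord G \<one> \<in> U" "\<And>k. Ck_on k U (\<lambda>y. Ad G (ecoord_inv G y) X)"
    using Ad_echart_smooth by metis
  define Wl where "Wl = {x \<in> snd c ` fst c. inv g \<otimes> chart_inv c x \<in> fst (echart G)}"
  define l where "l x = ecoord G (inv g \<otimes> chart_inv c x)" for x
  have l: "open Wl" "Ck_on k Wl l" for k
    using Ck_on_left_translation[where g = "inv g", OF c(1) echart_in_atlas] by (auto simp: Wl_def l_def[abs_def])
  define W where "W = Wl \<inter> l -` U"
  have W: "open W" unfolding W_def
    by (rule continuous_open_preimage[OF Ck_on_imp_continuous_on[OF l(2)[of 0]] l(1) U(1)])
  have "bounded_linear (\<lambda>Y. \<xi> (Ad G g Y))"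
    by (rule bounded_linear_compose[OF blinfun.bounded_linear_right bounded_linear_Ad])
  then have "Ck_on (Suc 0) W (\<lambda>x. \<xi> (Ad G g (Ad G (ecoord_inv G (l x)) X)))"
    by (rule Ck_on_bounded_linear[OF W])
      (rule Ck_on_compose[OF W U(1) _ Ck_on_subset[OF l(2)] U(3)], auto simp: W_def)
  then have "Ck_on (Suc 0) W (\<lambda>x. \<xi> (Ad G (chart_inv c x) X))"
    by (rule Ck_on_cong[OF W, rotated])
      (auto simp: W_def Wl_def l_def echart Ad_mult[symmetric] m_assoc[symmetric])
  moreover have "snd c g \<in> W" using c U(2) one_in_echart by (simp add: W_def Wl_def l_def chart(3))
  ultimately show ?thesis using c W by blast
qed

lemma momentum_abs_continuous:
  fixes \<xi> :: "'a \<Rightarrow>\<^sub>L real"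
  assumes "ac_curve G I \<gamma>" "{a..b} \<subseteq> I"
  shows "abs_continuous_on {a..b} (\<lambda>t. \<xi> (Ad G (\<gamma> t) X))"
  by (rule abs_continuous_on_curve[OF momentum_C1_in_charts assms])

lemma momentum_has_derivative:
  fixes \<xi> :: "'a \<Rightarrow>\<^sub>L real"
  assumes "continuous_on J \<gamma>" "t \<in> J" "left_shift G \<gamma> t differentiable (at t within J)"
  shows "((\<lambda>s. \<xi> (Ad G (\<gamma> s) X)) has_real_derivative
    \<xi> (Ad G (\<gamma> t) (lie_bracket G (control G J \<gamma> t) X))) (at t within J)"
  unfolding has_real_derivative_iff_has_vector_derivative
proof (rule curve_has_vector_derivative[OF assms, where D = "\<lambda>u. \<xi> (Ad G (\<gamma> t) (lie_bracket G u X))"])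
  have "bounded_linear (\<lambda>Y. \<xi> (Ad G (\<gamma> t) Y))"
    by (rule bounded_linear_compose[OF blinfun.bounded_linear_right bounded_linear_Ad])
  from bounded_linear.has_derivative[OF this Ad_has_derivative_lie_bracket]
  show "((\<lambda>x. \<xi> (Ad G (\<gamma> t \<otimes> ecoord_inv G x) X)) has_derivative (\<lambda>u. \<xi> (Ad G (\<gamma> t) (lie_bracket G u X)))) (at (ecoord G \<one>))"
    by (simp add: Ad_mult)
qed

lemma abelianization_mult:
  assumes "abelianization_identification G V \<iota>"
  shows "\<iota> (ab_proj G (g \<otimes> h)) = \<iota> (ab_proj G g) + \<iota> (ab_proj G h)" "\<iota> (ab_proj G g) \<in> V"
proof -
  interpret D: normal "commutator_subgroup G" G by (rule derived_self_is_normal)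
  have in_Mod: "ab_proj G g \<in> carrier (G Mod commutator_subgroup G)" for g
    by (auto simp: ab_proj_def FactGroup_def RCOSETS_def)
  have \<iota>: "\<iota> \<in> hom (G Mod commutator_subgroup G) (vector_group V)"
    using assms by (simp add: abelianization_identification_def iso_def)
  have "ab_proj G (g \<otimes> h) = ab_proj G g \<otimes>\<^bsub>G Mod commutator_subgroup G\<^esub> ab_proj G h"
    by (simp add: ab_proj_def FactGroup_def D.rcos_sum)
  then show "\<iota> (ab_proj G (g \<otimes> h)) = \<iota> (ab_proj G g) + \<iota> (ab_proj G h)"
    using hom_mult[OF \<iota> in_Mod in_Mod] by (simp add: vector_group_def)
  show "\<iota> (ab_proj G g) \<in> V"
    using hom_in_carrier[OF \<iota> in_Mod] by (simp add: vector_group_def)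
qed

lemma abelianization_abs_continuous:
  assumes \<iota>: "abelianization_identification G V \<iota>" and "ac_curve G I \<gamma>" "{a..b} \<subseteq> I"
  shows "abs_continuous_on {a..b} (\<lambda>t. \<iota> (ab_proj G (\<gamma> t)))"
proof (rule abs_continuous_on_curve[OF _ assms(2,3)])
  fix g
  obtain c where c: "c \<in> atlas G" "g \<in> fst c" by (rule chart_around)
  have "Ck_on (Suc 0) (snd c ` fst c) (\<lambda>x. \<iota> (ab_proj G (chart_inv c x)))"
    using \<iota> c(1) unfolding abelianization_identification_def smooth_map_def smooth_on_def
    by (fastforce simp: o_def)
  then show "\<exists>c\<in>atlas G. g \<in> fst c \<and> (\<exists>W. open W \<and> snd c g \<in> W \<and> Ck_on (Suc 0) W (\<lambda>x. \<iota> (ab_proj G (chart_inv c x))))"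
    using c chart(2)[OF c(1)] by blast
qed

text \<open>
  The projection to the abelianization is a homomorphism whose differential at the identity fixes \<open>V\<close>, so
  the velocity of the projected curve is the control.
\<close>

lemma abelianization_has_vector_derivative:
  assumes \<iota>: "abelianization_identification G V \<iota>"
    and \<gamma>: "continuous_on J \<gamma>" "t \<in> J" "left_shift G \<gamma> t differentiable (at t within J)"
    and V: "control G J \<gamma> t \<in> V"
  shows "((\<lambda>s. \<iota> (ab_proj G (\<gamma> s))) has_vector_derivative control G J \<gamma> t) (at t within J)"
proof -
  let ?P = "\<lambda>x. \<iota> (ab_proj G (ecoord_inv G x))"
  let ?D = "frechet_derivative ?P (at (ecoord G \<one>))"
  have "Ck_on (Suc 0) (ecoord G ` fst (echart G)) ?P"
    using \<iota> echart_in_atlas unfolding abelianization_identification_def smooth_map_def smooth_on_def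
    by (fastforce simp: o_def)
  then have "(?P has_derivative ?D) (at (ecoord G \<one>))"
    by (rule Ck_on_SucD(1)) simp
  then have "((\<lambda>x. \<iota> (ab_proj G (\<gamma> t)) + ?P x) has_derivative ?D) (at (ecoord G \<one>))"
    by (auto intro!: derivative_eq_intros)
  then have "((\<lambda>x. \<iota> (ab_proj G (\<gamma> t \<otimes> ecoord_inv G x))) has_derivative ?D) (at (ecoord G \<one>))"
    using abelianization_mult(1)[OF \<iota>] by simp
  from curve_has_vector_derivative[OF \<gamma> this]
  have "((\<lambda>s. \<iota> (ab_proj G (\<gamma> s))) has_vector_derivative ?D (control G J \<gamma> t)) (at t within J)" .
  moreover have "?D (control G J \<gamma> t) = control G J \<gamma> t"
    using \<iota> V by (simp add: abelianization_identification_def o_def)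
  ultimately show ?thesis by simp
qed

lemma abelianization_derivative_AE:
  assumes \<iota>: "abelianization_identification G V \<iota>" and \<gamma>: "horizontal G V {a..b} \<gamma>"
  shows "AE t in lebesgue_on {a..b}. t \<in> {a<..<b} \<and> control G {a..b} \<gamma> t \<in> V \<and>
    ((\<lambda>s. \<iota> (ab_proj G (\<gamma> s))) has_vector_derivative control G {a..b} \<gamma> t) (at t within {a..b})"
proof -
  have "AE t in lebesgue_on {a..b}. t \<in> {a<..<b} \<and>
    left_shift G \<gamma> t differentiable (at t within {a..b}) \<and> control G {a..b} \<gamma> t \<in> V"
    using \<gamma> by (intro AE_lebesgue_on_subinterval[OF is_interval_cc order_refl]) (simp add: horizontal_def)
  then show ?thesis
    by (rule eventually_mono)
      (use \<gamma> in \<open>auto intro!: abelianization_has_vector_derivative[OF \<iota>] simp: horizontal_def ac_curve_def\<close>)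
qed

end

section \<open>Calibrated curves\<close>

text \<open>
  The set \<open>F\<close> contains all vertices of the unit ball and possibly further points of the ball.
\<close>

locale polyhedral_lie_group = lie_group G
  for G :: "('g::{t2_space, second_countable_topology}, 'a::euclidean_space, 'm) lie_group_data_scheme" (structure) +
  fixes V :: "'a set" and N :: "'a \<Rightarrow> real" and F :: "'a set" and \<iota> :: "'g set \<Rightarrow> 'a"
  assumes norm: "norm_on V N" and finite_F: "finite F" and hull: "{x\<in>V. N x \<le> 1} = convex hull F"
    and ident: "abelianization_identification G V \<iota>"
begin

lemmas norm_rules = norm_onD[OF norm]
lemmas vertex_rules = polyhedral_vertices[OF norm hull]

lemma inner_le_norm_if_le_on_vertices:
  assumes "\<And>f. f \<in> F \<Longrightarrow> y \<bullet> f \<le> 1" "v \<in> V"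
  shows "y \<bullet> v \<le> N v"
proof (cases "v = 0")
  case False
  then have pos: "N v > 0" using norm_rules(2,3)[OF assms(2)] by linarith
  have "y \<bullet> ((1 / N v) *\<^sub>R v) \<le> 1"
    by (rule linear_le_on_convex_hull[where p = "\<lambda>x. y \<bullet> x", OF _ assms(1) vertex_rules(5)[OF assms(2) refl pos]])
      (simp add: bounded_linear.linear bounded_linear_inner_right)
  then show ?thesis using pos by (simp add: field_simps)
qed (simp add: norm_rules(6))

lemma curve_length_const_speed:
  assumes "a \<le> b" "c \<ge> 0" "AE t in lebesgue_on {a..b}. N (control G {a..b} \<gamma> t) = c"
  shows "curve_length G N {a..b} \<gamma> = ennreal (c * (b - a))"
proof -
  have "curve_length G N {a..b} \<gamma> = (\<integral>\<^sup>+t. ennreal c \<partial>lebesgue_on {a..b})"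
    unfolding curve_length_def using assms(3) by (intro nn_integral_cong_AE) auto
  also have "\<dots> = ennreal c * emeasure (lebesgue_on {a..b}) {a..b}"
    by simp
  also have "\<dots> = ennreal (c * (b - a))"
    using assms(1,2) by (simp add: emeasure_restrict_space ennreal_mult)
  finally show ?thesis .
qed

lemma inner_projection_le_length:
  assumes \<sigma>: "horizontal G V {a..b} \<sigma>" and "a \<le> b" and y: "\<And>v. v \<in> V \<Longrightarrow> y \<bullet> v \<le> N v"
  shows "ennreal (y \<bullet> (\<iota> (ab_proj G (\<sigma> b)) - \<iota> (ab_proj G (\<sigma> a)))) \<le> curve_length G N {a..b} \<sigma>"
proof -
  have ac: "abs_continuous_on {a..b} (\<lambda>t. \<iota> (ab_proj G (\<sigma> t)))"
    using \<sigma> by (intro abelianization_abs_continuous[OF ident]) (auto simp: horizontal_def)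
  have "abs_continuous_on {a..b} (\<lambda>t. y \<bullet> \<iota> (ab_proj G (\<sigma> t)))"
    by (rule abs_continuous_on_lipschitz[OF ac, where B = "norm y"])
      (simp add: inner_diff_right[symmetric] Cauchy_Schwarz_ineq2)
  moreover have "AE t in lebesgue_on {a..b}. \<exists>d. ((\<lambda>t. y \<bullet> \<iota> (ab_proj G (\<sigma> t))) has_real_derivative d) (at t within {a..b})
      \<and> ennreal d \<le> ennreal (N (control G {a..b} \<sigma> t))"
    by (rule eventually_mono[OF abelianization_derivative_AE[OF ident \<sigma>]])
      (auto intro!: exI[of _ "y \<bullet> control G {a..b} \<sigma> _"] bounded_linear.has_vector_derivative[OF bounded_linear_inner_right]
        ennreal_leI y simp: has_real_derivative_iff_has_vector_derivative)
  ultimately show ?thesis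
    using abs_continuous_increment_le_nn_integral[OF _ \<open>a \<le> b\<close>, of "\<lambda>t. y \<bullet> \<iota> (ab_proj G (\<sigma> t))"]
    by (simp add: curve_length_def inner_diff_right)
qed

text \<open>
  The functional \<open>y\<close> grows along \<open>\<gamma>\<close> exactly at the speed of \<open>\<gamma>\<close>, and along any other horizontal curve at most at
  its speed. Its increment depends only on the endpoints in the abelianization, so no horizontal
  curve between the endpoints of \<open>\<gamma>\<close> is shorter. The same inequality bounds the norm of the increment of the projection
  from below by the length of \<open>\<gamma>\<close>; the opposite bound holds for all curves and follows from
  \<open>polyhedral_norm_bipolar\<close>.
\<close>

theorem calibrated_imp_minimizing:
  assumes \<gamma>: "horizontal G V {a..b} \<gamma>" and "a \<le> b" and y: "\<And>v. v \<in> V \<Longrightarrow> y \<bullet> v \<le> N v"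
    and c: "c \<ge> 0" "AE t in lebesgue_on {a..b}. N (control G {a..b} \<gamma> t) = c \<and> y \<bullet> control G {a..b} \<gamma> t = c"
  shows "length_minimizing G V N a b \<gamma>" "ab_length_minimizing V N \<iota> a b (ab_proj G \<circ> \<gamma>)"
proof -
  let ?P = "\<lambda>g. \<iota> (ab_proj G g)"
  define z where "z = ?P (\<gamma> b) - ?P (\<gamma> a)"
  have zV: "z \<in> V" unfolding z_def using norm_rules(1) abelianization_mult(2)[OF ident] by (simp add: subspace_diff)
  have speed: "AE t in lebesgue_on {a..b}. N (control G {a..b} \<gamma> t) = c"
    using c(2) by (rule eventually_mono) simp
  have len: "curve_length G N {a..b} \<gamma> = ennreal (c * (b - a))"
    by (rule curve_length_const_speed[OF \<open>a \<le> b\<close> c(1) speed])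
  have ac: "abs_continuous_on {a..b} (\<lambda>t. ?P (\<gamma> t))"
    using \<gamma> by (intro abelianization_abs_continuous[OF ident]) (auto simp: horizontal_def)
  have ac': "abs_continuous_on {a..b} (\<lambda>t. w \<bullet> ?P (\<gamma> t))" for w
    by (rule abs_continuous_on_lipschitz[OF ac, where B = "norm w"])
      (simp add: inner_diff_right[symmetric] Cauchy_Schwarz_ineq2)
  have der: "AE t in lebesgue_on {a..b}. t \<in> {a<..<b} \<and> control G {a..b} \<gamma> t \<in> V \<and>
    ((\<lambda>s. ?P (\<gamma> s)) has_vector_derivative control G {a..b} \<gamma> t) (at t within {a..b}) \<and>
    N (control G {a..b} \<gamma> t) = c \<and> y \<bullet> control G {a..b} \<gamma> t = c"
    using abelianization_derivative_AE[OF ident \<gamma>] c(2) by eventually_elim auto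
  have der': "((\<lambda>s. w \<bullet> ?P (\<gamma> s)) has_real_derivative w \<bullet> control G {a..b} \<gamma> t) (at t within {a..b})"
    if "((\<lambda>s. ?P (\<gamma> s)) has_vector_derivative control G {a..b} \<gamma> t) (at t within {a..b})" for w t
    unfolding has_real_derivative_iff_has_vector_derivative
    by (rule bounded_linear.has_vector_derivative[OF bounded_linear_inner_right that])
  have yz: "y \<bullet> z = c * (b - a)"
    using abs_continuous_increment_eq[OF ac' \<open>a \<le> b\<close> eventually_mono[OF der], of y c] der'[of _ y]
    by (fastforce simp: z_def inner_diff_right)
  have Nz: "N z = c * (b - a)"
  proof (rule antisym)
    show "N z \<le> c * (b - a)"
    proof (rule polyhedral_norm_bipolar[OF norm finite_F hull zV])
      show "0 \<le> c * (b - a)" using c(1) \<open>a \<le> b\<close> by simp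
      fix w assume w: "\<forall>f\<in>F. w \<bullet> f \<le> 1"
      have "w \<bullet> ?P (\<gamma> b) - w \<bullet> ?P (\<gamma> a) \<le> c * (b - a)"
      proof (rule abs_continuous_increment_le[OF ac' \<open>a \<le> b\<close> eventually_mono[OF der]])
        fix t assume t: "t \<in> {a<..<b} \<and> control G {a..b} \<gamma> t \<in> V \<and>
          ((\<lambda>s. ?P (\<gamma> s)) has_vector_derivative control G {a..b} \<gamma> t) (at t within {a..b}) \<and>
          N (control G {a..b} \<gamma> t) = c \<and> y \<bullet> control G {a..b} \<gamma> t = c"
        then have "w \<bullet> control G {a..b} \<gamma> t \<le> c"
          using inner_le_norm_if_le_on_vertices[of w "control G {a..b} \<gamma> t"] w by auto
        then show "\<exists>d. ((\<lambda>s. w \<bullet> ?P (\<gamma> s)) has_real_derivative d) (at t within {a..b}) \<and> d \<le> c"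
          using der'[of t w] t by blast
      qed
      then show "w \<bullet> z \<le> c * (b - a)" by (simp add: z_def inner_diff_right)
    qed
    show "c * (b - a) \<le> N z" using y[OF zV] yz by simp
  qed
  show "length_minimizing G V N a b \<gamma>"
    unfolding length_minimizing_def
  proof (intro conjI \<open>a \<le> b\<close> \<gamma> antisym)
    show "curve_length G N {a..b} \<gamma> \<le> cc_dist G V N (\<gamma> a) (\<gamma> b)"
      unfolding cc_dist_def
    proof (rule Inf_greatest, clarify)
      fix a' b' \<sigma> assume \<sigma>: "a' \<le> b'" "horizontal G V {a'..b'} \<sigma>" "\<sigma> a' = \<gamma> a" "\<sigma> b' = \<gamma> b"
      show "curve_length G N {a..b} \<gamma> \<le> curve_length G N {a'..b'} \<sigma>"
        using inner_projection_le_length[OF \<sigma>(2,1) y] \<sigma>(3,4) yz by (simp add: len z_def)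
    qed
    show "cc_dist G V N (\<gamma> a) (\<gamma> b) \<le> curve_length G N {a..b} \<gamma>"
      unfolding cc_dist_def using \<open>a \<le> b\<close> \<gamma> by (intro Inf_lower) blast
  qed
  have "(\<integral>\<^sup>+t. ennreal (N (vector_derivative (\<lambda>t. ?P (\<gamma> t)) (at t within {a..b}))) \<partial>lebesgue_on {a..b}) =
    curve_length G N {a..b} \<gamma>"
    unfolding curve_length_def
  proof (rule nn_integral_cong_AE, rule eventually_mono[OF der])
    fix t assume t: "t \<in> {a<..<b} \<and> control G {a..b} \<gamma> t \<in> V \<and>
      ((\<lambda>s. ?P (\<gamma> s)) has_vector_derivative control G {a..b} \<gamma> t) (at t within {a..b}) \<and>
      N (control G {a..b} \<gamma> t) = c \<and> y \<bullet> control G {a..b} \<gamma> t = c"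
    then have "vector_derivative (\<lambda>t. ?P (\<gamma> t)) (at t within {a..b}) = control G {a..b} \<gamma> t"
      using vector_derivative_within_cbox[of a b t "\<lambda>t. ?P (\<gamma> t)"] by auto
    then show "ennreal (N (vector_derivative (\<lambda>t. ?P (\<gamma> t)) (at t within {a..b}))) = ennreal (N (control G {a..b} \<gamma> t))"
      by simp
  qed
  then show "ab_length_minimizing V N \<iota> a b (ab_proj G \<circ> \<gamma>)"
    using ac \<open>a \<le> b\<close> Nz by (simp add: ab_length_minimizing_def o_def len z_def)
qed

end

section \<open>Constant speed of normal curves\<close>

context polyhedral_lie_group
begin

lemma extremal_AE:
  assumes "horizontal G V I \<gamma>" "associated_covector G V N I \<gamma> \<xi>" "{a..b} \<subseteq> I"
  shows "AE t in lebesgue_on {a..b}. t \<in> {a<..<b} \<and> left_shift G \<gamma> t differentiable (at t within I) \<and>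
    control G I \<gamma> t \<in> V \<and> (\<lambda>X. \<xi> (Ad G (\<gamma> t) X)) \<in> subdifferential V (energy N) (control G I \<gamma> t)"
proof (rule AE_lebesgue_on_subinterval[OF _ assms(3)])
  show "is_interval I" using assms(1) by (simp add: horizontal_def ac_curve_def)
  show "AE t in lebesgue_on I. left_shift G \<gamma> t differentiable (at t within I) \<and>
    control G I \<gamma> t \<in> V \<and> (\<lambda>X. \<xi> (Ad G (\<gamma> t) X)) \<in> subdifferential V (energy N) (control G I \<gamma> t)"
    using assms(1,2) unfolding horizontal_def associated_covector_def o_def by auto
qed

lemma linear_momentum: "linear (\<lambda>X. blinfun_apply \<xi> (Ad G g X))"
  by (rule linear_compose[OF linear_Ad bounded_linear.linear[OF blinfun.bounded_linear_right], unfolded o_def])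

text \<open>
  The maximum \<open>M\<close> over \<open>F\<close> is the dual norm of the momentum. At almost every time, \<open>M\<close> touches from
  above the function \<open>s \<mapsto> p\<^sub>s(w)\<close>, where \<open>w\<close> is the direction of the control, and the derivative of this
  function at \<open>t\<close> is \<open>p\<^sub>t([u(t), w]) = 0\<close>.
\<close>

lemma Max_momentum_constant:
  assumes \<gamma>: "horizontal G V I \<gamma>" "associated_covector G V N I \<gamma> \<xi>" and ab: "a \<le> b" "{a..b} \<subseteq> I"
  shows "(MAX f\<in>F. \<xi> (Ad G (\<gamma> a) f)) = (MAX f\<in>F. \<xi> (Ad G (\<gamma> b) f))"
proof -
  define p where "p X t = \<xi> (Ad G (\<gamma> t) X)" for X t
  define M where "M t = (MAX f\<in>F. p f t)" for t
  have ac\<gamma>: "ac_curve G I \<gamma>" using \<gamma>(1) by (simp add: horizontal_def)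
  have p_ac: "abs_continuous_on {a..b} (p X)" for X
    unfolding p_def[abs_def] by (rule momentum_abs_continuous[OF ac\<gamma> ab(2)])
  have p_lin: "linear (\<lambda>X. p X t)" for t unfolding p_def by (rule linear_momentum)
  have p_le: "p x t \<le> M t" if "x \<in> convex hull F" for x t
    by (rule linear_le_on_convex_hull[OF p_lin _ that]) (use finite_F in \<open>auto simp: M_def\<close>)
  have M_le: "M y - M x \<le> (\<Sum>f\<in>F. \<bar>p f y - p f x\<bar>)" for x y
  proof -
    have "M y \<in> (\<lambda>f. p f y) ` F"
      unfolding M_def by (rule Max_in) (use finite_F vertex_rules(3) in auto)
    then obtain f where f: "f \<in> F" "M y = p f y" by blast
    have "M y - M x \<le> \<bar>p f y - p f x\<bar>" using f p_le[OF hull_inc[OF f(1)], of x] by linarith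
    also have "\<dots> \<le> (\<Sum>f\<in>F. \<bar>p f y - p f x\<bar>)" by (rule member_le_sum) (use f finite_F in auto)
    finally show ?thesis .
  qed
  have M_ac: "abs_continuous_on {a..b} M"
  proof (rule abs_continuous_on_dominated[OF finite_F p_ac, where B = 1])
    fix x y
    have "(\<Sum>f\<in>F. \<bar>p f x - p f y\<bar>) = (\<Sum>f\<in>F. \<bar>p f y - p f x\<bar>)" by (simp add: abs_minus_commute)
    then show "norm (M y - M x) \<le> 1 * (\<Sum>f\<in>F. norm (p f y - p f x))"
      using M_le[of y x] M_le[of x y] by simp
  qed
  obtain C where C: "countable C" "\<And>t. t \<notin> C \<Longrightarrow> \<forall>f\<in>F. p f differentiable (at t) \<Longrightarrow> M differentiable (at t)"
    using differentiable_Max_except_countable[OF finite_F vertex_rules(3), of p] unfolding M_def[abs_def] by blast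
  have "negligible C" 
    using countable_imp_null_set_lborel[OF C(1)] by (simp add: negligible_iff_null_sets null_sets_completionI)
  then have "AE t in lebesgue_on {a..b}. t \<notin> C"
    by (subst AE_lebesgue_on_iff_negligible) auto
  with extremal_AE[OF \<gamma> ab(2)]
  have "AE t in lebesgue_on {a..b}. (M has_real_derivative 0) (at t within {a..b})"
  proof eventually_elim
    fix t
    let ?u = "control G I \<gamma> t"
    assume t: "t \<in> {a<..<b} \<and> left_shift G \<gamma> t differentiable (at t within I) \<and> ?u \<in> V \<and>
      (\<lambda>X. \<xi> (Ad G (\<gamma> t) X)) \<in> subdifferential V (energy N) ?u" and "t \<notin> C"
    then have tI: "t \<in> I" using ab by auto
    have at: "at t within I = at t" using at_within_subinterval[OF _ ab(2)] t by blast
    have p_der: "(p X has_real_derivative p (lie_bracket G ?u X) t) (at t)" for X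
      using momentum_has_derivative[of I \<gamma> t \<xi> X] ac\<gamma> tI t unfolding at p_def[abs_def]
      by (auto simp: ac_curve_def)
    then have "M differentiable (at t)"
      by (intro C(2) \<open>t \<notin> C\<close>) (auto simp: real_differentiable_def)
    then obtain D where D: "(M has_real_derivative D) (at t)" by (auto simp: real_differentiable_def)
    have sub: "(\<lambda>X. p X t) \<in> subdifferential V (energy N) ?u" using t by (simp add: p_def)
    have Mt: "M t = N ?u"
      unfolding M_def using polyhedral_subdifferential_Max[OF norm finite_F hull _ sub] t by simp
    \<comment> \<open>At a zero of the control the momentum vanishes on \<open>V\<close>, and \<open>w = 0\<close> touches \<open>M\<close> as well.\<close>
    define w where "w = (if N ?u = 0 then 0 else (1 / N ?u) *\<^sub>R ?u)"
    have w: "w \<in> convex hull F" using vertex_rules(4,5) norm_rules(2) t by (auto simp: w_def less_le)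
    have "p w t = M t"
      using subdifferential_energyD(2)[OF norm _ sub] t linear_0[OF p_lin] linear_scale[OF p_lin]
      by (auto simp: w_def Mt power2_eq_square)
    moreover have "lie_bracket G ?u w = 0"
      using linear_0[OF linear_lie_bracket_right] linear_scale[OF linear_lie_bracket_right, of ?u _ ?u] by (simp add: w_def)
    then have "(p w has_real_derivative 0) (at t)" using p_der[of w] linear_0[OF p_lin] by simp
    then have "((\<lambda>s. M s - p w s) has_real_derivative D - 0) (at t)" by (rule DERIV_diff[OF D])
    ultimately have "D - 0 = 0"
      by (intro DERIV_local_min[of "\<lambda>s. M s - p w s" _ t 1]) (use p_le[OF w] in auto)
    then show "(M has_real_derivative 0) (at t within {a..b})"
      using D by (auto intro: has_field_derivative_at_within)
  qed
  from abs_continuous_increment_eq[OF M_ac ab(1) this] show ?thesis by (simp add: M_def p_def)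
qed

text \<open>
  The speed is the dual norm of the momentum, so dividing the momentum by the speed normalizes it to dual norm one.
\<close>

lemma constant_speed:
  assumes \<gamma>: "horizontal G V I \<gamma>" "associated_covector G V N I \<gamma> \<xi>"
  obtains c where "c \<ge> 0" "\<And>t. t \<in> I \<Longrightarrow> (MAX f\<in>F. \<xi> (Ad G (\<gamma> t) f)) = c"
    "AE t in lebesgue_on I. N (control G I \<gamma> t) = c"
proof (cases "I = {}")
  case True
  then have "AE t in lebesgue_on I. N (control G I \<gamma> t) = 0"
    by (subst AE_lebesgue_on_iff_negligible) (auto intro: exI[of _ "{}"])
  then show thesis using that[of 0] True by simp
next
  case False
  then obtain t0 where t0: "t0 \<in> I" by blast
  have I: "is_interval I" using \<gamma>(1) by (simp add: horizontal_def ac_curve_def)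
  define M where "M t = (MAX f\<in>F. \<xi> (Ad G (\<gamma> t) f))" for t
  have "M s = M t" if "s \<in> I" "t \<in> I" "s \<le> t" for s t
  proof -
    have "{s..t} \<subseteq> I" using I that by (meson is_interval_1 atLeastAtMost_iff subsetI)
    then show ?thesis using Max_momentum_constant[OF \<gamma> \<open>s \<le> t\<close>] by (simp add: M_def)
  qed
  then have const: "M t = M t0" if "t \<in> I" for t using t0 that by (metis linear)
  have "\<xi> (Ad G (\<gamma> t0) 0) \<le> M t0"
    by (rule linear_le_on_convex_hull[OF linear_momentum _ vertex_rules(4)]) (use finite_F in \<open>auto simp: M_def\<close>)
  then have "M t0 \<ge> 0" using linear_0[OF linear_momentum, of \<xi> "\<gamma> t0"] by linarith
  moreover have "AE t in lebesgue_on I. control G I \<gamma> t \<in> V \<and>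
    (\<lambda>X. \<xi> (Ad G (\<gamma> t) X)) \<in> subdifferential V (energy N) (control G I \<gamma> t)"
    using \<gamma> unfolding horizontal_def associated_covector_def o_def by auto
  then have "AE t in lebesgue_on I. N (control G I \<gamma> t) = M t0"
  proof (rule AE_mp, intro AE_I2 impI)
    fix t assume "t \<in> space (lebesgue_on I)" "control G I \<gamma> t \<in> V \<and>
      (\<lambda>X. \<xi> (Ad G (\<gamma> t) X)) \<in> subdifferential V (energy N) (control G I \<gamma> t)"
    then show "N (control G I \<gamma> t) = M t0"
      using polyhedral_subdifferential_Max[OF norm finite_F hull,
          of "control G I \<gamma> t" "\<lambda>X. \<xi> (Ad G (\<gamma> t) X)"] const[of t] by (simp add: M_def)
  qed
  ultimately show thesis using that const by (simp add: M_def)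
qed

end

section \<open>Minimality of normal curves\<close>

context polyhedral_lie_group
begin

text \<open>
  If the normalized momenta on an interval stay within \<open>\<delta>\<close> of the one at time \<open>t0\<close>, then one functional
  \<open>\<eta>\<close> of dual norm one is maximal on all the faces that they expose. These faces contain the directions of the
  control, so \<open>\<eta>\<close> is a calibration.
\<close>

lemma momentum_close_imp_minimizing:
  assumes B: "finite B" "B \<subseteq> V" "\<And>e. e \<in> B \<Longrightarrow> norm e = 1"
      "\<And>x. x \<in> V \<Longrightarrow> (\<Sum>e\<in>B. (x \<bullet> e) *\<^sub>R e) = x"
    and \<delta>: "\<And>y. y \<in> dual_sphere V F \<Longrightarrow> \<exists>\<eta>\<in>dual_sphere V F. \<forall>z\<in>dual_sphere V F.
      dist y z < \<delta> \<longrightarrow> (\<forall>f\<in>F. z \<bullet> f = 1 \<longrightarrow> \<eta> \<bullet> f = 1)"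
    and \<gamma>: "horizontal G V I \<gamma>" "associated_covector G V N I \<gamma> \<xi>" and ab: "a \<le> b" "{a..b} \<subseteq> I"
    and c: "c \<ge> 0" "\<And>t. t \<in> I \<Longrightarrow> (MAX f\<in>F. \<xi> (Ad G (\<gamma> t) f)) = c"
    and speed: "AE t in lebesgue_on I. N (control G I \<gamma> t) = c"
    and close: "c > 0 \<Longrightarrow> \<exists>t0\<in>{a..b}. \<forall>t\<in>{a..b}.
      (\<Sum>e\<in>B. \<bar>\<xi> (Ad G (\<gamma> t0) e) - \<xi> (Ad G (\<gamma> t) e)\<bar>) < \<delta> * c"
  shows "length_minimizing G V N a b \<gamma> \<and> ab_length_minimizing V N \<iota> a b (ab_proj G \<circ> \<gamma>)"
proof -
  have I: "is_interval I" using \<gamma>(1) by (simp add: horizontal_def ac_curve_def)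
  note hor = horizontal_subinterval[OF \<gamma>(1) ab(2)]
  have speed': "AE t in lebesgue_on {a..b}. t \<in> {a<..<b} \<and> N (control G I \<gamma> t) = c"
    by (rule AE_lebesgue_on_subinterval[OF I ab(2) speed])
  show "length_minimizing G V N a b \<gamma> \<and> ab_length_minimizing V N \<iota> a b (ab_proj G \<circ> \<gamma>)"
  proof (cases "c = 0")
    case True
    have "AE t in lebesgue_on {a..b}. N (control G {a..b} \<gamma> t) = 0 \<and> 0 \<bullet> control G {a..b} \<gamma> t = 0"
      using speed'
    proof (rule eventually_mono)
      fix t assume t: "t \<in> {a<..<b} \<and> N (control G I \<gamma> t) = c"
      then have "control G {a..b} \<gamma> t = control G I \<gamma> t" by (intro control_subinterval[OF _ ab(2)]) simp
      then show "N (control G {a..b} \<gamma> t) = 0 \<and> 0 \<bullet> control G {a..b} \<gamma> t = 0" using t True by simp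
    qed
    then show ?thesis
      using calibrated_imp_minimizing[OF hor ab(1), of 0 0] norm_rules(2) by simp
  next
    case False
    then have "c > 0" using c by simp
    \<comment> \<open>The vector of \<open>V\<close> that represents the momentum, normalized to dual norm one.\<close>
    define z where "z t = (1 / c) *\<^sub>R (\<Sum>e\<in>B. \<xi> (Ad G (\<gamma> t) e) *\<^sub>R e)" for t
    have zV: "z t \<in> V" for t unfolding z_def using norm_rules(1) B(2) by (intro subspace_scale subspace_sum) auto
    have z_inner: "z t \<bullet> v = \<xi> (Ad G (\<gamma> t) v) / c" if "v \<in> V" for t v
    proof -
      have "\<xi> (Ad G (\<gamma> t) v) = \<xi> (Ad G (\<gamma> t) (\<Sum>e\<in>B. (v \<bullet> e) *\<^sub>R e))" using B(4)[OF that] by simp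
      also have "\<dots> = (\<Sum>e\<in>B. (v \<bullet> e) * \<xi> (Ad G (\<gamma> t) e))"
        by (simp add: linear_sum[OF linear_momentum] linear_scale[OF linear_momentum])
      finally have "\<xi> (Ad G (\<gamma> t) v) = (\<Sum>e\<in>B. (v \<bullet> e) * \<xi> (Ad G (\<gamma> t) e))" .
      moreover have "z t \<bullet> v = (\<Sum>e\<in>B. (v \<bullet> e) * \<xi> (Ad G (\<gamma> t) e)) / c"
        unfolding z_def by (simp add: inner_sum_left inner_commute[of v] mult.commute)
      ultimately show ?thesis by simp
    qed
    have z_sphere: "z t \<in> dual_sphere V F" if "t \<in> I" for t
    proof -
      have le: "\<xi> (Ad G (\<gamma> t) f) \<le> c" if "f \<in> F" for f
        unfolding c(2)[OF \<open>t \<in> I\<close>, symmetric] using that finite_F by (intro Max_ge) auto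
      have "c \<in> (\<lambda>f. \<xi> (Ad G (\<gamma> t) f)) ` F"
        unfolding c(2)[OF \<open>t \<in> I\<close>, symmetric] by (rule Max_in) (use finite_F vertex_rules(3) in auto)
      then obtain f where "f \<in> F" "\<xi> (Ad G (\<gamma> t) f) = c" by auto
      then show ?thesis
        using le \<open>c > 0\<close> zV z_inner vertex_rules(1) by (auto simp: dual_sphere_def intro!: bexI[of _ f])
    qed
    obtain t0 where t0: "t0 \<in> {a..b}"
      "\<And>t. t \<in> {a..b} \<Longrightarrow> (\<Sum>e\<in>B. \<bar>\<xi> (Ad G (\<gamma> t0) e) - \<xi> (Ad G (\<gamma> t) e)\<bar>) < \<delta> * c"
      using close[OF \<open>c > 0\<close>] by blast
    have near: "dist (z t0) (z t) < \<delta>" if "t \<in> {a..b}" for t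
    proof -
      have "dist (z t0) (z t) = norm (\<Sum>e\<in>B. (\<xi> (Ad G (\<gamma> t0) e) - \<xi> (Ad G (\<gamma> t) e)) *\<^sub>R e) / c"
        using \<open>c > 0\<close> by (simp add: dist_norm z_def scaleR_diff_right[symmetric] sum_subtractf[symmetric] scaleR_left_diff_distrib)
      also have "\<dots> \<le> (\<Sum>e\<in>B. \<bar>\<xi> (Ad G (\<gamma> t0) e) - \<xi> (Ad G (\<gamma> t) e)\<bar>) / c"
        using \<open>c > 0\<close> B(3) by (intro divide_right_mono order_trans[OF norm_sum]) auto
      also have "\<dots> < \<delta>" using t0(2)[OF that] \<open>c > 0\<close> by (simp add: divide_less_eq)
      finally show ?thesis .
    qed
    obtain \<eta> where \<eta>: "\<eta> \<in> dual_sphere V F" "\<And>w. w \<in> dual_sphere V F \<Longrightarrow> dist (z t0) w < \<delta> \<Longrightarrow>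
      (\<forall>f\<in>F. w \<bullet> f = 1 \<longrightarrow> \<eta> \<bullet> f = 1)"
      using \<delta>[OF z_sphere, of t0] t0(1) ab(2) by blast
    have \<eta>_le: "\<eta> \<bullet> v \<le> N v" if "v \<in> V" for v
      using \<eta>(1) that by (intro inner_le_norm_if_le_on_vertices) (auto simp: dual_sphere_def)
    have "AE t in lebesgue_on {a..b}. N (control G {a..b} \<gamma> t) = c \<and> \<eta> \<bullet> control G {a..b} \<gamma> t = c"
      using speed' extremal_AE[OF \<gamma> ab(2)]
    proof eventually_elim
      fix t
      let ?u = "control G I \<gamma> t"
      assume t1: "t \<in> {a<..<b} \<and> N ?u = c" and t2: "t \<in> {a<..<b} \<and> left_shift G \<gamma> t differentiable (at t within I) \<and> ?u \<in> V \<and>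
        (\<lambda>X. \<xi> (Ad G (\<gamma> t) X)) \<in> subdifferential V (energy N) ?u"
      then have t: "t \<in> {a..b}" "t \<in> I" using ab by auto
      have "\<xi> (Ad G (\<gamma> t) ?u) = c\<^sup>2" using subdifferential_energyD(2)[OF norm _, of ?u] t1 t2 by auto
      then have zu: "z t \<bullet> ((1 / c) *\<^sub>R ?u) = 1"
        using z_inner[of ?u t] t2 \<open>c > 0\<close> by (simp add: power2_eq_square)
      have "\<eta> \<bullet> ((1 / c) *\<^sub>R ?u) = 1"
      proof (rule linear_const_on_exposed_face[OF finite_F, where p = "\<lambda>x. z t \<bullet> x" and q = "\<lambda>x. \<eta> \<bullet> x"])
        show "(1 / c) *\<^sub>R ?u \<in> convex hull F" using vertex_rules(5)[of ?u c] t1 t2 \<open>c > 0\<close> by blast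
        show "z t \<bullet> f \<le> 1" if "f \<in> F" for f using z_sphere[OF t(2)] that by (simp add: dual_sphere_def)
        show "\<eta> \<bullet> f = 1" if "f \<in> F" "z t \<bullet> f = 1" for f
          using \<eta>(2)[OF z_sphere[OF t(2)] near[OF t(1)]] that by blast
      qed (use zu in \<open>auto intro: bounded_linear.linear bounded_linear_inner_right\<close>)
      then have "\<eta> \<bullet> ?u = c" using \<open>c > 0\<close> by (simp add: field_simps)
      then show "N (control G {a..b} \<gamma> t) = c \<and> \<eta> \<bullet> control G {a..b} \<gamma> t = c"
        using t1 control_subinterval[of t a b I G \<gamma>] ab(2) by simp
    qed
    then show ?thesis
      using calibrated_imp_minimizing[OF hor ab(1) \<eta>_le c(1)] by blast
  qed
qed

theorem normal_curve_locally_minimizing: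
  assumes "normal_curve G V N I \<gamma>"
  shows "locally_length_minimizing G V N I \<gamma>"
  unfolding locally_length_minimizing_def
proof
  fix t assume t: "t \<in> I"
  obtain \<xi> where \<gamma>: "horizontal G V I \<gamma>" "associated_covector G V N I \<gamma> \<xi>"
    using assms by (auto simp: normal_curve_def)
  then have ac: "ac_curve G I \<gamma>" and I: "is_interval I" by (simp_all add: horizontal_def ac_curve_def)
  obtain c where c: "c \<ge> 0" "\<And>t. t \<in> I \<Longrightarrow> (MAX f\<in>F. \<xi> (Ad G (\<gamma> t) f)) = c"
    "AE t in lebesgue_on I. N (control G I \<gamma> t) = c"
    using constant_speed[OF \<gamma>] by blast
  obtain B where B: "finite B" "B \<subseteq> V" "\<And>e. e \<in> B \<Longrightarrow> norm e = 1"
    "\<And>x. x \<in> V \<Longrightarrow> (\<Sum>e\<in>B. (x \<bullet> e) *\<^sub>R e) = x"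
    using orthonormal_basis_of_subspace[OF norm_rules(1)] by metis
  obtain \<delta> where \<delta>: "\<delta> > 0" "\<And>y. y \<in> dual_sphere V F \<Longrightarrow> \<exists>\<eta>\<in>dual_sphere V F. \<forall>z\<in>dual_sphere V F.
    dist y z < \<delta> \<longrightarrow> (\<forall>f\<in>F. z \<bullet> f = 1 \<longrightarrow> \<eta> \<bullet> f = 1)"
    using dual_sphere_uniform_face[OF norm finite_F hull] by blast
  obtain a b e where ab: "e > 0" "a \<le> t" "t \<le> b" "{a..b} \<subseteq> I" "ball t e \<inter> I \<subseteq> {a..b}"
    using is_interval_neighbourhood[OF I t] by metis
  have "\<exists>r>0. c > 0 \<longrightarrow> (\<forall>s\<in>{a..b}. \<bar>s - t\<bar> < r \<longrightarrow>
    (\<Sum>e\<in>B. \<bar>\<xi> (Ad G (\<gamma> t) e) - \<xi> (Ad G (\<gamma> s) e)\<bar>) < \<delta> * c)"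
  proof (cases "c > 0")
    case True
    define h where "h s = (\<Sum>e\<in>B. \<bar>\<xi> (Ad G (\<gamma> t) e) - \<xi> (Ad G (\<gamma> s) e)\<bar>)" for s
    have "continuous_on {a..b} h"
      unfolding h_def[abs_def]
      by (intro continuous_intros abs_continuous_on_imp_continuous_on momentum_abs_continuous[OF ac ab(4)])
    moreover have "\<delta> * c > 0" "t \<in> {a..b}" using True \<delta>(1) ab(2,3) by simp_all
    ultimately obtain r where "r > 0" "\<forall>s\<in>{a..b}. dist s t < r \<longrightarrow> dist (h s) (h t) < \<delta> * c"
      unfolding continuous_on_iff by blast
    then show ?thesis by (intro exI[of _ r]) (auto simp: dist_real_def h_def)
  qed (auto intro: exI[of _ 1])
  then obtain r where r: "r > 0" "\<And>s. c > 0 \<Longrightarrow> s \<in> {a..b} \<Longrightarrow> \<bar>s - t\<bar> < r \<Longrightarrow>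
    (\<Sum>e\<in>B. \<bar>\<xi> (Ad G (\<gamma> t) e) - \<xi> (Ad G (\<gamma> s) e)\<bar>) < \<delta> * c" by blast
  define a' b' where "a' = max a (t - r / 2)" and "b' = min b (t + r / 2)"
  have t': "t \<in> {a'..b'}" and sub: "{a'..b'} \<subseteq> {a..b}" and small: "\<And>s. s \<in> {a'..b'} \<Longrightarrow> \<bar>s - t\<bar> < r"
    using ab(2,3) r(1) by (auto simp: a'_def b'_def)
  have "length_minimizing G V N a' b' \<gamma> \<and> ab_length_minimizing V N \<iota> a' b' (ab_proj G \<circ> \<gamma>)"
  proof (rule momentum_close_imp_minimizing[OF B \<delta>(2) \<gamma> _ _ c])
    show "a' \<le> b'" "{a'..b'} \<subseteq> I" using t' sub ab(4) by auto
    assume "c > 0"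
    then show "\<exists>t0\<in>{a'..b'}. \<forall>s\<in>{a'..b'}. (\<Sum>e\<in>B. \<bar>\<xi> (Ad G (\<gamma> t0) e) - \<xi> (Ad G (\<gamma> s) e)\<bar>) < \<delta> * c"
      using t' r(2) sub small by (intro bexI[of _ t]) blast+
  qed
  then have "length_minimizing G V N a' b' \<gamma>" ..
  moreover have "ball t (min e (r / 2)) \<inter> I \<subseteq> {a'..b'}"
  proof
    fix s assume s: "s \<in> ball t (min e (r / 2)) \<inter> I"
    then have "s \<in> {a..b}" "\<bar>t - s\<bar> < r / 2" using ab(5) by (auto simp: dist_real_def)
    then show "s \<in> {a'..b'}" unfolding a'_def b'_def atLeastAtMost_iff by linarith
  qed
  ultimately show "\<exists>a b. t \<in> {a..b} \<and> {a..b} \<subseteq> I \<and> (\<exists>\<epsilon>>0. ball t \<epsilon> \<inter> I \<subseteq> {a..b}) \<and> length_minimizing G V N a b \<gamma>"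
    using t' sub ab(1,4) r(1) by (intro exI[of _ a'] exI[of _ b'] conjI exI[of _ "min e (r / 2)"]) auto
qed

text \<open>
  The momentum at time \<open>0\<close> is \<open>coAd G (\<gamma> 0) \<xi>\<close>, so its coordinates are bounded by the given norm of this covector.
  The growth bound, with the Lie bracket as coefficients, converts this into a Lipschitz constant of the momentum that is
  linear in that norm.
\<close>

theorem normal_curve_projection_minimizing:
  fixes Nstar :: "('a \<Rightarrow>\<^sub>L real) \<Rightarrow> real"
  assumes Nstar: "norm_on UNIV Nstar"
  shows "\<exists>\<alpha>>0. \<forall>\<gamma> \<xi>. normal_curve G V N {0..1} \<gamma> \<and> curve_length G N {0..1} \<gamma> = 1 \<and>
      associated_covector G V N {0..1} \<gamma> \<xi> \<longrightarrow>
    (\<forall>a b. 0 \<le> a \<and> a \<le> b \<and> b \<le> 1 \<and> b - a \<le> \<alpha> / Nstar (coAd G (\<gamma> 0) \<xi>) \<longrightarrow>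
      ab_length_minimizing V N \<iota> a b (ab_proj G \<circ> \<gamma>))"
proof -
  obtain B where B: "finite B" "B \<subseteq> V" "\<And>e. e \<in> B \<Longrightarrow> norm e = 1"
    "\<And>x. x \<in> V \<Longrightarrow> (\<Sum>e\<in>B. (x \<bullet> e) *\<^sub>R e) = x"
    using orthonormal_basis_of_subspace[OF norm_rules(1)] by metis
  obtain \<delta> where \<delta>: "\<delta> > 0" "\<And>y. y \<in> dual_sphere V F \<Longrightarrow> \<exists>\<eta>\<in>dual_sphere V F. \<forall>z\<in>dual_sphere V F.
    dist y z < \<delta> \<longrightarrow> (\<forall>f\<in>F. z \<bullet> f = 1 \<longrightarrow> \<eta> \<bullet> f = 1)"
    using dual_sphere_uniform_face[OF norm finite_F hull] by blast
  obtain R where R: "R > 0" "\<And>x. x \<in> V \<Longrightarrow> norm x \<le> R * N x"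
    using polyhedral_norm_le[OF norm finite_F hull] by metis
  define K where "K = (\<Sum>b\<in>Basis. onorm (\<lambda>u. lie_bracket G u (b :: 'a)))"
  have bl: "bounded_linear (\<lambda>u. lie_bracket G u b)" for b
    using linear_lie_bracket_left by (simp add: linear_conv_bounded_linear)
  have "K \<ge> 0" unfolding K_def by (intro sum_nonneg onorm_pos_le bl)
  have K: "norm (lie_bracket G u b) \<le> K * norm u" if "b \<in> Basis" for u b
  proof -
    have "norm (lie_bracket G u b) \<le> onorm (\<lambda>u. lie_bracket G u b) * norm u" by (rule onorm[OF bl])
    also have "\<dots> \<le> K * norm u"
      unfolding K_def by (intro mult_right_mono member_le_sum that onorm_pos_le bl) auto
    finally show ?thesis .
  qed
  have "K * R \<ge> 0" using \<open>K \<ge> 0\<close> R(1) by simp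
  obtain m :: nat where "real m > max 1 (2 * (K * R * DIM('a)))" using reals_Archimedean2 by blast
  then have m: "0 < real m" "2 * (K * R * DIM('a)) \<le> real m" by auto
  define C where "C = K * R * 2 ^ m"
  have "C \<ge> 0" using \<open>K * R \<ge> 0\<close> by (simp add: C_def)
  obtain C' where C': "C' > 0" "\<And>\<xi>. norm \<xi> \<le> C' * Nstar \<xi>"
    using norm_on_dual_ge[OF Nstar] by metis
  define K1 where "K1 = card B * (DIM('a) * (C * (DIM('a) * C')))"
  have "K1 \<ge> 0" using \<open>C \<ge> 0\<close> C'(1) by (simp add: K1_def)
  \<comment> \<open>The normalized momentum moves by at most \<open>K1\<close> times the norm of the initial covector times
    the elapsed time.\<close>
  define \<alpha> where "\<alpha> = \<delta> / (K1 + 1)"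
  have \<alpha>: "\<alpha> > 0" "K1 * \<alpha> < \<delta>" using \<delta>(1) \<open>K1 \<ge> 0\<close> by (auto simp: \<alpha>_def field_simps)
  show ?thesis
  proof (intro exI[of _ \<alpha>] conjI \<alpha>(1) allI impI)
    fix \<gamma> \<xi> and a b :: real
    assume *: "normal_curve G V N {0..1} \<gamma> \<and> curve_length G N {0..1} \<gamma> = 1 \<and> associated_covector G V N {0..1} \<gamma> \<xi>"
      and ab: "0 \<le> a \<and> a \<le> b \<and> b \<le> 1 \<and> b - a \<le> \<alpha> / Nstar (coAd G (\<gamma> 0) \<xi>)"
    have \<gamma>: "horizontal G V {0..1} \<gamma>" "associated_covector G V N {0..1} \<gamma> \<xi>"
      using * by (auto simp: normal_curve_def)
    then have ac: "ac_curve G {0..1} \<gamma>" by (simp add: horizontal_def)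
    obtain c where c: "c \<ge> 0" "\<And>t. t \<in> {0..1} \<Longrightarrow> (MAX f\<in>F. \<xi> (Ad G (\<gamma> t) f)) = c"
      "AE t in lebesgue_on {0..1}. N (control G {0..1} \<gamma> t) = c"
      using constant_speed[OF \<gamma>] by blast
    have "c = 1"
      using curve_length_const_speed[OF _ c(1,3)] * by simp
    define \<zeta> where "\<zeta> = coAd G (\<gamma> 0) \<xi>"
    define p where "p X t = \<xi> (Ad G (\<gamma> t) X)" for X t
    define S where "S t = (\<Sum>j\<in>Basis. \<bar>p j t\<bar>)" for t
    have p_lin: "linear (\<lambda>X. p X t)" for t unfolding p_def by (rule linear_momentum)
    have p_expand: "p X t = (\<Sum>j\<in>Basis. (X \<bullet> j) * p j t)" for X t
      by (subst euclidean_representation[of X, symmetric])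
        (simp only: linear_sum[OF p_lin] linear_scale[OF p_lin] real_scaleR_def)
    have S0: "S 0 \<le> DIM('a) * C' * Nstar \<zeta>"
    proof -
      have "\<bar>p j 0\<bar> \<le> C' * Nstar \<zeta>" if "j \<in> Basis" for j
      proof -
        have "bounded_linear (\<lambda>X. \<xi> (Ad G (\<gamma> 0) X))"
          using linear_momentum by (simp add: linear_conv_bounded_linear)
        then have "p j 0 = \<zeta> j" by (simp add: p_def \<zeta>_def coAd_def bounded_linear_Blinfun_apply)
        then show ?thesis using norm_blinfun[of \<zeta> j] C'(2)[of \<zeta>] that by simp
      qed
      then have "S 0 \<le> (\<Sum>j\<in>(Basis :: 'a set). C' * Nstar \<zeta>)" unfolding S_def by (rule sum_mono)
      then show ?thesis by (simp add: mult.assoc)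
    qed
    have growth: "\<bar>p i t - p i s\<bar> \<le> C * S 0 * (t - s)" if "i \<in> Basis" "0 \<le> s" "s \<le> t" "t \<le> 1" for i s t
      unfolding S_def C_def
    proof (rule abs_continuous_linear_growth_bound[OF \<open>K * R \<ge> 0\<close> m _ _ that])
      fix j :: 'a assume j: "j \<in> Basis"
      show "abs_continuous_on {0..1} (p j)"
        unfolding p_def[abs_def] by (rule momentum_abs_continuous[OF ac order_refl])
      show "AE \<tau> in lebesgue_on {0..1}. \<exists>d. (p j has_real_derivative d) (at \<tau> within {0..1}) \<and>
        \<bar>d\<bar> \<le> K * R * (\<Sum>j\<in>Basis. \<bar>p j \<tau>\<bar>)"
        using extremal_AE[OF \<gamma> order_refl] c(3)
      proof eventually_elim
        fix \<tau>
        let ?u = "control G {0..1} \<gamma> \<tau>"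
        assume \<tau>: "\<tau> \<in> {0<..<1} \<and> left_shift G \<gamma> \<tau> differentiable (at \<tau> within {0..1}) \<and> ?u \<in> V \<and>
          (\<lambda>X. \<xi> (Ad G (\<gamma> \<tau>) X)) \<in> subdifferential V (energy N) ?u" and "N ?u = c"
        let ?w = "lie_bracket G ?u j"
        have "(p j has_real_derivative p ?w \<tau>) (at \<tau> within {0..1})"
          using momentum_has_derivative[of "{0..1}" \<gamma> \<tau> \<xi> j] ac \<tau> by (simp add: p_def[abs_def] ac_curve_def)
        moreover have "\<bar>p ?w \<tau>\<bar> \<le> K * R * S \<tau>"
        proof -
          have "norm ?u \<le> R" using R(2)[of ?u] \<tau> \<open>N ?u = c\<close> \<open>c = 1\<close> by simp
          then have "norm ?w \<le> K * R" using K[OF j, of ?u] \<open>K \<ge> 0\<close> by (meson mult_left_mono order_trans)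
          then have "\<bar>?w \<bullet> i\<bar> \<le> K * R" if "i \<in> Basis" for i
            using Basis_le_norm[OF that, of ?w] by linarith
          then have "(\<Sum>i\<in>Basis. \<bar>?w \<bullet> i\<bar> * \<bar>p i \<tau>\<bar>) \<le> (\<Sum>i\<in>Basis. K * R * \<bar>p i \<tau>\<bar>)"
            by (intro sum_mono mult_right_mono) auto
          moreover have "\<bar>p ?w \<tau>\<bar> \<le> (\<Sum>i\<in>Basis. \<bar>?w \<bullet> i\<bar> * \<bar>p i \<tau>\<bar>)"
            unfolding p_expand[of ?w] using sum_abs[of "\<lambda>i. (?w \<bullet> i) * p i \<tau>" Basis] by (simp add: abs_mult)
          ultimately show ?thesis by (simp add: S_def sum_distrib_left)
        qed
        ultimately show "\<exists>d. (p j has_real_derivative d) (at \<tau> within {0..1}) \<and> \<bar>d\<bar> \<le> K * R * (\<Sum>j\<in>Basis. \<bar>p j \<tau>\<bar>)"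
          unfolding S_def by blast
      qed
    qed
    \<comment> \<open>If the covector is zero, then the division by zero in the bound forces \<open>a = b\<close>.\<close>
    have Nba: "Nstar \<zeta> * (b - a) \<le> \<alpha>"
    proof (cases "Nstar \<zeta> = 0")
      case False
      then have "Nstar \<zeta> > 0" using norm_onD(2)[OF Nstar, of \<zeta>] by simp
      then show ?thesis using ab by (simp add: \<zeta>_def[symmetric] pos_le_divide_eq mult.commute)
    qed (use \<alpha> in simp)
    have "(\<Sum>e\<in>B. \<bar>p e a - p e t\<bar>) < \<delta>" if t: "t \<in> {a..b}" for t
    proof -
      have "\<bar>p e a - p e t\<bar> \<le> DIM('a) * (C * S 0 * (b - a))" if e: "e \<in> B" for e
      proof -
        have "p e a - p e t = (\<Sum>i\<in>Basis. (e \<bullet> i) * (p i a - p i t))"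
          unfolding p_expand[of e] by (simp add: sum_subtractf right_diff_distrib)
        also have "\<bar>\<dots>\<bar> \<le> (\<Sum>i\<in>Basis. \<bar>(e \<bullet> i) * (p i a - p i t)\<bar>)" by (rule sum_abs)
        also have "\<dots> \<le> (\<Sum>i\<in>(Basis :: 'a set). C * S 0 * (b - a))"
        proof (rule sum_mono)
          fix i :: 'a assume i: "i \<in> Basis"
          have "\<bar>e \<bullet> i\<bar> \<le> 1" using Basis_le_norm[OF i, of e] B(3)[OF e] by simp
          then have "\<bar>(e \<bullet> i) * (p i a - p i t)\<bar> \<le> 1 * \<bar>p i a - p i t\<bar>"
            unfolding abs_mult by (rule mult_right_mono) simp
          also have "\<dots> \<le> C * S 0 * (t - a)"
            using growth[OF i, of a t] ab t by (simp add: abs_minus_commute)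
          also have "\<dots> \<le> C * S 0 * (b - a)"
            using t \<open>C \<ge> 0\<close> by (intro mult_left_mono mult_nonneg_nonneg) (auto simp: S_def sum_nonneg)
          finally show "\<bar>(e \<bullet> i) * (p i a - p i t)\<bar> \<le> C * S 0 * (b - a)" .
        qed
        finally show ?thesis by simp
      qed
      then have "(\<Sum>e\<in>B. \<bar>p e a - p e t\<bar>) \<le> (\<Sum>e\<in>B. DIM('a) * (C * S 0 * (b - a)))" by (rule sum_mono)
      also have "\<dots> = card B * (DIM('a) * (C * S 0 * (b - a)))" by simp
      also have "\<dots> \<le> card B * (DIM('a) * (C * (DIM('a) * C' * Nstar \<zeta>) * (b - a)))"
        using S0 \<open>C \<ge> 0\<close> ab by (intro mult_left_mono mult_right_mono) auto
      also have "\<dots> = K1 * (Nstar \<zeta> * (b - a))" by (simp add: K1_def mult_ac)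
      also have "\<dots> \<le> K1 * \<alpha>" using Nba \<open>K1 \<ge> 0\<close> by (rule mult_left_mono)
      also have "\<dots> < \<delta>" by (rule \<alpha>(2))
      finally show ?thesis .
    qed
    then have "\<exists>t0\<in>{a..b}. \<forall>t\<in>{a..b}. (\<Sum>e\<in>B. \<bar>\<xi> (Ad G (\<gamma> t0) e) - \<xi> (Ad G (\<gamma> t) e)\<bar>) < \<delta> * c"
      using ab \<open>c = 1\<close> by (intro bexI[of _ a]) (auto simp: p_def)
    then show "ab_length_minimizing V N \<iota> a b (ab_proj G \<circ> \<gamma>)"
      using momentum_close_imp_minimizing[OF B \<delta>(2) \<gamma> _ _ c] ab by auto
  qed
qed

end

theorem corollary1p3:
  fixes G :: "('g::{t2_space, second_countable_topology}, 'a::euclidean_space) lie_group_data"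
    and s :: nat and L :: "nat \<Rightarrow> 'a set" and N :: "'a \<Rightarrow> real" and \<iota> :: "'g set \<Rightarrow> 'a"
  assumes "carnot_group G s L"
    and "norm_on (L 1) N"
    and "polyhedral (L 1) N"
    and "abelianization_identification G (L 1) \<iota>"
  shows "(\<forall>I \<gamma>. normal_curve G (L 1) N I \<gamma> \<longrightarrow> locally_length_minimizing G (L 1) N I \<gamma>) \<and>
    (\<forall>Nstar :: ('a \<Rightarrow>\<^sub>L real) \<Rightarrow> real. norm_on UNIV Nstar \<longrightarrow>
      (\<exists>\<alpha>>0. \<forall>\<gamma> \<xi>. normal_curve G (L 1) N {0..1} \<gamma> \<and> curve_length G N {0..1} \<gamma> = 1 \<and>
          associated_covector G (L 1) N {0..1} \<gamma> \<xi> \<longrightarrow>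
        (\<forall>a b. 0 \<le> a \<and> a \<le> b \<and> b \<le> 1 \<and> b - a \<le> \<alpha> / Nstar (coAd G (\<gamma> 0) \<xi>) \<longrightarrow>
          ab_length_minimizing (L 1) N \<iota> a b (ab_proj G \<circ> \<gamma>))))"
proof -
  obtain F where F: "finite F" "{x \<in> L 1. N x \<le> 1} = convex hull F"
    using assms(3) by (auto simp: polyhedral_def)
  have "lie_group G" using assms(1) by (simp add: carnot_group_def)
  then interpret polyhedral_lie_group G "L 1" N F \<iota>
    by (intro polyhedral_lie_group.intro polyhedral_lie_group_axioms.intro assms F)
  show ?thesis
    using normal_curve_locally_minimizing normal_curve_projection_minimizing by blast
qed

end
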